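(* Let $M$ be a smooth surface (2-dimensional manifold). (1) The even Dirac structures on $M$ are exactly the smooth sections of the circle bundle $\mathrm{Lag}_e(\mathbb{T}M)\to M$; that is, every even almost Dirac structure on $M$ is involutive for the Courant bracket, hence is a Dirac structure. (2) The odd Dirac structures on $M$ correspond to regular $1$-dimensional foliations of $M$: the assignment sending a foliation with tangent line bundle $D\subseteq TM$ to the subbundle $D\oplus \mathrm{Ann}(D)\subseteq \mathbb{T}M$ is a bijection from the set of regular $1$-dimensional foliations on $M$ onto the set of odd Dirac structures on $M$.
   Context: For a real vector space $V$ of dimension $n$, $V\oplus V^*$ carries the split-signature inner product $\langle v+\xi,w+\eta\rangle=\tfrac12(\xi(w)+\eta(v))$. A subspace $L\subseteq V\oplus V^*$ is Lagrangian if it is $n$-dimensional and isotropic. The type of $L$ is the pair $(\dim(L\cap V),\dim(L\cap V^* ))$; $L$ is even if the second entry $\dim(L\cap V^* )$ is even and odd otherwise. The set $\mathrm{Lag}(V\oplus V^* )$ of all Lagrangians is diffeomorphic to $O(n)$ and its two components are the set $\mathrm{Lag}_e(V\oplus V^* )$ of even Lagrangians and the set $\mathrm{Lag}_o(V\oplus V^* )$ of odd Lagrangians. For $\dim V=2$ each of these is a circle. For a smooth $n$-manifold $M$, $\mathbb{T}M:=TM\oplus T^*M$ has the pointwise inner product above and the Courant bracket on sections $$[X+\xi,Y+\eta]=[X,Y]+\mathcal{L}_X\eta-\mathcal{L}_Y\xi-\tfrac12 d(\iota_X\eta-\iota_Y\xi).$$ $\mathrm{Lag}(\mathbb{T}M)$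 is the bundle over $M$ with fiber $\mathrm{Lag}(T_xM\oplus T_x^*M)$ at $x$, and $\mathrm{Lag}_e(\mathbb{T}M)$, $\mathrm{Lag}_o(\mathbb{T}M)$ are the subbundles with fibers $\mathrm{Lag}_e(T_xM\oplus T^*_xM)$, $\mathrm{Lag}_o(T_xM\oplus T^*_xM)$. When $M$ is a surface these are circle bundles; via $\Pi\mapsto\mathrm{Graph}(\Pi)$ for bivectors $\Pi\in\wedge^2T_xM$ viewed as skew maps $T_x^*M\to T_xM$ (or via $\omega\mapsto\mathrm{Graph}(\omega)$ for $\omega\in\wedge^2T^*_xM$), $\mathrm{Lag}_e(\mathbb{T}M)$ is a fiberwise compactification of the line bundle $\wedge^2TM$ (or $\wedge^2T^*M$). An almost Dirac structure on $M$ is a smooth Lagrangian subbundle $E\subseteq\mathbb{T}M$, equivalently a smooth section of $\mathrm{Lag}(\mathbb{T}M)$. It is a Dirac structure if it is involutive: the Courant bracket of two sections of $E$ is again a section of $E$. An (almost) Dirac structure $E$ is even (resp. odd) if every $E_x$ is an even (resp. odd) Lagrangian. $\mathrm{Ann}(D)\subseteq T^*M$ denotes the annihilator of $D\subseteq TM$. *)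

theory Defs
  imports "HOL-Analysis.Analysis" "HOL-Library.Function_Algebras"
begin

section \<open>Functions with values in a vector space\<close>

text \<open>
  With this instance (on top of the pointwise additive structure of
  \<^theory>\<open>HOL-Library.Function_Algebras\<close>) tangent and cotangent spaces below are linear subspaces of
  function types, so that \<^const>\<open>subspace\<close>, \<^const>\<open>span\<close> and \<^const>\<open>dim\<close> apply to them.
\<close>

instantiation "fun" :: (type, real_vector) real_vector
begin

definition scaleR_fun :: "real \<Rightarrow> ('a \<Rightarrow> 'b) \<Rightarrow> 'a \<Rightarrow> 'b" where
  "scaleR_fun r f = (\<lambda>x. r *\<^sub>R f x)"

instance
  by standard (simp_all add: scaleR_fun_def fun_eq_iff scaleR_add_right scaleR_add_left)

end


section \<open>Lagrangian subspaces of \<open>V \<oplus> V\<^sup>*\<close>\<close>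

text \<open>
  A vector space \<open>V\<close> is a subspace of a type of class \<^class>\<open>real_vector\<close>.  A linear form on \<open>V\<close> is
  extended by \<open>0\<close> outside \<open>V\<close>, so that forms agreeing on \<open>V\<close> are equal.  The sum \<open>V \<oplus> V\<^sup>*\<close> is the
  set \<open>V \<times> dual_space V\<close>.
\<close>

definition dual_space :: "'v::real_vector set \<Rightarrow> ('v \<Rightarrow> real) set" where
  "dual_space V = {\<xi>. (\<forall>v\<in>V. \<forall>w\<in>V. \<xi> (v + w) = \<xi> v + \<xi> w) \<and>
                       (\<forall>r. \<forall>v\<in>V. \<xi> (r *\<^sub>R v) = r * \<xi> v) \<and>
                       (\<forall>v. v \<notin> V \<longrightarrow> \<xi> v = 0)}"

definition annihilator :: "'v::real_vector set \<Rightarrow> 'v set \<Rightarrow> ('v \<Rightarrow> real) set" where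
  "annihilator V D = {\<xi> \<in> dual_space V. \<forall>v\<in>D. \<xi> v = 0}"

definition pairing :: "'v \<times> ('v \<Rightarrow> real) \<Rightarrow> 'v \<times> ('v \<Rightarrow> real) \<Rightarrow> real" where
  "pairing a b = (1/2) * (snd a (fst b) + snd b (fst a))"

definition Lag :: "'v::real_vector set \<Rightarrow> ('v \<times> ('v \<Rightarrow> real)) set set" where
  "Lag V = {L. L \<subseteq> V \<times> dual_space V \<and> subspace L \<and> dim L = dim V \<and>
               (\<forall>a\<in>L. \<forall>b\<in>L. pairing a b = 0)}"

definition Lag_type :: "'v::real_vector set \<Rightarrow> ('v \<times> ('v \<Rightarrow> real)) set \<Rightarrow> nat \<times> nat" where
  "Lag_type V L = (dim (L \<inter> (V \<times> {0})), dim (L \<inter> ({0} \<times> dual_space V)))"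

definition Lag_even :: "'v::real_vector set \<Rightarrow> ('v \<times> ('v \<Rightarrow> real)) set set" where
  "Lag_even V = {L \<in> Lag V. even (snd (Lag_type V L))}"

definition Lag_odd :: "'v::real_vector set \<Rightarrow> ('v \<times> ('v \<Rightarrow> real)) set set" where
  "Lag_odd V = {L \<in> Lag V. odd (snd (Lag_type V L))}"


section \<open>Smooth maps between Euclidean spaces\<close>

text \<open>\<open>C\<^sup>k\<close> maps; only meaningful for open \<open>S\<close>.\<close>

primrec Ck_on :: "nat \<Rightarrow> 'a::euclidean_space set \<Rightarrow> ('a \<Rightarrow> 'b::real_normed_vector) \<Rightarrow> bool" where
  "Ck_on 0 S f \<longleftrightarrow> continuous_on S f"
| "Ck_on (Suc k) S f \<longleftrightarrow> (\<forall>x\<in>S. f differentiable (at x)) \<and>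
     (\<forall>v. Ck_on k S (\<lambda>x. frechet_derivative f (at x) v))"

definition smooth_on :: "'a::euclidean_space set \<Rightarrow> ('a \<Rightarrow> 'b::real_normed_vector) \<Rightarrow> bool" where
  "smooth_on S f \<longleftrightarrow> (\<forall>k. Ck_on k S f)"

text \<open>
  A map from \<open>S\<close> to the Grassmannian of a Euclidean space is smooth if it is so after the standard
  embedding of the Grassmannian, which sends a subspace to the orthogonal projector onto it;
  \<^term>\<open>closest_point W w\<close> is the orthogonal projection of \<open>w\<close> to the subspace \<open>W\<close>.
\<close>

definition smooth_subspace_map_on ::
    "'a::euclidean_space set \<Rightarrow> ('a \<Rightarrow> 'w::euclidean_space set) \<Rightarrow> bool" where
  "smooth_subspace_map_on S W \<longleftrightarrow> (\<forall>w. smooth_on S (\<lambda>x. closest_point (W x) w))"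


section \<open>Smooth manifolds\<close>

text \<open>
  A chart is a pair of an open set \<open>U\<close> and a homeomorphism \<open>\<phi>\<close> of \<open>U\<close> onto an open subset of
  \<open>\<real>\<^sup>n\<close>, with \<open>n = CARD('n)\<close>.  As \<open>\<phi>\<close> is required to be \<^const>\<open>undefined\<close> outside \<open>U\<close>, it is
  determined by its restriction to \<open>U\<close>.
\<close>

type_synonym ('a, 'n) chart = "'a set \<times> ('a \<Rightarrow> real ^ 'n)"

definition chart_on :: "'a topology \<Rightarrow> ('a, 'n::finite) chart \<Rightarrow> bool" where
  "chart_on M c \<longleftrightarrow> openin M (fst c) \<and> snd c \<in> extensional (fst c) \<and> open (snd c ` fst c) \<and>
     homeomorphic_map (subtopology M (fst c)) (top_of_set (snd c ` fst c)) (snd c)"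

abbreviation chart_inv :: "('a, 'n) chart \<Rightarrow> real ^ 'n \<Rightarrow> 'a" where
  "chart_inv c \<equiv> inv_into (fst c) (snd c)"

definition transition :: "('a, 'n) chart \<Rightarrow> ('a, 'n) chart \<Rightarrow> real ^ 'n \<Rightarrow> real ^ 'n" where
  "transition c d = snd d \<circ> chart_inv c"

definition smoothly_compatible :: "('a, 'n::finite) chart \<Rightarrow> ('a, 'n) chart \<Rightarrow> bool" where
  "smoothly_compatible c d \<longleftrightarrow>
     smooth_on (snd c ` (fst c \<inter> fst d)) (transition c d) \<and>
     smooth_on (snd d ` (fst c \<inter> fst d)) (transition d c)"

definition smooth_manifold :: "'a topology \<Rightarrow> ('a, 'n::finite) chart set \<Rightarrow> bool" where
  "smooth_manifold M A \<longleftrightarrow>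
     Hausdorff_space M \<and> second_countable M \<and>
     (\<forall>c\<in>A. chart_on M c) \<and> (\<Union>c\<in>A. fst c) = topspace M \<and>
     (\<forall>c\<in>A. \<forall>d\<in>A. smoothly_compatible c d) \<and>
     (\<forall>c. chart_on M c \<and> (\<forall>d\<in>A. smoothly_compatible c d) \<longrightarrow> c \<in> A)"

definition charts_at :: "('a, 'n) chart set \<Rightarrow> 'a \<Rightarrow> ('a, 'n) chart set" where
  "charts_at A p = {c \<in> A. p \<in> fst c}"


section \<open>Tangent and cotangent spaces\<close>

text \<open>
  A tangent vector at \<open>p\<close> assigns to every chart around \<open>p\<close> its components in this chart; the
  components in different charts are related by the derivative of the transition map.  All other
  pairs are sent to \<open>0\<close>.
\<close>

type_synonym ('a, 'n) tvector = "('a, 'n) chart \<Rightarrow> real ^ 'n"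
type_synonym ('a, 'n) covector = "('a, 'n) tvector \<Rightarrow> real"
type_synonym ('a, 'n) gvector = "('a, 'n) tvector \<times> ('a, 'n) covector"

definition tangent_space :: "('a, 'n::finite) chart set \<Rightarrow> 'a \<Rightarrow> ('a, 'n) tvector set" where
  "tangent_space A p =
     {v. (\<forall>c. c \<notin> charts_at A p \<longrightarrow> v c = 0) \<and>
         (\<forall>c\<in>charts_at A p. \<forall>d\<in>charts_at A p.
            v d = frechet_derivative (transition c d) (at (snd c p)) (v c))}"

abbreviation cotangent_space :: "('a, 'n::finite) chart set \<Rightarrow> 'a \<Rightarrow> ('a, 'n) covector set" where
  "cotangent_space A p \<equiv> dual_space (tangent_space A p)"

text \<open>The tangent vector at \<open>p\<close> with components \<open>u\<close> in the chart \<open>c\<close>.\<close>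

definition tvector_of ::
    "('a, 'n::finite) chart set \<Rightarrow> ('a, 'n) chart \<Rightarrow> 'a \<Rightarrow> real ^ 'n \<Rightarrow> ('a, 'n) tvector" where
  "tvector_of A c p u =
     (\<lambda>d. if d \<in> charts_at A p then frechet_derivative (transition c d) (at (snd c p)) u else 0)"

text \<open>Components of tangent vectors and covectors with respect to the coordinate basis
  \<open>\<partial>\<^sub>i\<close> and its dual basis \<open>dx\<^sup>i\<close>.\<close>

definition covector_coords ::
    "('a, 'n::finite) chart set \<Rightarrow> ('a, 'n) chart \<Rightarrow> 'a \<Rightarrow> ('a, 'n) covector \<Rightarrow> real ^ 'n" where
  "covector_coords A c p \<xi> = (\<chi> i. \<xi> (tvector_of A c p (axis i 1)))"

definition gvector_coords ::
    "('a, 'n::finite) chart set \<Rightarrow> ('a, 'n) chart \<Rightarrow> 'a \<Rightarrow> ('a, 'n) gvector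
      \<Rightarrow> (real ^ 'n) \<times> (real ^ 'n)" where
  "gvector_coords A c p a = (fst a c, covector_coords A c p (snd a))"


section \<open>Vector fields, 1-forms and the Courant bracket\<close>

text \<open>The local representatives of a function, vector field or 1-form in a chart.\<close>

definition fun_local :: "('a, 'n) chart \<Rightarrow> ('a \<Rightarrow> real) \<Rightarrow> real ^ 'n \<Rightarrow> real" where
  "fun_local c f = (\<lambda>x. f (chart_inv c x))"

definition vf_local :: "('a, 'n) chart \<Rightarrow> ('a \<Rightarrow> ('a, 'n) tvector) \<Rightarrow> real ^ 'n \<Rightarrow> real ^ 'n" where
  "vf_local c X = (\<lambda>x. X (chart_inv c x) c)"

definition form_local ::
    "('a, 'n::finite) chart set \<Rightarrow> ('a, 'n) chart \<Rightarrow> ('a \<Rightarrow> ('a, 'n) covector)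
      \<Rightarrow> real ^ 'n \<Rightarrow> real ^ 'n" where
  "form_local A c \<eta> = (\<lambda>x. covector_coords A c (chart_inv c x) (\<eta> (chart_inv c x)))"

text \<open>
  The operations below are given at \<open>p\<close> by their coordinate expressions in some chart around \<open>p\<close>;
  by naturality the result for smooth arguments does not depend on the chart.
\<close>

definition chart_at :: "('a, 'n) chart set \<Rightarrow> 'a \<Rightarrow> ('a, 'n) chart" where
  "chart_at A p = (SOME c. c \<in> charts_at A p)"

definition differential ::
    "('a, 'n::finite) chart set \<Rightarrow> ('a \<Rightarrow> real) \<Rightarrow> 'a \<Rightarrow> ('a, 'n) covector" where
  "differential A f p = (\<lambda>v. if v \<in> tangent_space A p
     then let c = chart_at A p in frechet_derivative (fun_local c f) (at (snd c p)) (v c)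
     else 0)"

text \<open>\<open>[X, Y]\<^sup>i = X\<^sup>j \<partial>\<^sub>j Y\<^sup>i - Y\<^sup>j \<partial>\<^sub>j X\<^sup>i\<close>\<close>

definition lie_bracket ::
    "('a, 'n::finite) chart set \<Rightarrow> ('a \<Rightarrow> ('a, 'n) tvector) \<Rightarrow> ('a \<Rightarrow> ('a, 'n) tvector)
      \<Rightarrow> 'a \<Rightarrow> ('a, 'n) tvector" where
  "lie_bracket A X Y p =
     (let c = chart_at A p; x = snd c p in
      tvector_of A c p
        (frechet_derivative (vf_local c Y) (at x) (vf_local c X x) -
         frechet_derivative (vf_local c X) (at x) (vf_local c Y x)))"

text \<open>\<open>(\<L>\<^sub>X \<eta>)\<^sub>i = X\<^sup>j \<partial>\<^sub>j \<eta>\<^sub>i + \<eta>\<^sub>j \<partial>\<^sub>i X\<^sup>j\<close>, evaluated on \<open>v = v\<^sup>i \<partial>\<^sub>i\<close>\<close>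

definition lie_derivative ::
    "('a, 'n::finite) chart set \<Rightarrow> ('a \<Rightarrow> ('a, 'n) tvector) \<Rightarrow> ('a \<Rightarrow> ('a, 'n) covector)
      \<Rightarrow> 'a \<Rightarrow> ('a, 'n) covector" where
  "lie_derivative A X \<eta> p = (\<lambda>v. if v \<in> tangent_space A p
     then let c = chart_at A p; x = snd c p in
       frechet_derivative (form_local A c \<eta>) (at x) (vf_local c X x) \<bullet> v c +
       form_local A c \<eta> x \<bullet> frechet_derivative (vf_local c X) (at x) (v c)
     else 0)"

definition contraction ::
    "('a \<Rightarrow> ('a, 'n) tvector) \<Rightarrow> ('a \<Rightarrow> ('a, 'n) covector) \<Rightarrow> 'a \<Rightarrow> real" where
  "contraction X \<eta> = (\<lambda>p. \<eta> p (X p))"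

definition courant_bracket ::
    "('a, 'n::finite) chart set \<Rightarrow> ('a \<Rightarrow> ('a, 'n) gvector) \<Rightarrow> ('a \<Rightarrow> ('a, 'n) gvector)
      \<Rightarrow> 'a \<Rightarrow> ('a, 'n) gvector" where
  "courant_bracket A a b =
     (let X = fst \<circ> a; \<xi> = snd \<circ> a; Y = fst \<circ> b; \<eta> = snd \<circ> b in
      (\<lambda>p. (lie_bracket A X Y p,
            lie_derivative A X \<eta> p - lie_derivative A Y \<xi> p -
            (1/2) *\<^sub>R differential A (\<lambda>q. contraction X \<eta> q - contraction Y \<xi> q) p)))"


section \<open>Almost Dirac and Dirac structures\<close>

definition smooth_gsection_on ::
    "('a, 'n::finite) chart set \<Rightarrow> 'a set \<Rightarrow> ('a \<Rightarrow> ('a, 'n) gvector) \<Rightarrow> bool" where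
  "smooth_gsection_on A U a \<longleftrightarrow>
     (\<forall>c\<in>A. smooth_on (snd c ` (fst c \<inter> U))
        (\<lambda>x. gvector_coords A c (chart_inv c x) (a (chart_inv c x))))"

text \<open>
  A family \<open>E\<close> of subspaces of the fibers of \<open>TM \<oplus> T\<^sup>*M\<close> is a smooth subbundle of rank \<open>n\<close> if
  it has smooth local frames; for Lagrangian fibers spanning \<open>n\<close>-tuples are automatically bases.
\<close>

definition almost_dirac ::
    "'a topology \<Rightarrow> ('a, 'n::finite) chart set \<Rightarrow> ('a \<Rightarrow> ('a, 'n) gvector set) \<Rightarrow> bool" where
  "almost_dirac M A E \<longleftrightarrow>
     E \<in> (\<Pi>\<^sub>E p\<in>topspace M. Lag (tangent_space A p)) \<and>
     (\<forall>p\<in>topspace M. \<exists>U s. openin M U \<and> p \<in> U \<and>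
        (\<forall>i::'n. smooth_gsection_on A U (s i)) \<and>
        (\<forall>q\<in>U. E q = span (range (\<lambda>i. s i q))))"

definition sections ::
    "'a topology \<Rightarrow> ('a, 'n::finite) chart set \<Rightarrow> ('a \<Rightarrow> ('a, 'n) gvector set)
      \<Rightarrow> ('a \<Rightarrow> ('a, 'n) gvector) set" where
  "sections M A E = {a \<in> (\<Pi> p\<in>topspace M. E p). smooth_gsection_on A (topspace M) a}"

definition involutive ::
    "'a topology \<Rightarrow> ('a, 'n::finite) chart set \<Rightarrow> ('a \<Rightarrow> ('a, 'n) gvector set) \<Rightarrow> bool" where
  "involutive M A E \<longleftrightarrow>
     (\<forall>a\<in>sections M A E. \<forall>b\<in>sections M A E. courant_bracket A a b \<in> sections M A E)"

definition dirac ::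
    "'a topology \<Rightarrow> ('a, 'n::finite) chart set \<Rightarrow> ('a \<Rightarrow> ('a, 'n) gvector set) \<Rightarrow> bool" where
  "dirac M A E \<longleftrightarrow> almost_dirac M A E \<and> involutive M A E"

definition even_structure ::
    "'a topology \<Rightarrow> ('a, 'n::finite) chart set \<Rightarrow> ('a \<Rightarrow> ('a, 'n) gvector set) \<Rightarrow> bool" where
  "even_structure M A E \<longleftrightarrow> (\<forall>p\<in>topspace M. E p \<in> Lag_even (tangent_space A p))"

definition odd_structure ::
    "'a topology \<Rightarrow> ('a, 'n::finite) chart set \<Rightarrow> ('a \<Rightarrow> ('a, 'n) gvector set) \<Rightarrow> bool" where
  "odd_structure M A E \<longleftrightarrow> (\<forall>p\<in>topspace M. E p \<in> Lag_odd (tangent_space A p))"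

text \<open>
  Smooth sections of the bundle with fibers \<open>Lag_even (tangent_space A p)\<close>.  A chart of \<open>M\<close>
  identifies the fiber of \<open>TM \<oplus> T\<^sup>*M\<close> with \<open>\<real>\<^sup>n \<times> \<real>\<^sup>n\<close>, hence its even Lagrangians with
  points of the Grassmannian of \<open>\<real>\<^sup>n \<times> \<real>\<^sup>n\<close>, of which they form a submanifold.
\<close>

definition smooth_Lag_even_sections ::
    "'a topology \<Rightarrow> ('a, 'n::finite) chart set \<Rightarrow> ('a \<Rightarrow> ('a, 'n) gvector set) set" where
  "smooth_Lag_even_sections M A =
     {E \<in> (\<Pi>\<^sub>E p\<in>topspace M. Lag_even (tangent_space A p)).
        \<forall>c\<in>A. smooth_subspace_map_on (snd c ` fst c)
          (\<lambda>x. gvector_coords A c (chart_inv c x) ` E (chart_inv c x))}"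


section \<open>Regular 1-dimensional foliations of surfaces\<close>

text \<open>
  A foliation is a maximal foliated atlas: a covering by charts \<open>(x, y)\<close> of \<open>M\<close>, whose plaques are
  the curves \<open>y = const\<close>, such that transition maps are locally of the form
  \<open>(x, y) \<mapsto> (f (x, y), g y)\<close>, i.e. send plaques to plaques.
\<close>

definition foliated_compatible :: "('a, 2) chart \<Rightarrow> ('a, 2) chart \<Rightarrow> bool" where
  "foliated_compatible c d \<longleftrightarrow>
     (\<forall>p \<in> fst c \<inter> fst d. \<exists>N (f :: real \<Rightarrow> real \<Rightarrow> real) (g :: real \<Rightarrow> real).
        open N \<and> snd c p \<in> N \<and> N \<subseteq> snd c ` (fst c \<inter> fst d) \<and>
        (\<forall>z\<in>N. transition c d z = vector [f (z $ 1) (z $ 2), g (z $ 2)]))"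

definition foliation :: "'a topology \<Rightarrow> ('a, 2) chart set \<Rightarrow> ('a, 2) chart set \<Rightarrow> bool" where
  "foliation M A F \<longleftrightarrow>
     F \<subseteq> A \<and> (\<Union>c\<in>F. fst c) = topspace M \<and>
     (\<forall>c\<in>F. \<forall>d\<in>F. foliated_compatible c d) \<and>
     (\<forall>c\<in>A. (\<forall>d\<in>F. foliated_compatible c d \<and> foliated_compatible d c) \<longrightarrow> c \<in> F)"

text \<open>The line bundle of vectors tangent to the plaques.\<close>

definition foliation_tangent ::
    "'a topology \<Rightarrow> ('a, 2) chart set \<Rightarrow> ('a, 2) chart set \<Rightarrow> 'a \<Rightarrow> ('a, 2) tvector set" where
  "foliation_tangent M A F =
     (\<lambda>p\<in>topspace M. {v \<in> tangent_space A p. \<exists>c\<in>charts_at F p. v c $ 2 = 0})"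

definition plus_annihilator ::
    "'a topology \<Rightarrow> ('a, 'n::finite) chart set \<Rightarrow> ('a \<Rightarrow> ('a, 'n) tvector set)
      \<Rightarrow> 'a \<Rightarrow> ('a, 'n) gvector set" where
  "plus_annihilator M A D =
     (\<lambda>p\<in>topspace M. D p \<times> annihilator (tangent_space A p) (D p))"

end

theory Submission
  imports Defs
begin

text \<open>
  \<^bold>\<open>Involutivity.\<close>  In a chart let \<open>a = X + \<xi>\<close>, \<open>b = Y + \<eta>\<close>, \<open>c = Z + \<zeta>\<close> be sections of
  a Lagrangian subbundle \<open>E\<close>, and let \<open>D\<^sub>u\<close> be the derivative of components in the direction \<open>u\<close>.
  The isotropy of \<open>E\<close> turns \<open>\<langle>[a, b], c\<rangle>\<close> into the cyclic sum
  \<open>\<langle>D\<^sub>X b, c\<rangle> + \<langle>D\<^sub>Y c, a\<rangle> + \<langle>D\<^sub>Z a, b\<rangle>\<close>.  Differentiating \<open>\<langle>b, c\<rangle> = 0\<close> shows that \<open>\<langle>D\<^sub>u b, c\<rangle>\<close>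
  is skew in \<open>b\<close> and \<open>c\<close> and vanishes at a point as soon as one of \<open>b\<close>, \<open>c\<close> does.  Hence the cyclic
  sum is an alternating trilinear form on the fibre of \<open>E\<close>, which is zero because the fibre has
  dimension two (\<open>courant_bracket_pairing_zero\<close>).  A Lagrangian is its own orthogonal complement,
  so \<open>[a, b]\<close> lies in \<open>E\<close>: on a surface every almost Dirac structure, even or odd, is a Dirac
  structure (\<open>almost_dirac_involutive\<close>).  The bracket is defined pointwise through a chart chosen at
  each point, so its smoothness rests on the invariance of the coordinate formulas under changes of
  charts, which in turn is the symmetry of second derivatives (\<open>courant_bracket_coords\<close>).

  \<^bold>\<open>Even structures.\<close>  It remains to see that a plane field has smooth local frames if and only if
  its orthogonal projector is smooth in every chart: Gram--Schmidt expresses the projector by a frame,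
  and the projections of a basis of one fibre form a frame of the nearby fibres
  (\<open>even_almost_dirac_iff\<close>).

  \<^bold>\<open>Odd structures.\<close>  An odd Lagrangian \<open>L\<close> in dimension two meets the cotangent space in a line.
  Isotropy then forces \<open>L = D \<oplus> Ann D\<close> for a line \<open>D\<close> (\<open>odd_Lagrangian_split\<close>).  So odd Dirac
  structures are smooth line fields, and the claim becomes the correspondence between line fields and
  foliations.  A foliation \<open>F\<close> consists of all charts adapted to its tangent line field, that is, of
  all charts in which this field is horizontal (\<open>foliation_eq_adapted\<close>), so the line field determines
  \<open>F\<close>.  Conversely adapted charts exist around each point by the flow box theorem (\<open>flow_box\<close>).
  For the latter, the field is written as \<open>(1, h)\<close>, the scalar equation
  \<open>y' = h (x, y)\<close> is solved jointly in the initial value \<open>c\<close> by Picard iteration, and the formula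
  \<open>\<partial>y/\<partial>c = exp (\<integral> \<partial>h/\<partial>y)\<close> bootstraps smoothness of the solution.
\<close>

section \<open>Smooth maps between Euclidean spaces\<close>

abbreviation jac :: "('a::euclidean_space \<Rightarrow> 'b::real_normed_vector) \<Rightarrow> 'a \<Rightarrow> 'a \<Rightarrow> 'b" where
  "jac f x \<equiv> frechet_derivative f (at x)"

lemma Ck_on_cong:
  assumes "open S" "\<And>x. x \<in> S \<Longrightarrow> f x = g x" "Ck_on k S f"
  shows "Ck_on k S g"
  using assms(2,3)
proof (induction k arbitrary: f g)
  case 0
  then show ?case by (simp cong: continuous_on_cong)
next
  case (Suc k)
  have d: "(g has_derivative jac f x) (at x)" if "x \<in> S" for x
    using Suc.prems that assms(1)
    by (auto intro: has_derivative_transform_within_open[of f _ x UNIV S g] simp: frechet_derivative_works)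
  then have fd: "jac g x = jac f x" if "x \<in> S" for x
    using frechet_derivative_at that by metis
  show ?case
    using Suc.IH[of "\<lambda>x. jac f x v" "\<lambda>x. jac g x v" for v] Suc.prems d fd
    by (auto simp: differentiable_def)
qed

text \<open>
  The form in which \<open>C\<^sup>k\<close> regularity is proved below: it allows any known expression for the
  derivative in place of the chosen one.
\<close>
lemma Ck_on_SucI:
  assumes "open S" "\<And>x. x \<in> S \<Longrightarrow> (f has_derivative f' x) (at x)" "\<And>v. Ck_on k S (\<lambda>x. f' x v)"
  shows "Ck_on (Suc k) S f"
proof -
  have "jac f x = f' x" if "x \<in> S" for x
    using frechet_derivative_at assms(2) that by metis
  then have "Ck_on k S (\<lambda>x. jac f x v)" for v
    by (intro Ck_on_cong[OF assms(1) _ assms(3)[of v]]) auto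
  then show ?thesis using assms(2) by (auto simp: differentiable_def)
qed

lemma Ck_on_SucD: "Ck_on (Suc k) S f \<Longrightarrow> Ck_on k S f"
proof (induction k arbitrary: f)
  case 0
  then show ?case
    by (auto intro!: differentiable_imp_continuous_on differentiable_at_imp_differentiable_on)
next
  case (Suc k)
  then show ?case by (metis Ck_on.simps(2))
qed

lemma Ck_on_has_derivative:
  "Ck_on (Suc k) S f \<Longrightarrow> x \<in> S \<Longrightarrow> (f has_derivative jac f x) (at x)"
  by (simp add: frechet_derivative_works)

lemma Ck_on_const: "open S \<Longrightarrow> Ck_on k S (\<lambda>x. c)"
proof (induction k arbitrary: c)
  case (Suc k)
  show ?case by (rule Ck_on_SucI[where f'="\<lambda>x v. 0"]) (use Suc in auto)
qed simp

lemma Ck_on_bounded_linear: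
  assumes "open S" "bounded_linear L" "Ck_on k S f"
  shows "Ck_on k S (\<lambda>x. L (f x))"
  using assms(3)
proof (induction k arbitrary: f)
  case 0
  then show ?case using assms(2) by (simp add: bounded_linear.continuous_on)
next
  case (Suc k)
  show ?case
    by (rule Ck_on_SucI[OF assms(1) bounded_linear.has_derivative[OF assms(2) Ck_on_has_derivative[OF Suc.prems]]])
       (use Suc in auto)
qed

lemma Ck_on_id: "open S \<Longrightarrow> Ck_on k S (\<lambda>x. x)"
proof (cases k)
  case (Suc j)
  assume "open S"
  then show ?thesis unfolding Suc by (intro Ck_on_SucI[where f'="\<lambda>x v. v"] Ck_on_const) auto
qed simp

lemma Ck_on_add:
  assumes "open S" "Ck_on k S f" "Ck_on k S g"
  shows "Ck_on k S (\<lambda>x. f x + g x)"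
  using assms(2,3)
proof (induction k arbitrary: f g)
  case 0
  then show ?case by (simp add: continuous_on_add)
next
  case (Suc k)
  show ?case
    by (rule Ck_on_SucI[OF assms(1) has_derivative_add[OF Ck_on_has_derivative[OF Suc.prems(1)] Ck_on_has_derivative[OF Suc.prems(2)]]])
       (use Suc in auto)
qed

lemma Ck_on_bounded_bilinear:
  assumes "open S" "bounded_bilinear B" "Ck_on k S f" "Ck_on k S g"
  shows "Ck_on k S (\<lambda>x. B (f x) (g x))"
  using assms(3,4)
proof (induction k arbitrary: f g)
  case 0
  then show ?case using assms(2) by (simp add: bounded_bilinear.continuous_on)
next
  case (Suc k)
  note s = Ck_on_SucD[OF Suc.prems(1)] Ck_on_SucD[OF Suc.prems(2)]
  show ?case
    by (rule Ck_on_SucI[OF assms(1) bounded_bilinear.FDERIV[OF assms(2) Ck_on_has_derivative[OF Suc.prems(1)] Ck_on_has_derivative[OF Suc.prems(2)]]])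
       (use Suc s assms(1) in \<open>auto intro!: Ck_on_add\<close>)
qed

lemma Ck_on_sum:
  assumes "open S" "\<And>i. i \<in> I \<Longrightarrow> Ck_on k S (f i)"
  shows "Ck_on k S (\<lambda>x. \<Sum>i\<in>I. f i x)"
  using assms(2)
  by (induction I rule: infinite_finite_induct) (auto simp: assms(1) Ck_on_const intro!: Ck_on_add)

lemma Ck_on_Pair:
  assumes "open S" "Ck_on k S f" "Ck_on k S g"
  shows "Ck_on k S (\<lambda>x. (f x, g x))"
proof -
  have "Ck_on k S (\<lambda>x. (f x, 0) + (0, g x))"
    by (intro Ck_on_add assms(1) Ck_on_bounded_linear[OF assms(1) _ assms(2)] Ck_on_bounded_linear[OF assms(1) _ assms(3)]
        bounded_linear_Pair bounded_linear_ident bounded_linear_zero)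
  then show ?thesis by simp
qed

lemma frechet_derivative_basis_expansion:
  fixes f :: "'a::euclidean_space \<Rightarrow> 'b::real_normed_vector"
  assumes "f differentiable (at x)"
  shows "jac f x v = (\<Sum>b\<in>Basis. (v \<bullet> b) *\<^sub>R jac f x b)"
proof -
  have l: "linear (jac f x)" using assms by (rule linear_frechet_derivative)
  have "jac f x v = jac f x (\<Sum>b\<in>Basis. (v \<bullet> b) *\<^sub>R b)"
    by (simp add: euclidean_representation)
  also have "\<dots> = (\<Sum>b\<in>Basis. (v \<bullet> b) *\<^sub>R jac f x b)"
    by (simp only: linear_sum[OF l] linear_scale[OF l])
  finally show ?thesis .
qed

text \<open>
  The chain rule expresses the derivative of \<open>g \<circ> f\<close> through \<open>jac g (f x) b\<close> for basis vectors \<open>b\<close>;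
  these are compositions with derivatives of \<open>g\<close>, to which the induction hypothesis applies.
\<close>
lemma Ck_on_compose:
  fixes f :: "'a::euclidean_space \<Rightarrow> 'b::euclidean_space"
  assumes "open S" "open T" "\<And>x. x \<in> S \<Longrightarrow> f x \<in> T" "Ck_on k S f" "Ck_on k T g"
  shows "Ck_on k S (\<lambda>x. g (f x))"
  using assms(4,5)
proof (induction k arbitrary: g)
  case 0
  then show ?case using assms(3) by (auto intro: continuous_on_compose2)
next
  case (Suc k)
  note s = Ck_on_SucD[OF Suc.prems(1)]
  let ?d = "\<lambda>x v. jac g (f x) (jac f x v)"
  show ?case
  proof (rule Ck_on_SucI[OF assms(1), where f'="?d"])
    fix x assume "x \<in> S"
    then show "((\<lambda>x. g (f x)) has_derivative ?d x) (at x)"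
      using Ck_on_has_derivative[OF Suc.prems(2)] Ck_on_has_derivative[OF Suc.prems(1)] assms(3)
      by (intro has_derivative_compose[of f _ x UNIV g]) auto
  next
    fix v
    have "Ck_on k S (\<lambda>x. \<Sum>b\<in>Basis. (jac f x v \<bullet> b) *\<^sub>R jac g (f x) b)"
      using Suc.prems s
      by (intro Ck_on_sum[OF assms(1)] Ck_on_bounded_bilinear[OF assms(1) bounded_bilinear_scaleR]
          Ck_on_bounded_linear[OF assms(1) bounded_linear_inner_left] Suc.IH) auto
    moreover have "(\<Sum>b\<in>Basis. (jac f x v \<bullet> b) *\<^sub>R jac g (f x) b) = ?d x v"
      if "x \<in> S" for x
      using Suc.prems(2) assms(3) that by (subst frechet_derivative_basis_expansion[of g]) auto
    ultimately show "Ck_on k S (\<lambda>x. ?d x v)"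
      using Ck_on_cong assms(1) by (metis (no_types, lifting))
  qed
qed

lemma Ck_on_local:
  assumes "\<And>x. x \<in> S \<Longrightarrow> \<exists>U. open U \<and> x \<in> U \<and> Ck_on k U f"
  shows "Ck_on k S f"
  using assms
proof (induction k arbitrary: f)
  case 0
  show ?case
    unfolding Ck_on.simps
    by (rule continuous_at_imp_continuous_on)
       (use 0 continuous_on_eq_continuous_at in fastforce)
next
  case (Suc k)
  show ?case
    unfolding Ck_on.simps
    by (intro conjI ballI allI Suc.IH) (use Suc.prems in \<open>fastforce+\<close>)
qed

lemma Ck_on_subset: "Ck_on k S f \<Longrightarrow> T \<subseteq> S \<Longrightarrow> Ck_on k T f"
  by (induction k arbitrary: f) (auto intro: continuous_on_subset)

lemma Ck_on_inverse: "Ck_on k (-{0::real}) inverse"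
proof (induction k)
  case 0
  show ?case by (auto intro!: continuous_intros)
next
  case (Suc k)
  show ?case
    by (rule Ck_on_SucI[where f'="\<lambda>x v. - (inverse x * v * inverse x)"])
       (auto intro!: has_derivative_inverse' Suc Ck_on_const Ck_on_bounded_linear[OF _ bounded_linear_minus[OF bounded_linear_ident]]
         Ck_on_bounded_bilinear[OF _ bounded_bilinear_mult])
qed

lemma Ck_on_exp: "Ck_on k (UNIV::real set) exp"
proof (induction k)
  case 0
  show ?case by (auto intro!: continuous_intros)
next
  case (Suc k)
  show ?case
    by (rule Ck_on_SucI[where f'="\<lambda>x v. v * exp x"])
       (auto intro!: derivative_eq_intros Suc Ck_on_const Ck_on_bounded_bilinear[OF _ bounded_bilinear_mult])
qed

lemma smooth_onD: "smooth_on S f \<Longrightarrow> Ck_on k S f"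
  by (simp add: smooth_on_def)

lemma smooth_on_cong:
  assumes "open S" "\<And>x. x \<in> S \<Longrightarrow> f x = g x" "smooth_on S f"
  shows "smooth_on S g"
  using assms Ck_on_cong by (metis smooth_on_def)

lemma smooth_on_subset: "smooth_on S f \<Longrightarrow> T \<subseteq> S \<Longrightarrow> smooth_on T f"
  by (auto simp: smooth_on_def intro: Ck_on_subset)

lemma smooth_on_local:
  "(\<And>x. x \<in> S \<Longrightarrow> \<exists>U. open U \<and> x \<in> U \<and> smooth_on U f) \<Longrightarrow> smooth_on S f"
  unfolding smooth_on_def by (intro allI Ck_on_local) blast

lemma smooth_on_continuous: "smooth_on S f \<Longrightarrow> continuous_on S f"
  using smooth_onD[of S f 0] by simp

lemma smooth_on_has_derivative:
  "smooth_on S f \<Longrightarrow> x \<in> S \<Longrightarrow> (f has_derivative jac f x) (at x)"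
  using Ck_on_has_derivative smooth_onD by blast

lemma smooth_on_differentiable: "smooth_on S f \<Longrightarrow> x \<in> S \<Longrightarrow> f differentiable (at x)"
  using smooth_on_has_derivative differentiable_def by blast

lemma smooth_on_frechet_derivative: "smooth_on S f \<Longrightarrow> smooth_on S (\<lambda>x. jac f x v)"
  unfolding smooth_on_def by (metis Ck_on.simps(2))

lemma smooth_on_const: "open S \<Longrightarrow> smooth_on S (\<lambda>x. c)"
  by (simp add: smooth_on_def Ck_on_const)

lemma smooth_on_id: "open S \<Longrightarrow> smooth_on S (\<lambda>x. x)"
  by (simp add: smooth_on_def Ck_on_id)

lemma smooth_on_bounded_linear:
  "bounded_linear L \<Longrightarrow> open S \<Longrightarrow> smooth_on S f \<Longrightarrow> smooth_on S (\<lambda>x. L (f x))"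
  by (simp add: smooth_on_def Ck_on_bounded_linear)

lemma smooth_on_bounded_bilinear:
  "bounded_bilinear B \<Longrightarrow> open S \<Longrightarrow> smooth_on S f \<Longrightarrow> smooth_on S g \<Longrightarrow> smooth_on S (\<lambda>x. B (f x) (g x))"
  by (simp add: smooth_on_def Ck_on_bounded_bilinear)

lemma smooth_on_add: "open S \<Longrightarrow> smooth_on S f \<Longrightarrow> smooth_on S g \<Longrightarrow> smooth_on S (\<lambda>x. f x + g x)"
  by (simp add: smooth_on_def Ck_on_add)

lemmas smooth_on_minus = smooth_on_bounded_linear[OF bounded_linear_minus[OF bounded_linear_ident]]
lemmas smooth_on_vec_nth = smooth_on_bounded_linear[OF bounded_linear_vec_nth]
lemmas smooth_on_fst = smooth_on_bounded_linear[OF bounded_linear_fst]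
lemmas smooth_on_snd = smooth_on_bounded_linear[OF bounded_linear_snd]
lemmas smooth_on_mult = smooth_on_bounded_bilinear[OF bounded_bilinear_mult]
lemmas smooth_on_scaleR = smooth_on_bounded_bilinear[OF bounded_bilinear_scaleR]
lemmas smooth_on_inner = smooth_on_bounded_bilinear[OF bounded_bilinear_inner]

lemma smooth_on_diff: "open S \<Longrightarrow> smooth_on S f \<Longrightarrow> smooth_on S g \<Longrightarrow> smooth_on S (\<lambda>x. f x - g x)"
  using smooth_on_add[of S f "\<lambda>x. - g x"] smooth_on_minus[of S g] by simp

lemma smooth_on_sum:
  "open S \<Longrightarrow> (\<And>i. i \<in> I \<Longrightarrow> smooth_on S (f i)) \<Longrightarrow> smooth_on S (\<lambda>x. \<Sum>i\<in>I. f i x)"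
  by (simp add: smooth_on_def Ck_on_sum)

lemma smooth_on_compose:
  fixes f :: "'a::euclidean_space \<Rightarrow> 'b::euclidean_space"
  shows "open S \<Longrightarrow> open T \<Longrightarrow> (\<And>x. x \<in> S \<Longrightarrow> f x \<in> T) \<Longrightarrow> smooth_on S f \<Longrightarrow> smooth_on T g
    \<Longrightarrow> smooth_on S (\<lambda>x. g (f x))"
  unfolding smooth_on_def by (blast intro: Ck_on_compose)

lemma smooth_on_inverse:
  fixes f :: "'a::euclidean_space \<Rightarrow> real"
  assumes "open S" "smooth_on S f" "\<And>x. x \<in> S \<Longrightarrow> f x \<noteq> 0"
  shows "smooth_on S (\<lambda>x. inverse (f x))"
  by (rule smooth_on_compose[OF assms(1) _ _ assms(2), of "-{0}"])
     (use assms in \<open>auto simp: smooth_on_def Ck_on_inverse\<close>)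

lemma smooth_on_divide:
  fixes f :: "'a::euclidean_space \<Rightarrow> real"
  assumes "open S" "smooth_on S f" "smooth_on S g" "\<And>x. x \<in> S \<Longrightarrow> g x \<noteq> 0"
  shows "smooth_on S (\<lambda>x. f x / g x)"
  unfolding divide_inverse by (intro smooth_on_mult smooth_on_inverse assms)

lemma smooth_on_Pair:
  "open S \<Longrightarrow> smooth_on S f \<Longrightarrow> smooth_on S g \<Longrightarrow> smooth_on S (\<lambda>x. (f x, g x))"
  by (simp add: smooth_on_def Ck_on_Pair)

lemma smooth_on_componentwise:
  fixes f :: "'a::euclidean_space \<Rightarrow> 'b::euclidean_space"
  assumes "open S" "\<And>b. b \<in> Basis \<Longrightarrow> smooth_on S (\<lambda>x. f x \<bullet> b)"
  shows "smooth_on S f"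
proof -
  have "smooth_on S (\<lambda>x. \<Sum>b\<in>Basis. (f x \<bullet> b) *\<^sub>R b)"
    by (intro smooth_on_sum smooth_on_scaleR smooth_on_const assms)
  then show ?thesis by (simp add: euclidean_representation)
qed

lemma smooth_on_vec:
  fixes f :: "'a::euclidean_space \<Rightarrow> real ^ 'n"
  assumes "open S" "\<And>i. smooth_on S (\<lambda>x. f x $ i)"
  shows "smooth_on S f"
  by (rule smooth_on_componentwise) (auto simp: assms Basis_vec_def inner_axis)

text \<open>
  Derivatives in a variable direction are combinations, with smooth coefficients, of derivatives in
  the finitely many basis directions.
\<close>
lemma smooth_on_frechet_derivative_apply:
  fixes f :: "'a::euclidean_space \<Rightarrow> 'b::real_normed_vector"
  assumes "open S" "smooth_on S f" "smooth_on S v"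
  shows "smooth_on S (\<lambda>x. jac f x (v x))"
proof -
  have "smooth_on S (\<lambda>x. \<Sum>b\<in>Basis. (v x \<bullet> b) *\<^sub>R jac f x b)"
    by (intro smooth_on_sum smooth_on_scaleR smooth_on_inner smooth_on_const smooth_on_frechet_derivative assms)
  then show ?thesis
    by (rule smooth_on_cong[OF assms(1), rotated])
       (simp add: frechet_derivative_basis_expansion[symmetric] smooth_on_differentiable[OF assms(2)])
qed

lemma frechet_derivative_cong_open:
  assumes "open S" "x \<in> S" "\<And>y. y \<in> S \<Longrightarrow> f y = g y"
  shows "jac f x = jac g x"
proof -
  have "(f has_derivative D) (at x) \<longleftrightarrow> (g has_derivative D) (at x)" for D
    using has_derivative_transform_within_open[of f D x UNIV S g] has_derivative_transform_within_open[of g D x UNIV S f] assms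
    by metis
  then show ?thesis unfolding frechet_derivative_def by simp
qed

section \<open>Symmetry of second derivatives\<close>

text \<open>
  Two applications of the mean value theorem to the second difference over a square.  Since this
  difference is symmetric in both variables, it equals a mixed derivative of either order at some point
  of the square.
\<close>
lemma second_difference_mvt:
  fixes \<phi> :: "real \<Rightarrow> real \<Rightarrow> real"
  assumes h: "h > 0"
    and ds: "\<And>s t. s \<in> {0..h} \<Longrightarrow> t \<in> {0..h} \<Longrightarrow> ((\<lambda>s. \<phi> s t) has_real_derivative \<phi>s s t) (at s)"
    and dst: "\<And>s t. s \<in> {0..h} \<Longrightarrow> t \<in> {0..h} \<Longrightarrow> ((\<lambda>t. \<phi>s s t) has_real_derivative \<phi>st s t) (at t)"
  shows "\<exists>s\<in>{0..h}. \<exists>t\<in>{0..h}. \<phi> h h - \<phi> h 0 - \<phi> 0 h + \<phi> 0 0 = h * h * \<phi>st s t"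
proof -
  have "\<exists>s. 0 < s \<and> s < h \<and> (\<phi> h h - \<phi> h 0) - (\<phi> 0 h - \<phi> 0 0) = (h - 0) * (\<phi>s s h - \<phi>s s 0)"
    using h by (intro MVT2[where f="\<lambda>s. \<phi> s h - \<phi> s 0"]) (auto intro!: derivative_intros ds)
  then obtain s where s: "0 < s" "s < h" "(\<phi> h h - \<phi> h 0) - (\<phi> 0 h - \<phi> 0 0) = h * (\<phi>s s h - \<phi>s s 0)" by auto
  have "\<exists>t. 0 < t \<and> t < h \<and> \<phi>s s h - \<phi>s s 0 = (h - 0) * \<phi>st s t"
    using h s by (intro MVT2[where f="\<lambda>t. \<phi>s s t"]) (auto intro!: derivative_intros dst)
  then obtain t where "0 < t" "t < h" "\<phi>s s h - \<phi>s s 0 = h * \<phi>st s t" by auto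
  with s show ?thesis by (intro bexI[of _ s] bexI[of _ t]) (auto simp: algebra_simps)
qed

lemma second_derivative_symmetric_real:
  fixes f :: "'a::euclidean_space \<Rightarrow> real"
  assumes "open S" "x \<in> S" "smooth_on S f"
  shows "jac (\<lambda>y. jac f y u) x v =
         jac (\<lambda>y. jac f y v) x u"
proof (rule ccontr)
  define F where "F = (\<lambda>u v y. jac (\<lambda>y. jac f y u) y v)"
  assume "\<not> ?thesis"
  then have ne: "F u v x \<noteq> F v u x" by (simp add: F_def)
  have sF: "smooth_on S (F u v)" for u v
    unfolding F_def by (intro smooth_on_frechet_derivative assms)
  define e where "e = dist (F u v x) (F v u x) / 2"
  have "e > 0" using ne by (simp add: e_def)
  have cont: "\<exists>d>0. \<forall>y. dist y x < d \<longrightarrow> dist (F u v y) (F u v x) < e" for u v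
    using smooth_on_continuous[OF sF] assms(1,2) \<open>e > 0\<close>
    by (simp add: continuous_on_eq_continuous_at continuous_at_eps_delta)
  obtain d1 where d1: "d1 > 0" "\<And>y. dist y x < d1 \<Longrightarrow> dist (F u v y) (F u v x) < e"
    using cont[of u v] by auto
  obtain d2 where d2: "d2 > 0" "\<And>y. dist y x < d2 \<Longrightarrow> dist (F v u y) (F v u x) < e"
    using cont[of v u] by auto
  note d = d1 d2
  obtain d3 where d3: "d3 > 0" "ball x d3 \<subseteq> S" using assms(1,2) openE by blast
  \<comment> \<open>A side length that keeps the parallelogram spanned by \<open>h u\<close> and \<open>h v\<close> in \<open>S\<close> and where both
    mixed derivatives vary by less than \<open>e\<close>.\<close>
  define h where "h = min d1 (min d2 d3) / (norm u + norm v + 1)"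
  have pos: "norm u + norm v + 1 > 0" by (simp add: add_nonneg_pos)
  have h: "h > 0" using d d3 pos by (simp add: h_def)
  have near: "dist (x + s *\<^sub>R u + t *\<^sub>R v) x < min d1 (min d2 d3)" if "s \<in> {0..h}" "t \<in> {0..h}" for s t
  proof -
    have "dist (x + s *\<^sub>R u + t *\<^sub>R v) x \<le> s * norm u + t * norm v"
      using that norm_triangle_ineq[of "s *\<^sub>R u" "t *\<^sub>R v"] by (simp add: dist_norm add.assoc)
    also have "\<dots> \<le> h * norm u + h * norm v"
      using that by (intro add_mono mult_right_mono) auto
    also have "\<dots> < h * (norm u + norm v + 1)" using h by (simp add: algebra_simps)
    also have "\<dots> = min d1 (min d2 d3)" using pos by (simp add: h_def)
    finally show ?thesis .
  qed
  then have inS: "x + s *\<^sub>R u + t *\<^sub>R v \<in> S" if "s \<in> {0..h}" "t \<in> {0..h}" for s t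
    using d3 that by (force simp: dist_commute)
  define \<phi> where "\<phi> = (\<lambda>s t. f (x + s *\<^sub>R u + t *\<^sub>R v))"
  have drv: "((\<lambda>s. g (x + s *\<^sub>R u + t *\<^sub>R v)) has_real_derivative jac g (x + s *\<^sub>R u + t *\<^sub>R v) u) (at s)"
     "((\<lambda>t. g (x + s *\<^sub>R u + t *\<^sub>R v)) has_real_derivative jac g (x + s *\<^sub>R u + t *\<^sub>R v) v) (at t)"
    if "s \<in> {0..h}" "t \<in> {0..h}" "smooth_on S g" for g s t
  proof -
    note gd = smooth_on_has_derivative[OF that(3) inS[OF that(1,2)]]
    have l: "linear (jac g (x + s *\<^sub>R u + t *\<^sub>R v))"
      using gd has_derivative_linear by blast
    have "((\<lambda>s. g (x + s *\<^sub>R u + t *\<^sub>R v)) has_derivative (\<lambda>r. jac g (x + s *\<^sub>R u + t *\<^sub>R v) (r *\<^sub>R u))) (at s)"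
      by (rule has_derivative_compose[where f = "\<lambda>s. x + s *\<^sub>R u + t *\<^sub>R v" and g = g]) (auto intro!: derivative_eq_intros gd)
    then show "((\<lambda>s. g (x + s *\<^sub>R u + t *\<^sub>R v)) has_real_derivative jac g (x + s *\<^sub>R u + t *\<^sub>R v) u) (at s)"
      unfolding has_field_derivative_def linear_scale[OF l] by (simp add: mult_commute_abs)
    have "((\<lambda>t. g (x + s *\<^sub>R u + t *\<^sub>R v)) has_derivative (\<lambda>r. jac g (x + s *\<^sub>R u + t *\<^sub>R v) (r *\<^sub>R v))) (at t)"
      by (rule has_derivative_compose[where f = "\<lambda>t. x + s *\<^sub>R u + t *\<^sub>R v" and g = g]) (auto intro!: derivative_eq_intros gd)
    then show "((\<lambda>t. g (x + s *\<^sub>R u + t *\<^sub>R v)) has_real_derivative jac g (x + s *\<^sub>R u + t *\<^sub>R v) v) (at t)"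
      unfolding has_field_derivative_def linear_scale[OF l] by (simp add: mult_commute_abs)
  qed
  obtain s t where st: "s \<in> {0..h}" "t \<in> {0..h}"
      "\<phi> h h - \<phi> h 0 - \<phi> 0 h + \<phi> 0 0 = h * h * F u v (x + s *\<^sub>R u + t *\<^sub>R v)"
    using second_difference_mvt[OF h, of \<phi> "\<lambda>s t. jac f (x + s *\<^sub>R u + t *\<^sub>R v) u"
        "\<lambda>s t. F u v (x + s *\<^sub>R u + t *\<^sub>R v)"]
      drv(1)[OF _ _ assms(3)] drv(2)[OF _ _ smooth_on_frechet_derivative[OF assms(3)]]
    unfolding \<phi>_def F_def by blast
  obtain s' t' where st': "s' \<in> {0..h}" "t' \<in> {0..h}"
      "\<phi> h h - \<phi> 0 h - \<phi> h 0 + \<phi> 0 0 = h * h * F v u (x + s' *\<^sub>R u + t' *\<^sub>R v)"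
    using second_difference_mvt[OF h, of "\<lambda>t s. \<phi> s t" "\<lambda>t s. jac f (x + s *\<^sub>R u + t *\<^sub>R v) v"
        "\<lambda>t s. F v u (x + s *\<^sub>R u + t *\<^sub>R v)"]
      drv(2)[OF _ _ assms(3)] drv(1)[OF _ _ smooth_on_frechet_derivative[OF assms(3)]]
    unfolding \<phi>_def F_def by blast
  have "h * h * F u v (x + s *\<^sub>R u + t *\<^sub>R v) = h * h * F v u (x + s' *\<^sub>R u + t' *\<^sub>R v)"
    using st(3) st'(3) by linarith
  then have eq: "F u v (x + s *\<^sub>R u + t *\<^sub>R v) = F v u (x + s' *\<^sub>R u + t' *\<^sub>R v)" using h by simp
  have "dist (F u v (x + s *\<^sub>R u + t *\<^sub>R v)) (F u v x) < e" using d near st(1,2) by simp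
  moreover have "dist (F v u (x + s' *\<^sub>R u + t' *\<^sub>R v)) (F v u x) < e" using d near st'(1,2) by simp
  ultimately have "dist (F u v x) (F v u x) < e + e"
    unfolding eq using dist_triangle2[of "F u v x" "F v u x" "F v u (x + s' *\<^sub>R u + t' *\<^sub>R v)"]
    by (simp add: dist_commute)
  then show False by (simp add: e_def)
qed

lemma frechet_derivative_bounded_linear:
  assumes "bounded_linear L" "f differentiable (at x)"
  shows "jac (\<lambda>y. L (f y)) x v = L (jac f x v)"
  using frechet_derivative_at[OF bounded_linear.has_derivative[OF assms(1), of f "jac f x" "at x"]]
    assms(2) by (metis frechet_derivative_works)

lemma second_derivative_symmetric:
  fixes f :: "'a::euclidean_space \<Rightarrow> 'b::euclidean_space"
  assumes "open S" "x \<in> S" "smooth_on S f"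
  shows "jac (\<lambda>y. jac f y u) x v =
         jac (\<lambda>y. jac f y v) x u"
proof (rule euclidean_eqI)
  fix b :: 'b assume "b \<in> Basis"
  have s: "smooth_on S (\<lambda>y. f y \<bullet> b)" by (intro smooth_on_inner smooth_on_const assms)
  have e: "jac (\<lambda>y. jac f y u) x v \<bullet> b =
     jac (\<lambda>y. jac (\<lambda>y. f y \<bullet> b) y u) x v" for u v
  proof -
    have "jac (\<lambda>y. jac f y u) x v \<bullet> b =
      jac (\<lambda>y. jac f y u \<bullet> b) x v"
      by (rule frechet_derivative_bounded_linear[symmetric, OF bounded_linear_inner_left])
         (rule smooth_on_differentiable[OF smooth_on_frechet_derivative[OF assms(3)] assms(2)])
    also have "jac (\<lambda>y. jac f y u \<bullet> b) x =
        jac (\<lambda>y. jac (\<lambda>y. f y \<bullet> b) y u) x"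
      by (rule frechet_derivative_cong_open[OF assms(1,2)], rule sym,
          rule frechet_derivative_bounded_linear[OF bounded_linear_inner_left])
         (rule smooth_on_differentiable[OF assms(3)])
    finally show ?thesis .
  qed
  show "jac (\<lambda>y. jac f y u) x v \<bullet> b =
         jac (\<lambda>y. jac f y v) x u \<bullet> b"
    unfolding e by (rule second_derivative_symmetric_real[OF assms(1,2) s])
qed

section \<open>Flow boxes in the plane\<close>

text \<open>
  The integral of \<open>g\<close> from \<open>0\<close> to \<open>x\<close> is written over the fixed interval \<open>[0, 1]\<close>.  In this form
  it makes sense for either sign of \<open>x\<close>, and theorems about integrals with a parameter apply.
\<close>
lemma has_derivative_radial_integral:
  fixes g :: "real \<Rightarrow> real"
  assumes "continuous_on {-r<..<r} g" "x \<in> {-r<..<r}"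
  shows "((\<lambda>x. x * integral {0..1} (\<lambda>s. g (s * x))) has_real_derivative g x) (at x)"
proof -
  define b where "b = (\<bar>x\<bar> + r) / 2"
  have b: "\<bar>x\<bar> < b" "b < r" "b > 0" using assms(2) by (auto simp: b_def)
  have "continuous_on {-b..b} g" using b by (intro continuous_on_subset[OF assms(1)]) auto
  then obtain G where G: "\<And>x. x \<in> {-b..b} \<Longrightarrow> (G has_vector_derivative g x) (at x within {-b..b})"
    using antiderivative_continuous by blast
  have eq: "x * integral {0..1} (\<lambda>s. g (s * x)) = G x - G 0" if x: "x \<in> {-b<..<b}" for x
  proof -
    have in_b: "s * x \<in> {-b..b}" if "s \<in> {0..1}" for s
    proof -
      have "\<bar>s * x\<bar> \<le> 1 * b" unfolding abs_mult using x that by (intro mult_mono) auto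
      then show ?thesis by auto
    qed
    have "((\<lambda>s. g (s * x) * x) has_integral G (1 * x) - G (0 * x)) {0..1}"
    proof (rule fundamental_theorem_of_calculus)
      fix s :: real assume s: "s \<in> {0..1}"
      have "(G has_real_derivative g (s * x)) (at (s * x) within {-b..b})"
        using G[OF in_b[OF s]] by (simp add: has_real_derivative_iff_has_vector_derivative)
      then have "(G has_real_derivative g (s * x)) (at (s * x) within (\<lambda>s. s * x) ` {0..1})"
        by (rule DERIV_subset) (use in_b in auto)
      then have "((\<lambda>s. G (s * x)) has_real_derivative g (s * x) * x) (at s within {0..1})"
        by (rule DERIV_image_chain[unfolded o_def]) (auto intro!: derivative_eq_intros)
      then show "((\<lambda>s. G (s * x)) has_vector_derivative g (s * x) * x) (at s within {0..1})"
        by (simp add: has_real_derivative_iff_has_vector_derivative)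
    qed auto
    from integral_unique[OF this] show ?thesis by (simp add: mult.commute)
  qed
  have "(G has_real_derivative g x) (at x)"
  proof -
    have "(G has_real_derivative g x) (at x within {-b..b})"
      using G[of x] b by (simp add: has_real_derivative_iff_has_vector_derivative abs_if split: if_splits)
    moreover have "x \<in> interior {-b..b}" using b by auto
    ultimately show ?thesis using at_within_interior[of x "{-b..b}"] by simp
  qed
  then have "((\<lambda>x. G x - G 0) has_real_derivative g x) (at x)"
    using DERIV_diff[OF _ DERIV_const] by fastforce
  then show ?thesis
    by (rule has_field_derivative_transform_within_open[of _ _ _ "{-b<..<b}"]) (use b eq in auto)
qed

text \<open>
  Picard iteration takes place in the space of bounded continuous functions of \<open>(x, c)\<close>, applied to the
  displacement \<open>y (x, c) - c\<close>; so continuity in the initial value \<open>c\<close> comes with the solution.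
\<close>
lemma picard_fixed_point:
  fixes h :: "real \<times> real \<Rightarrow> real"
  assumes cont: "continuous_on UNIV h" and B: "\<And>z. \<bar>h z\<bar> \<le> B"
    and L: "\<And>x y1 y2. \<bar>h (x, y1) - h (x, y2)\<bar> \<le> L * \<bar>y1 - y2\<bar>"
    and \<rho>: "\<rho> \<ge> 0" "\<rho> * L \<le> 1/2" and "L \<ge> 0"
  shows "\<exists>y :: real \<times> real \<Rightarrow> real. continuous_on UNIV y \<and> (\<forall>x c. \<bar>y (x, c) - c\<bar> \<le> \<rho> * B) \<and>
    (\<forall>x c. \<bar>x\<bar> \<le> \<rho> \<longrightarrow> y (x, c) = c + x * integral {0..1} (\<lambda>s. h (s * x, y (s * x, c))))"
proof -
  \<comment> \<open>Truncating \<open>x\<close> to \<open>[-\<rho>, \<rho>]\<close> makes the iteration a contraction of functions on the whole plane.\<close>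
  define k where "k = (\<lambda>x. max (-\<rho>) (min \<rho> x))"
  have k: "\<bar>k x\<bar> \<le> \<rho>" "continuous_on S k" for x S
    using \<rho> by (auto simp: k_def intro!: continuous_intros)
  define T where "T = (\<lambda>(z :: real \<times> real \<Rightarrow> real) p. k (fst p) * integral {0..1} (\<lambda>s. h (s * k (fst p), snd p + z (s * k (fst p), snd p))))"
  have cont_s: "continuous_on {0..1} (\<lambda>s. h (s * a, c + z (s * a, c)))" if "continuous_on UNIV z" for z a c
    by (intro continuous_on_compose2[OF cont] continuous_intros continuous_on_compose2[OF that]) auto
  have T_cont: "continuous_on UNIV (T z)" if "continuous_on UNIV z" for z
  proof -
    have "continuous_on UNIV (\<lambda>p. integral (cbox 0 1) (\<lambda>s. h (s * k (fst p), snd p + z (s * k (fst p), snd p))))"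
      by (rule integral_continuous_on_param, unfold split_beta)
         (intro continuous_on_compose2[OF cont] continuous_intros continuous_on_compose2[OF that]
          continuous_on_compose2[OF k(2)[of UNIV]]; auto)
    then show ?thesis unfolding T_def
      by (intro continuous_intros continuous_on_compose2[OF k(2)[of UNIV]]) (auto simp: cbox_interval)
  qed
  have int_le: "\<bar>integral {0..1} f\<bar> \<le> C" if "continuous_on {0..1} f" "\<And>s. s \<in> {0..1} \<Longrightarrow> \<bar>f s\<bar> \<le> C"
    for f :: "real \<Rightarrow> real" and C
    using integral_bound[of 0 1 f C] that by simp
  have B0: "B \<ge> 0" using B[of 0] by linarith
  have T_bound: "\<bar>T z p\<bar> \<le> \<rho> * B" if "continuous_on UNIV z" for z p
    unfolding T_def abs_mult
    by (intro mult_mono k int_le B cont_s that) (use \<rho> in auto)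
  have T_bcontfun: "T (apply_bcontfun f) \<in> bcontfun" for f
    by (rule bcontfun_normI[where b = "\<rho> * B"]) (use T_cont T_bound continuous_on_apply_bcontfun in auto)
  define T' where "T' = (\<lambda>f. Bcontfun (T (apply_bcontfun f)))"
  have T'_apply: "apply_bcontfun (T' f) = T (apply_bcontfun f)" for f
    unfolding T'_def by (rule Bcontfun_inverse[OF T_bcontfun])
  have contr: "dist (T' f) (T' g) \<le> (1/2) * dist f g" for f g
  proof (rule dist_bound)
    fix p
    have "\<bar>T (apply_bcontfun f) p - T (apply_bcontfun g) p\<bar>
      = \<bar>k (fst p)\<bar> * \<bar>integral {0..1} (\<lambda>s. h (s * k (fst p), snd p + f (s * k (fst p), snd p))
            - h (s * k (fst p), snd p + g (s * k (fst p), snd p)))\<bar>"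
      unfolding T_def abs_mult[symmetric] right_diff_distrib[symmetric]
      by (subst integral_diff)
         (auto intro!: integrable_continuous_real cont_s continuous_on_apply_bcontfun)
    also have "\<dots> \<le> \<rho> * (L * dist f g)"
    proof (intro mult_mono k int_le continuous_on_diff cont_s continuous_on_apply_bcontfun)
      fix s :: real
      have "\<bar>h (s * k (fst p), snd p + f (s * k (fst p), snd p)) - h (s * k (fst p), snd p + g (s * k (fst p), snd p))\<bar>
         \<le> L * \<bar>f (s * k (fst p), snd p) - g (s * k (fst p), snd p)\<bar>"
        using L[of "s * k (fst p)" "snd p + f (s * k (fst p), snd p)" "snd p + g (s * k (fst p), snd p)"] by simp
      also have "\<dots> \<le> L * dist f g"
        using dist_bounded[of f _ g] \<open>L \<ge> 0\<close> by (intro mult_left_mono) (simp_all add: dist_real_def)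
      finally show "\<bar>h (s * k (fst p), snd p + f (s * k (fst p), snd p)) - h (s * k (fst p), snd p + g (s * k (fst p), snd p))\<bar> \<le> L * dist f g" .
    qed (use \<rho> in auto)
    also have "\<dots> = (\<rho> * L) * dist f g" by simp
    also have "\<dots> \<le> (1/2) * dist f g" by (intro mult_right_mono \<rho>) auto
    finally show "dist (T' f p) (T' g p) \<le> (1/2) * dist f g"
      by (simp add: T'_apply dist_real_def)
  qed
  have "\<exists>!f. T' f = f"
    by (rule banach_fix_type[of "1/2"]) (use contr in auto)
  then obtain f where f: "T' f = f" by blast
  define y where "y = (\<lambda>p. snd p + apply_bcontfun f p)"
  have fT: "apply_bcontfun f = T (apply_bcontfun f)" using T'_apply[of f] f by simp
  have "continuous_on UNIV y" unfolding y_def by (intro continuous_intros continuous_on_apply_bcontfun)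
  moreover have "\<bar>y (x, c) - c\<bar> \<le> \<rho> * B" for x c
    unfolding y_def by (subst fT) (use T_bound continuous_on_apply_bcontfun in auto)
  moreover have "y (x, c) = c + x * integral {0..1} (\<lambda>s. h (s * x, y (s * x, c)))" if "\<bar>x\<bar> \<le> \<rho>" for x c
  proof -
    have "k x = x" using that by (auto simp: k_def)
    then have "T (apply_bcontfun f) (x, c) = x * integral {0..1} (\<lambda>s. h (s * x, y (s * x, c)))"
      unfolding T_def y_def by simp
    then show ?thesis unfolding y_def using fT by simp
  qed
  ultimately show ?thesis by blast
qed

lemma has_derivative_from_partials:
  fixes f :: "real \<times> real \<Rightarrow> real"
  assumes S: "open S" "p \<in> S"
    and fx: "\<And>x c. (x, c) \<in> S \<Longrightarrow> ((\<lambda>x. f (x, c)) has_real_derivative fx (x, c)) (at x)"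
    and fc: "\<And>x c. (x, c) \<in> S \<Longrightarrow> ((\<lambda>c. f (x, c)) has_real_derivative fc (x, c)) (at c)"
    and cont: "continuous_on S fc"
  shows "(f has_derivative (\<lambda>v. fst v * fx p + snd v * fc p)) (at p)"
proof -
  obtain a b where p: "p = (a, b)" by fastforce
  obtain X Y where XY: "open X" "open Y" "(a, b) \<in> X \<times> Y" "X \<times> Y \<subseteq> S"
    using open_prod_elim[OF S(1)] S(2) unfolding p by blast
  obtain d where d: "d > 0" "ball b d \<subseteq> Y" using XY openE by blast
  have sub: "X \<times> ball b d \<subseteq> S" using XY d by auto
  have "((\<lambda>(x, y). f (x, y)) has_derivative (\<lambda>(tx, ty). fx p * tx + blinfun_scaleR_left (fc (a, b)) ty)) (at (a, b) within X \<times> ball b d)"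
  proof (rule has_derivative_partialsI[where fy = "\<lambda>x y. blinfun_scaleR_left (fc (x, y))"])
    show "((\<lambda>x. f (x, b)) has_derivative (*) (fx p)) (at a within X)"
      using fx[of a b] XY unfolding p has_field_derivative_def by (auto intro: has_derivative_at_withinI)
    show "((\<lambda>y. f (x, y)) has_derivative blinfun_apply (blinfun_scaleR_left (fc (x, y)))) (at y within ball b d)"
      if "x \<in> X" "y \<in> ball b d" for x y
    proof -
      have "(x, y) \<in> S" using that sub by auto
      then have "((\<lambda>y. f (x, y)) has_derivative (*) (fc (x, y))) (at y)"
        using fc[of x y] unfolding has_field_derivative_def by simp
      moreover have "blinfun_apply (blinfun_scaleR_left (fc (x, y))) = (*) (fc (x, y))"
        by (auto simp: fun_eq_iff blinfun_scaleR_left.rep_eq mult.commute)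
      ultimately show ?thesis by (simp add: has_derivative_at_withinI)
    qed
    have "continuous_on (X \<times> ball b d) (\<lambda>z. blinfun_scaleR_left (fc z))"
      by (intro bounded_linear.continuous_on[OF bounded_linear_blinfun_scaleR_left] continuous_on_subset[OF cont sub])
    then show "continuous (at (a, b) within X \<times> ball b d) (\<lambda>(x, y). blinfun_scaleR_left (fc (x, y)))"
      using XY d unfolding case_prod_beta' prod.collapse
      by (simp add: continuous_on_eq_continuous_within)
    show "b \<in> ball b d" using d by simp
    show "convex (ball b d)" by simp
  qed
  moreover have "at (a, b) within X \<times> ball b d = at (a, b)"
    using XY d by (intro at_within_open open_Times) auto
  moreover have "(\<lambda>(tx, ty). fx p * tx + blinfun_scaleR_left (fc (a, b)) ty) = (\<lambda>v. fst v * fx p + snd v * fc p)"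
    by (auto simp: fun_eq_iff blinfun_scaleR_left.rep_eq p)
  ultimately show ?thesis by (simp add: p split_beta)
qed

lemma Ck_on_from_partials:
  fixes f :: "real \<times> real \<Rightarrow> real"
  assumes S: "open S"
    and fx: "\<And>x c. (x, c) \<in> S \<Longrightarrow> ((\<lambda>x. f (x, c)) has_real_derivative fx (x, c)) (at x)"
    and fc: "\<And>x c. (x, c) \<in> S \<Longrightarrow> ((\<lambda>c. f (x, c)) has_real_derivative fc (x, c)) (at c)"
    and "Ck_on k S fx" "Ck_on k S fc"
  shows "Ck_on (Suc k) S f"
proof (rule Ck_on_SucI[OF S])
  have "Ck_on 0 S fc" using assms(5) by (induction k) (blast dest: Ck_on_SucD)+
  then have cont: "continuous_on S fc" by simp
  show "(f has_derivative (\<lambda>v. fst v * fx p + snd v * fc p)) (at p)" if "p \<in> S" for p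
    by (rule has_derivative_from_partials[OF S that fx fc cont])
  show "Ck_on k S (\<lambda>p. fst v * fx p + snd v * fc p)" for v
    by (intro Ck_on_add Ck_on_bounded_bilinear[OF _ bounded_bilinear_mult] Ck_on_const assms)
qed

lemma Ck_on_continuous: "Ck_on k S f \<Longrightarrow> continuous_on S f"
proof (induction k)
  case (Suc k)
  then show ?case using Ck_on_SucD by blast
qed simp

lemma has_real_derivative_partials:
  fixes f :: "real \<times> real \<Rightarrow> real"
  assumes "f differentiable (at (x, c))"
  shows "((\<lambda>x. f (x, c)) has_real_derivative jac f (x, c) (1, 0)) (at x)"
    and "((\<lambda>c. f (x, c)) has_real_derivative jac f (x, c) (0, 1)) (at c)"
proof -
  have df: "(f has_derivative jac f (x, c)) (at (x, c))"
    using assms by (simp add: frechet_derivative_works)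
  have l: "linear (jac f (x, c))" using df has_derivative_linear by blast
  have "((\<lambda>x. f (x, c)) has_derivative (\<lambda>t. jac f (x, c) (t, 0))) (at x)"
    by (rule has_derivative_compose[where f = "\<lambda>x. (x, c)" and g = f, OF _ df]) (auto intro!: derivative_eq_intros)
  moreover have "(\<lambda>t. jac f (x, c) (t, 0)) = (*) (jac f (x, c) (1, 0))"
  proof
    show "jac f (x, c) (t, 0) = jac f (x, c) (1, 0) * t" for t
      using linear_scale[OF l, of t "(1, 0)"] by (simp add: mult.commute)
  qed
  ultimately show "((\<lambda>x. f (x, c)) has_real_derivative jac f (x, c) (1, 0)) (at x)"
    by (simp only: has_field_derivative_def)
  have "((\<lambda>c. f (x, c)) has_derivative (\<lambda>t. jac f (x, c) (0, t))) (at c)"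
    by (rule has_derivative_compose[where f = "\<lambda>c. (x, c)" and g = f, OF _ df]) (auto intro!: derivative_eq_intros)
  moreover have "(\<lambda>t. jac f (x, c) (0, t)) = (*) (jac f (x, c) (0, 1))"
  proof
    show "jac f (x, c) (0, t) = jac f (x, c) (0, 1) * t" for t
      using linear_scale[OF l, of t "(0, 1)"] by (simp add: mult.commute)
  qed
  ultimately show "((\<lambda>c. f (x, c)) has_real_derivative jac f (x, c) (0, 1)) (at c)"
    by (simp only: has_field_derivative_def)
qed

abbreviation rect :: "real \<Rightarrow> real \<Rightarrow> (real \<times> real) set" where
  "rect \<rho> \<sigma> \<equiv> {-\<rho><..<\<rho>} \<times> {-\<sigma><..<\<sigma>}"

text \<open>
  The weight \<open>w\<close> makes the induction work: differentiating \<open>f (s x, c)\<close> in \<open>x\<close> produces a factor \<open>s\<close>.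
\<close>
lemma Ck_on_radial_integral:
  fixes f :: "real \<times> real \<Rightarrow> real"
  assumes "Ck_on k (rect \<rho> \<sigma>) f" "continuous_on {0..1} w"
  shows "Ck_on k (rect \<rho> \<sigma>) (\<lambda>p. integral {0..1} (\<lambda>s. w s * f (s * fst p, snd p)))"
  using assms
proof (induction k arbitrary: f w)
  let ?R = "rect \<rho> \<sigma>"
  have scaled: "s * x \<in> {-\<rho><..<\<rho>}" if "s \<in> {0..1}" "x \<in> {-\<rho><..<\<rho>}" for s x
  proof -
    have "\<bar>s * x\<bar> \<le> 1 * \<bar>x\<bar>" unfolding abs_mult using that by (intro mult_right_mono) auto
    then show ?thesis using that by auto
  qed
  have cont_param: "continuous_on (?R \<times> {0..1}) (\<lambda>(p, s). w s * f (s * fst p, snd p))"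
    if "continuous_on ?R f" "continuous_on {0..1} w" for f :: "real \<times> real \<Rightarrow> real" and w
    unfolding split_beta
    by (intro continuous_intros continuous_on_compose2[OF that(1)] continuous_on_compose2[OF that(2)])
       (use scaled in auto)
  {
    case 0
    show ?case
      using integral_continuous_on_param[of ?R 0 1 "\<lambda>p s. w s * f (s * fst p, snd p)"]
        cont_param[of f w] 0 by (simp add: cbox_interval)
  next
    case (Suc k)
    define fx where "fx = (\<lambda>p. jac f p (1, 0))"
    define fc where "fc = (\<lambda>p. jac f p (0, 1))"
    have R: "open ?R" by (intro open_Times) auto
    have Ck: "Ck_on k ?R fx" "Ck_on k ?R fc" "Ck_on k ?R f"
      using Suc.prems(1) Ck_on_SucD[OF Suc.prems(1)] unfolding fx_def fc_def by auto
    note cont = Ck_on_continuous[OF Ck(1)] Ck_on_continuous[OF Ck(2)] Ck_on_continuous[OF Ck(3)]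
    have dfx: "((\<lambda>x. f (x, c)) has_real_derivative fx (x, c)) (at x)"
      and dfc: "((\<lambda>c. f (x, c)) has_real_derivative fc (x, c)) (at c)" if "(x, c) \<in> ?R" for x c
      using has_real_derivative_partials[of f x c] that Suc.prems(1) unfolding fx_def fc_def by simp_all
    have int: "(\<lambda>s. w s * f (s * x, c)) integrable_on cbox 0 1" if "(x, c) \<in> ?R" for x c
      unfolding cbox_interval
      by (intro integrable_continuous_real continuous_intros Suc.prems continuous_on_compose2[OF cont(3)])
         (use that scaled in auto)
    show ?case
    proof (rule Ck_on_from_partials[OF R])
      fix x c assume xc: "(x, c) \<in> ?R"
      have "((\<lambda>x. integral (cbox 0 1) (\<lambda>s. w s * f (s * x, c))) has_field_derivative
          integral (cbox 0 1) (\<lambda>s. (w s * s) * fx (s * x, c))) (at x within {-\<rho><..<\<rho>})"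
      proof (rule leibniz_rule_field_derivative)
        fix x s :: real assume xs: "x \<in> {-\<rho><..<\<rho>}" "s \<in> cbox 0 1"
        have "((\<lambda>x. f (s * x, c)) has_real_derivative fx (s * x, c) * s) (at x)"
          by (rule DERIV_chain2[OF dfx]) (use xs xc scaled in \<open>auto intro!: derivative_eq_intros simp: cbox_interval\<close>)
        from DERIV_cmult[OF this, of "w s"]
        show "((\<lambda>x. w s * f (s * x, c)) has_field_derivative (w s * s) * fx (s * x, c)) (at x within {-\<rho><..<\<rho>})"
          by (intro has_field_derivative_at_within[where s="{-\<rho><..<\<rho>}"]) (simp add: mult_ac)
      next
        show "continuous_on ({-\<rho><..<\<rho>} \<times> cbox 0 1) (\<lambda>(x, s). (w s * s) * fx (s * x, c))"
          unfolding split_beta cbox_interval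
          by (intro continuous_intros continuous_on_compose2[OF Suc.prems(2)] continuous_on_compose2[OF cont(1)])
             (use xc scaled in auto)
      qed (use xc int in auto)
      moreover have "at x within {-\<rho><..<\<rho>} = at x" using xc by (intro at_within_open) auto
      ultimately show "((\<lambda>x. integral {0..1} (\<lambda>s. w s * f (s * fst (x, c), snd (x, c)))) has_real_derivative
          integral {0..1} (\<lambda>s. (w s * s) * fx (s * fst (x, c), snd (x, c)))) (at x)"
        by (simp add: cbox_interval)
      have "((\<lambda>c. integral (cbox 0 1) (\<lambda>s. w s * f (s * x, c))) has_field_derivative
          integral (cbox 0 1) (\<lambda>s. w s * fc (s * x, c))) (at c within {-\<sigma><..<\<sigma>})"
      proof (rule leibniz_rule_field_derivative)
        fix c s :: real assume cs: "c \<in> {-\<sigma><..<\<sigma>}" "s \<in> cbox 0 1"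
        have "((\<lambda>c. f (s * x, c)) has_real_derivative fc (s * x, c)) (at c)"
          by (rule dfc) (use cs xc scaled in \<open>auto simp: cbox_interval\<close>)
        from DERIV_cmult[OF this, of "w s"]
        show "((\<lambda>c. w s * f (s * x, c)) has_field_derivative w s * fc (s * x, c)) (at c within {-\<sigma><..<\<sigma>})"
          using has_field_derivative_at_within by blast
      next
        show "continuous_on ({-\<sigma><..<\<sigma>} \<times> cbox 0 1) (\<lambda>(c, s). w s * fc (s * x, c))"
          unfolding split_beta cbox_interval
          by (intro continuous_intros continuous_on_compose2[OF Suc.prems(2)] continuous_on_compose2[OF cont(2)])
             (use xc scaled in auto)
      qed (use xc int in auto)
      moreover have "at c within {-\<sigma><..<\<sigma>} = at c" using xc by (intro at_within_open) auto
      ultimately show "((\<lambda>c. integral {0..1} (\<lambda>s. w s * f (s * fst (x, c), snd (x, c)))) has_real_derivative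
          integral {0..1} (\<lambda>s. w s * fc (s * fst (x, c), snd (x, c)))) (at c)"
        by (simp add: cbox_interval)
    next
      show "Ck_on k ?R (\<lambda>p. integral {0..1} (\<lambda>s. (w s * s) * fx (s * fst p, snd p)))"
        by (rule Suc.IH[OF Ck(1), of "\<lambda>s. w s * s"]) (intro continuous_intros Suc.prems)
      show "Ck_on k ?R (\<lambda>p. integral {0..1} (\<lambda>s. w s * fc (s * fst p, snd p)))"
        by (rule Suc.IH[OF Ck(2) Suc.prems(2)])
    qed
  }
qed

text \<open>
  The solution \<open>y\<close> of \<open>y' = h (x, y)\<close> with \<open>y (0, c) = c\<close>, and its derivative \<open>m\<close> in \<open>c\<close>.
  The difference of two solutions satisfies a linear equation with the coefficient
  \<open>K t a b = \<integral> \<partial>h/\<partial>y (t, a + s (b - a)) ds\<close>, a mean of \<open>\<partial>h/\<partial>y\<close> between them, hence is the difference of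
  the initial values times an exponential.  This shows at once that \<open>y\<close> is injective in \<open>c\<close>, that it is
  differentiable, and that \<open>m = exp (\<integral> \<partial>h/\<partial>y)\<close> is positive.
\<close>
lemma smooth_local_flow:
  fixes h :: "real \<times> real \<Rightarrow> real"
  assumes "open S" "(0, 0) \<in> S" "smooth_on S h"
  obtains \<rho> \<sigma> y m where "\<rho> > 0" "\<sigma> > 0"
    "smooth_on (rect \<rho> \<sigma>) y" "smooth_on (rect \<rho> \<sigma>) m"
    "\<And>x c. x \<in> {-\<rho><..<\<rho>} \<Longrightarrow> c \<in> {-\<sigma><..<\<sigma>} \<Longrightarrow> (x, y (x, c)) \<in> S"
    "y (0, 0) = 0"
    "\<And>x c. x \<in> {-\<rho><..<\<rho>} \<Longrightarrow> c \<in> {-\<sigma><..<\<sigma>} \<Longrightarrow> ((\<lambda>x. y (x, c)) has_real_derivative h (x, y (x, c))) (at x)"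
    "\<And>x c. x \<in> {-\<rho><..<\<rho>} \<Longrightarrow> c \<in> {-\<sigma><..<\<sigma>} \<Longrightarrow> ((\<lambda>c. y (x, c)) has_real_derivative m (x, c)) (at c)"
    "\<And>p. m p > (0::real)"
    "\<And>x. x \<in> {-\<rho><..<\<rho>} \<Longrightarrow> inj_on (\<lambda>c. y (x, c)) {-\<sigma><..<\<sigma>}"
proof -
  obtain e where e: "e > 0" "ball (0, 0) e \<subseteq> S" using assms(1,2) openE by blast
  \<comment> \<open>The square \<open>[-r, r]\<^sup>2\<close> lies in the ball of radius \<open>e\<close>, as \<open>norm (x, z) \<le> \<bar>x\<bar> + \<bar>z\<bar>\<close>.\<close>
  define r where "r = e / 4"
  have r: "r > 0" using e by (simp add: r_def)
  have inS: "(x, z) \<in> S" if "\<bar>x\<bar> \<le> r" "\<bar>z\<bar> \<le> r" for x z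
  proof -
    have "norm (x, z) \<le> \<bar>x\<bar> + \<bar>z\<bar>" using norm_Pair_le[of x z] by simp
    also have "\<dots> < e" using that e by (simp add: r_def)
    finally have "(x, z) \<in> ball (0, 0) e" by (simp add: zero_prod_def[symmetric])
    then show ?thesis using e(2) by blast
  qed
  let ?Q = "{-r..r} \<times> {-r..r}"
  \<comment> \<open>Clamping both arguments extends \<open>h\<close> to a bounded function on the plane that is Lipschitz in \<open>y\<close>.\<close>
  define cl where "cl = (\<lambda>t. max (-r) (min r t))"
  have cl: "\<bar>cl t\<bar> \<le> r" "\<bar>t\<bar> \<le> r \<Longrightarrow> cl t = t" "\<bar>cl s - cl t\<bar> \<le> \<bar>s - t\<bar>" for s t
    using r unfolding cl_def abs_real_def max_def min_def by (auto split: if_splits)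
  have cl_cont: "continuous_on UNIV cl" unfolding cl_def by (intro continuous_intros)
  define D2 where "D2 = (\<lambda>p. jac h p (0, 1))"
  have D2: "smooth_on S D2" unfolding D2_def by (intro smooth_on_frechet_derivative assms)
  define hc where "hc = (\<lambda>p. h (cl (fst p), cl (snd p)))"
  define hy where "hy = (\<lambda>p. D2 (cl (fst p), cl (snd p)))"
  have cont: "continuous_on UNIV hc" "continuous_on UNIV hy"
    unfolding hc_def hy_def
    by (intro continuous_on_compose2[OF smooth_on_continuous[OF assms(3)]]
      continuous_on_compose2[OF smooth_on_continuous[OF D2]] continuous_intros continuous_on_compose2[OF cl_cont];
      use cl inS in auto)+
  have "compact ?Q" by (intro compact_Times) auto
  moreover have "continuous_on ?Q h" "continuous_on ?Q D2"
    using inS by (auto intro!: continuous_on_subset[OF smooth_on_continuous[OF assms(3)]] continuous_on_subset[OF smooth_on_continuous[OF D2]])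
  ultimately have "bounded (h ` ?Q)" "bounded (D2 ` ?Q)"
    by (auto intro!: compact_imp_bounded compact_continuous_image)
  then obtain B L where BL: "B > 0" "L > 0" "\<forall>q\<in>?Q. \<bar>h q\<bar> \<le> B" "\<forall>q\<in>?Q. \<bar>D2 q\<bar> \<le> L"
    unfolding bounded_pos by auto
  have hcB: "\<bar>hc p\<bar> \<le> B" and hyL: "\<bar>hy p\<bar> \<le> L" for p
    using BL(3,4) cl(1) unfolding hc_def hy_def by (auto simp: abs_le_iff minus_le_iff)
  define K where "K = (\<lambda>t a b. integral {0..1} (\<lambda>s. hy (t, a + s * (b - a))))"
  have cont_hy_line: "continuous_on {0..1} (\<lambda>s. hy (t, a + s * (b - a)))" for t a b
    by (intro continuous_on_compose2[OF cont(2)] continuous_intros) auto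
  have K_diff: "h (t, b) - h (t, a) = K t a b * (b - a)" if "\<bar>t\<bar> \<le> r" "\<bar>a\<bar> \<le> r" "\<bar>b\<bar> \<le> r" for t a b
  proof -
    have "((\<lambda>s. hy (t, a + s * (b - a)) * (b - a)) has_integral h (t, a + 1 * (b - a)) - h (t, a + 0 * (b - a))) {0..1}"
    proof (rule fundamental_theorem_of_calculus)
      fix s :: real assume s: "s \<in> {0..1}"
      have "a + s * (b - a) = (1 - s) * a + s * b" by (simp add: algebra_simps)
      moreover have "\<bar>(1 - s) * a + s * b\<bar> \<le> (1 - s) * r + s * r"
        using s that by (intro order_trans[OF abs_triangle_ineq] add_mono) (auto simp: abs_mult intro!: mult_left_mono)
      ultimately have z: "\<bar>a + s * (b - a)\<bar> \<le> r" by (simp add: algebra_simps)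
      have "((\<lambda>z. h (t, z)) has_real_derivative D2 (t, a + s * (b - a))) (at (a + s * (b - a)))"
        unfolding D2_def by (intro has_real_derivative_partials smooth_on_differentiable[OF assms(3)] inS that z)
      moreover have "((\<lambda>s. a + s * (b - a)) has_real_derivative b - a) (at s within {0..1})"
        by (auto intro!: derivative_eq_intros)
      ultimately have "((\<lambda>s. h (t, a + s * (b - a))) has_real_derivative D2 (t, a + s * (b - a)) * (b - a)) (at s within {0..1})"
        by (rule DERIV_chain2)
      moreover have "hy (t, a + s * (b - a)) = D2 (t, a + s * (b - a))"
        unfolding hy_def using cl(2) that z by simp
      ultimately show "((\<lambda>s. h (t, a + s * (b - a))) has_vector_derivative hy (t, a + s * (b - a)) * (b - a)) (at s within {0..1})"
        by (simp add: has_real_derivative_iff_has_vector_derivative)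
    qed simp
    from integral_unique[OF this] show ?thesis by (simp add: K_def)
  qed
  have K_le: "\<bar>K t a b\<bar> \<le> L" for t a b
    using integral_bound[of 0 1 "\<lambda>s. hy (t, a + s * (b - a))" L] cont_hy_line hyL by (simp add: K_def)
  have lip: "\<bar>hc (x, y1) - hc (x, y2)\<bar> \<le> L * \<bar>y1 - y2\<bar>" for x y1 y2
  proof -
    have "\<bar>hc (x, y1) - hc (x, y2)\<bar> = \<bar>K (cl x) (cl y2) (cl y1)\<bar> * \<bar>cl y1 - cl y2\<bar>"
      using K_diff[of "cl x" "cl y2" "cl y1"] cl(1) by (simp add: hc_def abs_mult)
    also have "\<dots> \<le> L * \<bar>y1 - y2\<bar>" by (intro mult_mono K_le cl) (use BL in auto)
    finally show ?thesis .
  qed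
  \<comment> \<open>Small enough for a contraction, and for solutions that start in \<open>[-r/2, r/2]\<close> to stay in \<open>[-r, r]\<close>,
    where the clamped function agrees with \<open>h\<close>.\<close>
  define \<rho> where "\<rho> = min r (min (1 / (2 * L)) (r / (2 * B)))"
  have \<rho>: "\<rho> > 0" "\<rho> \<le> r" "\<rho> * L \<le> 1/2" "\<rho> * B \<le> r/2"
  proof -
    show "\<rho> > 0" "\<rho> \<le> r" using r BL by (auto simp: \<rho>_def)
    have "\<rho> * L \<le> 1 / (2 * L) * L" using BL by (intro mult_right_mono) (auto simp: \<rho>_def)
    then show "\<rho> * L \<le> 1/2" using BL by simp
    have "\<rho> * B \<le> r / (2 * B) * B" using BL by (intro mult_right_mono) (auto simp: \<rho>_def)
    then show "\<rho> * B \<le> r/2" using BL by simp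
  qed
  obtain y where y: "continuous_on UNIV y" "\<And>x c. \<bar>y (x, c) - c\<bar> \<le> \<rho> * B"
      "\<And>x c. \<bar>x\<bar> \<le> \<rho> \<Longrightarrow> y (x, c) = c + x * integral {0..1} (\<lambda>s. hc (s * x, y (s * x, c)))"
    using picard_fixed_point[OF cont(1) hcB lip less_imp_le[OF \<rho>(1)] \<rho>(3) less_imp_le[OF BL(2)]] by blast
  define \<sigma> where "\<sigma> = r / 2"
  have \<sigma>: "\<sigma> > 0" using r by (simp add: \<sigma>_def)
  let ?I = "{-\<rho><..<\<rho>}" and ?J = "{-\<sigma><..<\<sigma>}" and ?R = "rect \<rho> \<sigma>"
  have R: "open ?R" by (intro open_Times) auto
  have xr: "\<bar>x\<bar> \<le> r" if "x \<in> ?I" for x using that \<rho> by auto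
  have yr: "\<bar>y (x, c)\<bar> \<le> r" if "c \<in> ?J" for x c
    using y(2)[of x c] \<rho>(4) that by (auto simp: \<sigma>_def)
  have y0: "y (0, c) = c" for c using y(3)[of 0 c] \<rho> by simp
  have cont_y: "continuous_on T (\<lambda>t. y (t, c))" for T c
    by (intro continuous_on_compose2[OF y(1)] continuous_intros) auto
  have y_x: "((\<lambda>x. y (x, c)) has_real_derivative h (x, y (x, c))) (at x)" if "x \<in> ?I" "c \<in> ?J" for x c
  proof -
    have "continuous_on ?I (\<lambda>t. hc (t, y (t, c)))"
      by (intro continuous_on_compose2[OF cont(1)] continuous_intros cont_y) auto
    from has_derivative_radial_integral[OF this that(1)]
    have "((\<lambda>x. c + x * integral {0..1} (\<lambda>s. hc (s * x, y (s * x, c)))) has_real_derivative hc (x, y (x, c))) (at x)"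
      using DERIV_add[OF DERIV_const] by fastforce
    moreover have "hc (x, y (x, c)) = h (x, y (x, c))"
      using cl(2) xr yr that by (simp add: hc_def)
    ultimately have d: "((\<lambda>x. c + x * integral {0..1} (\<lambda>s. hc (s * x, y (s * x, c)))) has_real_derivative h (x, y (x, c))) (at x)"
      by simp
    show ?thesis
    proof (rule has_field_derivative_transform_within_open[OF d open_greaterThanLessThan that(1)])
      show "c + z * integral {0..1} (\<lambda>s. hc (s * z, y (s * z, c))) = y (z, c)" if "z \<in> ?I" for z
        by (rule y(3)[symmetric]) (use that in auto)
    qed
  qed
  have K_cont: "continuous_on UNIV (\<lambda>p. K (fst p) (fst (snd p)) (snd (snd p)))"
  proof -
    have "continuous_on UNIV (\<lambda>p. integral (cbox 0 1) (\<lambda>s. hy (fst p, fst (snd p) + s * (snd (snd p) - fst (snd p)))))"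
      by (rule integral_continuous_on_param, unfold split_beta)
         (intro continuous_on_compose2[OF cont(2)] continuous_intros; auto)
    then show ?thesis by (simp add: K_def cbox_interval)
  qed
  have cont_Ky: "continuous_on T (\<lambda>t. K t (y (t, c1)) (y (t, c2)))" for T c1 c2
  proof -
    have "continuous_on T (\<lambda>t. (t, y (t, c1), y (t, c2)))"
      by (intro continuous_on_Pair continuous_on_id cont_y)
    from continuous_on_compose2[OF K_cont this] show ?thesis by simp
  qed
  define I where "I = (\<lambda>c1 c2 x. x * integral {0..1} (\<lambda>s. K (s * x) (y (s * x, c1)) (y (s * x, c2))))"
  have y_diff: "y (x, c2) - y (x, c1) = (c2 - c1) * exp (I c1 c2 x)" if x: "x \<in> ?I" and c: "c1 \<in> ?J" "c2 \<in> ?J" for x c1 c2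
  proof -
    \<comment> \<open>This product is constant in \<open>x\<close>, with value \<open>c2 - c1\<close> at \<open>x = 0\<close>.\<close>
    let ?f = "\<lambda>x. (y (x, c2) - y (x, c1)) * exp (- I c1 c2 x)"
    have I': "(I c1 c2 has_real_derivative K x (y (x, c1)) (y (x, c2))) (at x)" if "x \<in> ?I" for x
      unfolding I_def by (rule has_derivative_radial_integral[OF cont_Ky that])
    have "(?f has_real_derivative 0) (at x within ?I)" if x: "x \<in> ?I" for x
    proof (rule has_field_derivative_at_within)
      have "((\<lambda>x. exp (- I c1 c2 x)) has_real_derivative exp (- I c1 c2 x) * - K x (y (x, c1)) (y (x, c2))) (at x)"
        by (rule DERIV_fun_exp[OF DERIV_minus[OF I'[OF x]]])
      from DERIV_mult[OF DERIV_diff[OF y_x[OF x c(2)] y_x[OF x c(1)]] this]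
      show "(?f has_real_derivative 0) (at x)"
        using K_diff[OF xr[OF x] yr[OF c(1)] yr[OF c(2)]] by (simp add: algebra_simps)
    qed
    then obtain C where C: "\<And>x. x \<in> ?I \<Longrightarrow> ?f x = C"
      using has_field_derivative_zero_constant[of ?I ?f] by auto
    have "?f x = ?f 0" using C x \<rho>(1) by simp
    also have "\<dots> = c2 - c1" by (simp add: y0 I_def)
    finally show ?thesis by (simp add: exp_minus field_simps)
  qed
  define m where "m = (\<lambda>p. exp (fst p * integral {0..1} (\<lambda>s. hy (s * fst p, y (s * fst p, snd p)))))"
  have I_diag: "exp (I c c x) = m (x, c)" for x c by (simp add: I_def K_def m_def)
  have y_c: "((\<lambda>c. y (x, c)) has_real_derivative m (x, c)) (at c)" if "x \<in> ?I" "c \<in> ?J" for x c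
  proof -
    have "continuous_on UNIV (\<lambda>c2. integral (cbox 0 1) (\<lambda>s. K (s * x) (y (s * x, c)) (y (s * x, c2))))"
      by (rule integral_continuous_on_param, unfold split_beta,
          rule continuous_on_compose2[OF K_cont, of _ "\<lambda>p. (snd p * x, y (snd p * x, c), y (snd p * x, fst p))", simplified])
         (intro continuous_intros continuous_on_compose2[OF y(1)]; auto)
    then have "continuous_on UNIV (\<lambda>c2. exp (I c c2 x))"
      unfolding I_def by (intro continuous_intros) (simp add: cbox_interval)
    then have "((\<lambda>c2. exp (I c c2 x)) \<longlongrightarrow> m (x, c)) (at c)"
      unfolding I_diag[symmetric] by (simp add: continuous_on_def)
    then have "((\<lambda>c2. (y (x, c2) - y (x, c)) / (c2 - c)) \<longlongrightarrow> m (x, c)) (at c)"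
      by (rule Lim_transform_within_open[where s = ?J]) (use that y_diff[OF that(1,2)] in auto)
    then show ?thesis by (simp add: has_field_derivative_iff)
  qed
  have m_pos: "m p > 0" for p by (simp add: m_def)
  have yS: "(fst p, y p) \<in> S" if "p \<in> ?R" for p
    using inS[OF xr yr, of "fst p" "snd p" "fst p"] that by auto
  have along: "Ck_on k ?R (\<lambda>p. g (fst p, y p))" if "Ck_on k ?R y" "smooth_on S g" for k and g :: "real \<times> real \<Rightarrow> real"
  proof -
    have "Ck_on k ?R (\<lambda>p. (fst p, y p))"
      by (intro Ck_on_Pair[OF R] Ck_on_bounded_linear[OF R bounded_linear_fst Ck_on_id[OF R]] that(1))
    from Ck_on_compose[OF R assms(1) yS this smooth_onD[OF that(2)]] show ?thesis .
  qed
  have m_Ck: "Ck_on k ?R m" if "Ck_on k ?R y" for k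
  proof -
    have "Ck_on k ?R (\<lambda>p. hy (fst p, y p))"
    proof (rule Ck_on_cong[OF R _ along[OF that D2]])
      fix p assume "p \<in> ?R"
      then show "D2 (fst p, y p) = hy (fst p, y p)"
        using xr[of "fst p"] yr[of "snd p" "fst p"] cl(2) by (auto simp: hy_def)
    qed
    from Ck_on_radial_integral[OF this, of "\<lambda>_. 1"]
    have "Ck_on k ?R (\<lambda>p. integral {0..1} (\<lambda>s. hy (s * fst p, y (s * fst p, snd p))))" by simp
    then show ?thesis unfolding m_def
      by (intro Ck_on_compose[OF R open_UNIV _ _ Ck_on_exp] Ck_on_bounded_bilinear[OF R bounded_bilinear_mult]
          Ck_on_bounded_linear[OF R bounded_linear_fst Ck_on_id[OF R]]) auto
  qed
  \<comment> \<open>Bootstrapping: if \<open>y\<close> is \<open>C\<^sup>k\<close>, then so are both partial derivatives \<open>h (x, y)\<close> and \<open>m\<close>.\<close>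
  have y_Ck: "Ck_on k ?R y" for k
  proof (induction k)
    case 0
    show ?case using y(1) continuous_on_subset by auto
  next
    case (Suc k)
    show ?case
      by (intro Ck_on_from_partials[OF R, where fx = "\<lambda>p. h (fst p, y p)" and fc = m] m_Ck along Suc assms)
         (use y_x y_c in auto)
  qed
  have inj: "inj_on (\<lambda>c. y (x, c)) ?J" if "x \<in> ?I" for x
    using y_diff[OF that] by (intro inj_onI) (metis diff_self exp_not_eq_zero mult_eq_0_iff eq_iff_diff_eq_0)
  show thesis
    by (rule that[OF \<rho>(1) \<sigma> _ _ _ y0 y_x y_c m_pos inj]) (use y_Ck m_Ck inS xr yr in \<open>auto simp: smooth_on_def\<close>)
qed

text \<open>
  The inverse of \<open>(x, c) \<mapsto> (x, y (x, c))\<close> has an explicit derivative in terms of \<open>h\<close>, \<open>m\<close> and the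
  inverse itself, so its smoothness also follows by bootstrapping.
\<close>
lemma smooth_shear_inverse:
  fixes y m :: "real \<times> real \<Rightarrow> real" and h :: "real \<times> real \<Rightarrow> real"
  defines "\<Phi> \<equiv> \<lambda>p. (fst p, y p)"
  assumes R: "open R" and S: "open S" "\<And>p. p \<in> R \<Longrightarrow> \<Phi> p \<in> S" "smooth_on S h"
    and y: "smooth_on R y" "smooth_on R m" "\<And>p. p \<in> R \<Longrightarrow> m p \<noteq> 0"
    and d: "\<And>p. p \<in> R \<Longrightarrow> (y has_derivative (\<lambda>v. fst v * h (\<Phi> p) + snd v * m p)) (at p)"
    and inj: "inj_on \<Phi> R"
  obtains \<Psi> where "open (\<Phi> ` R)" "smooth_on (\<Phi> ` R) \<Psi>" "\<And>p. p \<in> R \<Longrightarrow> \<Psi> (\<Phi> p) = p"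
    "\<And>w. w \<in> \<Phi> ` R \<Longrightarrow> jac \<Psi> w (1, h w) = (1, 0)"
proof -
  have \<Phi>: "smooth_on R \<Phi>"
    unfolding \<Phi>_def by (intro smooth_on_Pair R smooth_on_fst smooth_on_id y)
  obtain \<Psi> where \<Psi>: "homeomorphism R (\<Phi> ` R) \<Phi> \<Psi>"
    using invariance_of_domain_homeomorphism[OF R smooth_on_continuous[OF \<Phi>] _ inj] by auto
  have W: "open (\<Phi> ` R)" by (rule invariance_of_domain[OF smooth_on_continuous[OF \<Phi>] R inj])
  have inv: "\<Psi> (\<Phi> p) = p" if "p \<in> R" for p using \<Psi> that by (simp add: homeomorphism_def)
  have cont: "continuous_on (\<Phi> ` R) \<Psi>" using \<Psi> by (simp add: homeomorphism_def)
  \<comment> \<open>The inverse of the matrix with rows \<open>(1, 0)\<close> and \<open>(h, m)\<close>.\<close>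
  define D where "D = (\<lambda>w v. (fst v :: real, (snd v - fst v * h w) * inverse (m (\<Psi> w))))"
  have deriv: "(\<Psi> has_derivative D w) (at w)" if w: "w \<in> \<Phi> ` R" for w
  proof -
    obtain p where p: "p \<in> R" "w = \<Phi> p" using w by auto
    have dp: "(\<Phi> has_derivative (\<lambda>v. (fst v, fst v * h (\<Phi> p) + snd v * m p))) (at p)"
      unfolding \<Phi>_def using d[OF p(1)] unfolding \<Phi>_def by (auto intro!: derivative_eq_intros)
    show ?thesis
    proof (rule has_derivative_inverse_basic[where f = \<Phi> and T = "\<Phi> ` R"])
      show "(\<Phi> has_derivative (\<lambda>v. (fst v, fst v * h (\<Phi> p) + snd v * m p))) (at (\<Psi> w))"
        using dp p inv by simp
      show "bounded_linear (D w)" unfolding D_def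
        by (intro bounded_linear_Pair bounded_linear_fst bounded_linear_sub bounded_linear_snd
            bounded_linear_compose[OF bounded_linear_mult_left])
      show "D w \<circ> (\<lambda>v. (fst v, fst v * h (\<Phi> p) + snd v * m p)) = id"
        using inv p y(3)[of p] by (auto simp: D_def fun_eq_iff)
      show "continuous (at w) \<Psi>" using cont w continuous_on_eq_continuous_at[OF W] by blast
    qed (use W w inv in auto)
  qed
  have "Ck_on k (\<Phi> ` R) \<Psi>" for k
  proof (induction k)
    case 0
    then show ?case using cont by simp
  next
    case (Suc k)
    show ?case
    proof (rule Ck_on_SucI[OF W deriv])
      fix v :: "real \<times> real"
      have "Ck_on k (\<Phi> ` R) (\<lambda>w. inverse (m (\<Psi> w)))"
        by (rule Ck_on_compose[OF W R _ Suc smooth_onD[OF smooth_on_inverse[OF R y(2)]]]) (use inv y in auto)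
      moreover have "Ck_on k (\<Phi> ` R) h" by (rule Ck_on_subset[OF smooth_onD[OF S(3)]]) (use S(2) in blast)
      ultimately have "Ck_on k (\<Phi> ` R) (\<lambda>w. (fst v, 0) + ((snd v + (- fst v) * h w) * inverse (m (\<Psi> w))) *\<^sub>R (0, 1 :: real))"
        by (intro Ck_on_add W Ck_on_const Ck_on_bounded_bilinear[OF W bounded_bilinear_mult]
            Ck_on_bounded_bilinear[OF W bounded_bilinear_scaleR])
      then show "Ck_on k (\<Phi> ` R) (\<lambda>w. D w v)" by (simp add: D_def)
    qed
  qed
  moreover have "jac \<Psi> w (1, h w) = (1, 0)" if "w \<in> \<Phi> ` R" for w
    unfolding frechet_derivative_at[OF deriv[OF that], symmetric] by (simp add: D_def)
  ultimately show thesis using that[OF W _ inv] by (simp add: smooth_on_def)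
qed

lemma plane_flow_box:
  fixes h :: "real \<times> real \<Rightarrow> real"
  assumes "open S" "(0, 0) \<in> S" "smooth_on S h"
  obtains R W \<Phi> \<Psi> where "open R" "open W" "W \<subseteq> S" "(0, 0) \<in> W" "\<Phi> ` R = W"
    "smooth_on R (\<Phi> :: real \<times> real \<Rightarrow> real \<times> real)" "smooth_on W \<Psi>" "\<And>p. p \<in> R \<Longrightarrow> \<Psi> (\<Phi> p) = p"
    "\<And>w. w \<in> W \<Longrightarrow> jac \<Psi> w (1, h w) = (1, 0)"
proof -
  obtain \<rho> \<sigma> y m where f: "\<rho> > 0" "\<sigma> > 0"
    "smooth_on (rect \<rho> \<sigma>) y" "smooth_on (rect \<rho> \<sigma>) m"
    "\<And>x c. x \<in> {-\<rho><..<\<rho>} \<Longrightarrow> c \<in> {-\<sigma><..<\<sigma>} \<Longrightarrow> (x, y (x, c)) \<in> S"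
    "y (0, 0) = 0"
    "\<And>x c. x \<in> {-\<rho><..<\<rho>} \<Longrightarrow> c \<in> {-\<sigma><..<\<sigma>} \<Longrightarrow> ((\<lambda>x. y (x, c)) has_real_derivative h (x, y (x, c))) (at x)"
    "\<And>x c. x \<in> {-\<rho><..<\<rho>} \<Longrightarrow> c \<in> {-\<sigma><..<\<sigma>} \<Longrightarrow> ((\<lambda>c. y (x, c)) has_real_derivative m (x, c)) (at c)"
    "\<And>p. m p > (0::real)"
    "\<And>x. x \<in> {-\<rho><..<\<rho>} \<Longrightarrow> inj_on (\<lambda>c. y (x, c)) {-\<sigma><..<\<sigma>}"
    by (rule smooth_local_flow[OF assms]) (assumption | blast)+
  let ?R = "rect \<rho> \<sigma>" and ?\<Phi> = "\<lambda>p. (fst p, y p)"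
  have R: "open ?R" by (intro open_Times) auto
  have m0: "m p \<noteq> 0" for p using f(9)[of p] by simp
  have S: "?\<Phi> p \<in> S" if "p \<in> ?R" for p using f(5)[of "fst p" "snd p"] that by auto
  have inj: "inj_on ?\<Phi> ?R"
  proof (rule inj_onI)
    fix p q assume "p \<in> ?R" "q \<in> ?R" "?\<Phi> p = ?\<Phi> q"
    then show "p = q" using inj_onD[OF f(10)[of "fst p"], of "snd p" "snd q"] by (auto simp: prod_eq_iff)
  qed
  have d: "(y has_derivative (\<lambda>v. fst v * h (?\<Phi> p) + snd v * m p)) (at p)" if "p \<in> ?R" for p
    by (rule has_derivative_from_partials[OF R that, where fx = "\<lambda>p. h (?\<Phi> p)"])
       (use f(7,8) smooth_on_continuous[OF f(4)] in auto)
  obtain \<Psi> where \<Psi>: "open (?\<Phi> ` ?R)" "smooth_on (?\<Phi> ` ?R) \<Psi>" "\<And>p. p \<in> ?R \<Longrightarrow> \<Psi> (?\<Phi> p) = p"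
    "\<And>w. w \<in> ?\<Phi> ` ?R \<Longrightarrow> jac \<Psi> w (1, h w) = (1, 0)"
    by (rule smooth_shear_inverse[OF R assms(1) S assms(3) f(3,4) m0 d inj]) (assumption | blast)+
  show thesis
  proof (rule that[OF R \<Psi>(1) _ _ refl _ \<Psi>(2,3,4)])
    show "?\<Phi> ` ?R \<subseteq> S" using S by auto
    show "(0, 0) \<in> ?\<Phi> ` ?R" using f(1,2,6) by (intro image_eqI[of _ _ "(0, 0)"]) auto
    show "smooth_on ?R ?\<Phi>" by (intro smooth_on_Pair R smooth_on_fst smooth_on_id f)
  qed
qed

text \<open>
  Some component \<open>i\<close> of \<open>X\<close> is nonzero at \<open>p\<close>.  With it as first coordinate, centred at \<open>p\<close>, the field
  is a multiple of \<open>(1, h)\<close>, and the second coordinate of the straightened picture is constant along it.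
\<close>
lemma flow_box:
  fixes X :: "real ^ 2 \<Rightarrow> real ^ 2"
  assumes S: "open S" "p \<in> S" "smooth_on S X" and "X p \<noteq> 0"
  obtains V W \<phi> \<psi> where "open V" "open W" "p \<in> V" "V \<subseteq> S"
    "smooth_on V (\<phi> :: real ^ 2 \<Rightarrow> real ^ 2)" "smooth_on W (\<psi> :: real ^ 2 \<Rightarrow> real ^ 2)"
    "\<And>z. z \<in> V \<Longrightarrow> \<phi> z \<in> W \<and> \<psi> (\<phi> z) = z" "\<And>w. w \<in> W \<Longrightarrow> \<psi> w \<in> V \<and> \<phi> (\<psi> w) = w"
    "\<And>z. z \<in> V \<Longrightarrow> jac \<phi> z (X z) $ 2 = 0"
proof -
  obtain i where i: "X p $ i \<noteq> 0" using assms(4) by (metis vec_eq_iff zero_index)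
  obtain j :: 2 where j: "j \<noteq> i"
  proof (cases "i = 1")
    case True
    then show thesis using that[of 2] by simp
  next
    case False
    then show thesis using that[of 1] by simp
  qed
  have ij: "k = i \<or> k = j" for k using j exhaust_2[of i] exhaust_2[of j] exhaust_2[of k] by auto
  define \<alpha> where "\<alpha> = (\<lambda>z :: real ^ 2. (z $ i - p $ i, z $ j - p $ j))"
  define \<beta> where "\<beta> = (\<lambda>q :: real \<times> real. (\<chi> k. p $ k + (if k = i then fst q else snd q)) :: real ^ 2)"
  have \<alpha>\<beta>: "\<alpha> (\<beta> q) = q" "\<beta> (\<alpha> z) = z" for q z
  proof -
    show "\<alpha> (\<beta> q) = q" using j by (simp add: \<alpha>_def \<beta>_def)
    have "\<beta> (\<alpha> z) $ k = z $ k" for k using ij[of k] j by (auto simp: \<alpha>_def \<beta>_def)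
    then show "\<beta> (\<alpha> z) = z" by (simp add: vec_eq_iff)
  qed
  have \<alpha>_smooth: "smooth_on T \<alpha>" if "open T" for T
    unfolding \<alpha>_def using that by (intro smooth_on_Pair smooth_on_diff smooth_on_const smooth_on_vec_nth smooth_on_id)
  have \<beta>_smooth: "smooth_on T \<beta>" if "open T" for T
  proof (rule smooth_on_vec[OF that])
    fix k
    have "smooth_on T (\<lambda>q. p $ k + fst q)" "smooth_on T (\<lambda>q. p $ k + snd q)"
      by (intro smooth_on_add smooth_on_const smooth_on_fst smooth_on_snd smooth_on_id that)+
    then show "smooth_on T (\<lambda>q. \<beta> q $ k)" unfolding \<beta>_def by (cases "k = i") auto
  qed
  define S0 where "S0 = S \<inter> (\<lambda>z. X z $ i) -` (- {0})"
  have S0: "open S0" unfolding S0_def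
    by (rule continuous_open_preimage[OF smooth_on_continuous[OF smooth_on_vec_nth[OF S(1,3)]] S(1)]) auto
  define S' where "S' = \<beta> -` S0"
  have "open S'" unfolding S'_def
    by (rule open_vimage[OF S0]) (use smooth_on_continuous[OF \<beta>_smooth] in auto)
  have "\<beta> (0, 0) = p" by (simp add: \<beta>_def vec_eq_iff)
  then have "(0, 0) \<in> S'" using S(2) i by (simp add: S'_def S0_def)
  define h where "h = (\<lambda>q. X (\<beta> q) $ j / X (\<beta> q) $ i)"
  have X\<beta>: "smooth_on S' (\<lambda>q. X (\<beta> q))"
    by (rule smooth_on_compose[OF \<open>open S'\<close> S(1) _ \<beta>_smooth[OF \<open>open S'\<close>] S(3)]) (auto simp: S'_def S0_def)
  have "smooth_on S' h" unfolding h_def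
    by (intro smooth_on_divide \<open>open S'\<close> smooth_on_vec_nth X\<beta>) (auto simp: S'_def S0_def)
  obtain R Wq and \<Phi> \<Psi> :: "real \<times> real \<Rightarrow> real \<times> real" where F: "open R" "open Wq" "Wq \<subseteq> S'" "(0, 0) \<in> Wq" "\<Phi> ` R = Wq"
    "smooth_on R \<Phi>" "smooth_on Wq \<Psi>" "\<And>p. p \<in> R \<Longrightarrow> \<Psi> (\<Phi> p) = p"
    "\<And>w. w \<in> Wq \<Longrightarrow> jac \<Psi> w (1, h w) = (1, 0)"
    by (rule plane_flow_box[OF \<open>open S'\<close> \<open>(0, 0) \<in> S'\<close> \<open>smooth_on S' h\<close>]) (assumption | blast)+
  define V where "V = \<alpha> -` Wq"
  define \<gamma> where "\<gamma> = (\<lambda>w :: real ^ 2. (w $ 1, w $ 2))"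
  define \<delta> where "\<delta> = (\<lambda>q :: real \<times> real. (\<chi> k. if k = 1 then fst q else snd q) :: real ^ 2)"
  have \<gamma>\<delta>: "\<gamma> (\<delta> q) = q" "\<delta> (\<gamma> w) = w" for q w
    by (simp_all add: \<gamma>_def \<delta>_def vec_eq_iff forall_2)
  have \<gamma>_smooth: "smooth_on T \<gamma>" if "open T" for T
    unfolding \<gamma>_def using that by (intro smooth_on_Pair smooth_on_vec_nth smooth_on_id)
  define W where "W = \<gamma> -` R"
  define \<phi> where "\<phi> = (\<lambda>z. \<delta> (\<Psi> (\<alpha> z)))"
  define \<psi> where "\<psi> = (\<lambda>w. \<beta> (\<Phi> (\<gamma> w)))"
  have V: "open V" unfolding V_def
    by (rule open_vimage[OF F(2)]) (use smooth_on_continuous[OF \<alpha>_smooth] in auto)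
  have W: "open W" unfolding W_def
    by (rule open_vimage[OF F(1)]) (use smooth_on_continuous[OF \<gamma>_smooth] in auto)
  have \<Psi>\<alpha>: "smooth_on V (\<lambda>z. \<Psi> (\<alpha> z))"
    by (rule smooth_on_compose[OF V F(2) _ \<alpha>_smooth[OF V] F(7)]) (auto simp: V_def)
  show thesis
  proof (rule that[of V W \<phi> \<psi>])
    show "p \<in> V" using F(4) by (simp add: V_def \<alpha>_def)
    show "V \<subseteq> S" using F(3) \<alpha>\<beta>(2) by (force simp: V_def S'_def S0_def)
    show "smooth_on V \<phi>"
    proof (rule smooth_on_vec[OF V])
      show "smooth_on V (\<lambda>z. \<phi> z $ k)" for k
        unfolding \<phi>_def \<delta>_def using smooth_on_fst[OF V \<Psi>\<alpha>] smooth_on_snd[OF V \<Psi>\<alpha>] by (cases "k = 1") auto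
    qed
    have \<Phi>\<gamma>: "smooth_on W (\<lambda>w. \<Phi> (\<gamma> w))"
      by (rule smooth_on_compose[OF W F(1) _ \<gamma>_smooth[OF W] F(6)]) (auto simp: W_def)
    show "smooth_on W \<psi>" unfolding \<psi>_def
      by (rule smooth_on_compose[OF W open_UNIV _ \<Phi>\<gamma> \<beta>_smooth]) auto
    have \<Psi>R: "\<Psi> w \<in> R" "\<Phi> (\<Psi> w) = w" if "w \<in> Wq" for w using F(5,8) that by auto
    show "\<phi> z \<in> W \<and> \<psi> (\<phi> z) = z" if "z \<in> V" for z
      using that \<Psi>R[of "\<alpha> z"] by (simp add: V_def W_def \<phi>_def \<psi>_def \<gamma>\<delta> \<alpha>\<beta>)
    show "\<psi> w \<in> V \<and> \<phi> (\<psi> w) = w" if "w \<in> W" for w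
      using that F(5,8) by (auto simp: V_def W_def \<phi>_def \<psi>_def \<gamma>\<delta> \<alpha>\<beta>)
    show "jac \<phi> z (X z) $ 2 = 0" if z: "z \<in> V" for z
    proof -
      have zW: "\<alpha> z \<in> Wq" using z by (simp add: V_def)
      have zS: "X z $ i \<noteq> 0" using zW F(3) \<alpha>\<beta>(2) by (force simp: S'_def S0_def)
      have d\<Psi>: "(\<Psi> has_derivative jac \<Psi> (\<alpha> z)) (at (\<alpha> z))"
        by (rule smooth_on_has_derivative[OF F(7) zW])
      have d\<alpha>: "(\<alpha> has_derivative (\<lambda>v. (v $ i, v $ j))) (at z)"
        unfolding \<alpha>_def by (auto intro!: derivative_eq_intros bounded_linear.has_derivative[OF bounded_linear_vec_nth])
      have "((\<lambda>z. snd (\<Psi> (\<alpha> z))) has_derivative (\<lambda>v. snd (jac \<Psi> (\<alpha> z) (v $ i, v $ j)))) (at z)"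
        by (rule has_derivative_snd[OF has_derivative_compose[OF d\<alpha> d\<Psi>]])
      moreover have "((\<lambda>z. snd (\<Psi> (\<alpha> z))) has_derivative (\<lambda>v. jac \<phi> z v $ 2)) (at z)"
      proof -
        have "(\<lambda>z. \<phi> z $ 2) = (\<lambda>z. snd (\<Psi> (\<alpha> z)))" by (simp add: \<phi>_def \<delta>_def)
        then show ?thesis
          using bounded_linear.has_derivative[OF bounded_linear_vec_nth smooth_on_has_derivative[OF \<open>smooth_on V \<phi>\<close> z], of 2]
          by simp
      qed
      ultimately have eq: "(\<lambda>v. snd (jac \<Psi> (\<alpha> z) (v $ i, v $ j))) = (\<lambda>v. jac \<phi> z v $ 2)"
        by (rule has_derivative_unique)
      have "jac \<phi> z (X z) $ 2 = snd (jac \<Psi> (\<alpha> z) (X z $ i, X z $ j))"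
        using fun_cong[OF eq, of "X z"] by simp
      moreover have "(X z $ i, X z $ j) = (X z $ i) *\<^sub>R (1, h (\<alpha> z))"
        using zS by (simp add: h_def \<alpha>\<beta>)
      moreover have "jac \<Psi> (\<alpha> z) ((X z $ i) *\<^sub>R (1, h (\<alpha> z)))
          = (X z $ i) *\<^sub>R jac \<Psi> (\<alpha> z) (1, h (\<alpha> z))"
        by (rule linear_scale[OF has_derivative_linear[OF d\<Psi>]])
      ultimately have "jac \<phi> z (X z) $ 2 = snd ((X z $ i) *\<^sub>R jac \<Psi> (\<alpha> z) (1, h (\<alpha> z)))"
        by (simp only:)
      then show ?thesis by (simp add: F(9)[OF zW])
    qed
  qed (use V W in auto)
qed

section \<open>Tangent and cotangent spaces in a chart\<close>

lemma dim_linear_image_eq: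
  fixes f :: "'a::real_vector \<Rightarrow> 'b::real_vector"
  assumes "linear f" "inj_on f (span S)"
  shows "dim (f ` S) = dim S"
proof -
  obtain B where B: "B \<subseteq> S" "independent B" "S \<subseteq> span B" "card B = dim S"
    using real_vector.basis_exists[of S] by auto
  have sp: "span S = span B" by (metis B(1,3) span_mono span_span subset_antisym)
  have "dim (f ` S) = dim (span (f ` S))" by (simp add: real_vector.dim_span)
  also have "span (f ` S) = span (f ` B)" using sp assms(1) by (metis linear_span_image)
  also have "dim \<dots> = card (f ` B)"
    using linear_independent_injective_image[OF assms(1) B(2)] assms(2) sp
    by (metis real_vector.dim_span_eq_card_independent)
  also have "\<dots> = card B"
    using assms(2) sp by (metis card_image inj_on_subset span_superset)
  finally show ?thesis using B by simp
qed

lemma scaleR_fun_apply [simp]: "(r *\<^sub>R f) x = r *\<^sub>R f x"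
  by (simp add: scaleR_fun_def)

lemma linear_vec_expansion:
  fixes f :: "real ^ 'n \<Rightarrow> 'b::real_vector"
  assumes "linear f"
  shows "f u = (\<Sum>i\<in>UNIV. (u $ i) *\<^sub>R f (axis i 1))"
proof -
  have "f u = f (\<Sum>i\<in>UNIV. (u $ i) *\<^sub>R axis i 1)"
    using basis_expansion[of u] by (simp add: scalar_mult_eq_scaleR)
  then show ?thesis by (simp add: linear_sum[OF assms] linear_scale[OF assms])
qed

text \<open>
  A chart \<open>c\<close> around \<open>p\<close> identifies the tangent space \<open>T p\<close> with \<open>\<real>\<^sup>n\<close> by evaluation at \<open>c\<close>, and the fibre
  \<open>TT p\<close> of the generalized tangent bundle with \<open>\<real>\<^sup>n \<times> \<real>\<^sup>n\<close> by \<open>G c p\<close>.  All statements about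
  Lagrangians are transported along this linear isomorphism.
\<close>
locale smooth_mfd =
  fixes M :: "'a topology" and A :: "('a, 'n::finite) chart set"
  assumes smooth_manifold: "smooth_manifold M A"
begin

lemma
  assumes "c \<in> A"
  shows openin_chart: "openin M (fst c)"
    and chart_subset: "fst c \<subseteq> topspace M"
    and chart_homeo: "homeomorphic_map (subtopology M (fst c)) (top_of_set (snd c ` fst c)) (snd c)"
    and chart_inj: "inj_on (snd c) (fst c)"
    and open_chart_image: "open (snd c ` fst c)"
proof -
  have c: "chart_on M c" using smooth_manifold assms by (auto simp: smooth_manifold_def)
  then show o: "openin M (fst c)" "open (snd c ` fst c)"
    and h: "homeomorphic_map (subtopology M (fst c)) (top_of_set (snd c ` fst c)) (snd c)"
    by (auto simp: chart_on_def)
  show sub: "fst c \<subseteq> topspace M" using o openin_subset by blast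
  show "inj_on (snd c) (fst c)"
    using homeomorphic_imp_injective_map[OF h] sub by (simp add: Int_absorb1)
qed

lemma chart_inv_left: "c \<in> A \<Longrightarrow> p \<in> fst c \<Longrightarrow> chart_inv c (snd c p) = p"
  by (simp add: chart_inj)

lemma open_chart_image_Int:
  assumes "c \<in> A" "openin M U"
  shows "open (snd c ` (fst c \<inter> U))"
proof -
  have "openin (subtopology M (fst c)) (fst c \<inter> U)"
    using assms(2) by (auto simp: openin_subtopology Int_commute)
  then have "openin (top_of_set (snd c ` fst c)) (snd c ` (fst c \<inter> U))"
    using homeomorphic_imp_open_map[OF chart_homeo[OF assms(1)]] by (simp add: open_map_def)
  then show ?thesis using openin_open_eq[OF open_chart_image[OF assms(1)]] by blast
qed

lemma open_chart_image_subset: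
  "c \<in> A \<Longrightarrow> openin M U \<Longrightarrow> U \<subseteq> fst c \<Longrightarrow> open (snd c ` U)"
  using open_chart_image_Int[of c U] by (simp add: Int_absorb1)

lemma openin_chart_preimage:
  assumes "c \<in> A" "open V"
  shows "openin M {p \<in> fst c. snd c p \<in> V}"
proof -
  have "openin (top_of_set (snd c ` fst c)) (snd c ` fst c \<inter> V)"
    using assms(2) by (simp add: openin_open_Int)
  then have "openin (subtopology M (fst c)) {p \<in> topspace (subtopology M (fst c)). snd c p \<in> snd c ` fst c \<inter> V}"
    using homeomorphic_imp_continuous_map[OF chart_homeo[OF assms(1)]] unfolding continuous_map_def by blast
  moreover have "{p \<in> topspace (subtopology M (fst c)). snd c p \<in> snd c ` fst c \<inter> V} = {p \<in> fst c. snd c p \<in> V}"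
    using chart_subset[OF assms(1)] by auto
  ultimately show ?thesis using openin_trans_full[OF _ openin_chart[OF assms(1)]] by simp
qed

lemma transition_apply: "c \<in> A \<Longrightarrow> p \<in> fst c \<Longrightarrow> transition c d (snd c p) = snd d p"
  by (simp add: transition_def chart_inv_left)

lemma transition_smooth: "c \<in> A \<Longrightarrow> d \<in> A \<Longrightarrow> smooth_on (snd c ` (fst c \<inter> fst d)) (transition c d)"
  using smooth_manifold by (auto simp: smooth_manifold_def smoothly_compatible_def)

lemma open_overlap: "c \<in> A \<Longrightarrow> d \<in> A \<Longrightarrow> open (snd c ` (fst c \<inter> fst d))"
  by (simp add: open_chart_image_Int openin_chart)

abbreviation trD where "trD c d p \<equiv> jac (transition c d) (snd c p)"

lemma charts_atD: "c \<in> charts_at A p \<Longrightarrow> c \<in> A \<and> p \<in> fst c"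
  by (simp add: charts_at_def)

lemma transition_has_derivative:
  "c \<in> charts_at A p \<Longrightarrow> d \<in> charts_at A p \<Longrightarrow> (transition c d has_derivative trD c d p) (at (snd c p))"
  by (rule smooth_on_has_derivative[OF transition_smooth]) (auto simp: charts_at_def)

lemma trD_linear: "c \<in> charts_at A p \<Longrightarrow> d \<in> charts_at A p \<Longrightarrow> linear (trD c d p)"
  using transition_has_derivative has_derivative_linear by blast

text \<open>
  The cocycle condition, the chain rule for transition maps; it makes \<^const>\<open>tvector_of\<close> a tangent vector.
\<close>
lemma trD_trD:
  assumes "c \<in> charts_at A p" "d \<in> charts_at A p" "e \<in> charts_at A p"
  shows "trD d e p (trD c d p v) = trD c e p v"
proof -
  have A: "c \<in> A" "d \<in> A" "e \<in> A" "p \<in> fst c" "p \<in> fst d" "p \<in> fst e" using assms by (auto simp: charts_at_def)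
  let ?U = "fst c \<inter> (fst d \<inter> fst e)"
  have "((\<lambda>x. transition d e (transition c d x)) has_derivative (\<lambda>v. trD d e p (trD c d p v))) (at (snd c p))"
    by (rule has_derivative_compose[OF transition_has_derivative[OF assms(1,2)]])
       (use transition_has_derivative[OF assms(2,3)] in \<open>simp add: transition_apply A\<close>)
  then have "(transition c e has_derivative (\<lambda>v. trD d e p (trD c d p v))) (at (snd c p))"
  proof (rule has_derivative_transform_within_open)
    show "open (snd c ` ?U)" by (intro open_chart_image_Int A openin_Int openin_chart)
    show "snd c p \<in> snd c ` ?U" using A by auto
  qed (auto simp: transition_apply A)
  then show ?thesis using transition_has_derivative[OF assms(1,3)] has_derivative_unique by metis
qed

lemma trD_self:
  assumes "c \<in> charts_at A p"
  shows "trD c c p v = v"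
proof -
  have A: "c \<in> A" "p \<in> fst c" using assms by (auto simp: charts_at_def)
  have "((\<lambda>x. x) has_derivative (\<lambda>v. v)) (at (snd c p))" by simp
  then have "(transition c c has_derivative (\<lambda>v. v)) (at (snd c p))"
    by (rule has_derivative_transform_within_open[OF _ open_chart_image[OF A(1)]]) (auto simp: transition_apply A)
  then show ?thesis using transition_has_derivative[OF assms assms] has_derivative_unique by metis
qed

abbreviation "T p \<equiv> tangent_space A p"
abbreviation "T' p \<equiv> cotangent_space A p"

lemma tangent_space_trD:
  "v \<in> T p \<Longrightarrow> c \<in> charts_at A p \<Longrightarrow> d \<in> charts_at A p \<Longrightarrow> v d = trD c d p (v c)"
  unfolding tangent_space_def by blast

lemma tangent_space_outside: "v \<in> T p \<Longrightarrow> c \<notin> charts_at A p \<Longrightarrow> v c = 0"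
  unfolding tangent_space_def by blast

lemma tvector_of_apply: "d \<in> charts_at A p \<Longrightarrow> tvector_of A c p u d = trD c d p u"
  by (simp add: tvector_of_def)

lemma tvector_of_same: "c \<in> charts_at A p \<Longrightarrow> tvector_of A c p u c = u"
  by (simp add: tvector_of_apply trD_self)

lemma tvector_of_in: "c \<in> charts_at A p \<Longrightarrow> tvector_of A c p u \<in> T p"
  by (auto simp: tangent_space_def tvector_of_apply trD_trD) (simp add: tvector_of_def)

lemma tvector_of_eqI:
  assumes "v \<in> T p" "c \<in> charts_at A p" shows "tvector_of A c p (v c) = v"
proof
  fix d
  show "tvector_of A c p (v c) d = v d"
  proof (cases "d \<in> charts_at A p")
    case True
    then show ?thesis using tangent_space_trD[OF assms True] by (simp only: tvector_of_apply)
  next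
    case False
    then show ?thesis using tangent_space_outside[OF assms(1)] by (simp add: tvector_of_def)
  qed
qed

lemma tangent_eqI: "v \<in> T p \<Longrightarrow> w \<in> T p \<Longrightarrow> c \<in> charts_at A p \<Longrightarrow> v c = w c \<Longrightarrow> v = w"
  by (metis tvector_of_eqI)

lemma linear_tvector_of:
  assumes "c \<in> charts_at A p" shows "linear (tvector_of A c p)"
proof (rule linearI)
  fix u v :: "real ^ 'n" and r :: real
  show "tvector_of A c p (u + v) = tvector_of A c p u + tvector_of A c p v"
    using linear_add[OF trD_linear[OF assms]] by (auto simp: fun_eq_iff tvector_of_def)
  show "tvector_of A c p (r *\<^sub>R u) = r *\<^sub>R tvector_of A c p u"
    using linear_scale[OF trD_linear[OF assms]] by (auto simp: fun_eq_iff tvector_of_def)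
qed

lemma tangent_space_image:
  assumes "c \<in> charts_at A p" shows "T p = range (tvector_of A c p)"
  by (auto intro: tvector_of_in[OF assms]) (metis rangeI tvector_of_eqI[OF _ assms])

lemma subspace_tangent_space:
  assumes "c \<in> charts_at A p" shows "subspace (T p)"
  unfolding tangent_space_image[OF assms] by (rule linear_subspace_image[OF linear_tvector_of[OF assms] subspace_UNIV])

lemma dim_tangent_space:
  assumes "c \<in> charts_at A p" shows "dim (T p) = CARD('n)"
proof -
  have "inj (tvector_of A c p)" by (rule injI) (metis tvector_of_same[OF assms])
  then have "dim (tvector_of A c p ` UNIV) = dim (UNIV :: (real ^ 'n) set)"
    by (intro dim_linear_image_eq linear_tvector_of[OF assms]) (auto intro: inj_on_subset)
  then show ?thesis by (simp add: tangent_space_image[OF assms])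
qed

lemma subspace_dual_space: "subspace (dual_space V)"
  by (auto simp: subspace_def dual_space_def algebra_simps)

lemma covector_eq:
  assumes "\<xi> \<in> T' p" "c \<in> charts_at A p" "v \<in> T p"
  shows "\<xi> v = covector_coords A c p \<xi> \<bullet> v c"
proof -
  have "linear (\<lambda>u. \<xi> (tvector_of A c p u))"
  proof (rule linearI)
    fix u v :: "real ^ 'n" and r :: real
    show "\<xi> (tvector_of A c p (u + v)) = \<xi> (tvector_of A c p u) + \<xi> (tvector_of A c p v)"
      using assms(1) tvector_of_in[OF assms(2)] by (simp add: linear_add[OF linear_tvector_of[OF assms(2)]] dual_space_def)
    show "\<xi> (tvector_of A c p (r *\<^sub>R u)) = r *\<^sub>R \<xi> (tvector_of A c p u)"
      using assms(1) tvector_of_in[OF assms(2)] by (simp add: linear_scale[OF linear_tvector_of[OF assms(2)]] dual_space_def)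
  qed
  from linear_vec_expansion[OF this, of "v c"] show ?thesis
    by (simp add: tvector_of_eqI[OF assms(3,2)] covector_coords_def inner_vec_def mult.commute)
qed

text \<open>
  The inverse of \<^const>\<open>covector_coords\<close>.
\<close>
definition covector_of :: "('a, 'n) chart \<Rightarrow> 'a \<Rightarrow> real ^ 'n \<Rightarrow> ('a, 'n) covector" where
  "covector_of c p w = (\<lambda>v. if v \<in> T p then w \<bullet> v c else 0)"

lemma covector_of_in: "c \<in> charts_at A p \<Longrightarrow> covector_of c p w \<in> T' p"
  using subspace_tangent_space[of c p]
  by (auto simp: dual_space_def covector_of_def subspace_add subspace_scale inner_add_right)

lemma covector_coords_of: "c \<in> charts_at A p \<Longrightarrow> covector_coords A c p (covector_of c p w) = w"
  by (simp add: covector_coords_def covector_of_def tvector_of_in tvector_of_same vec_eq_iff inner_axis)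

lemma covector_of_coords: "\<xi> \<in> T' p \<Longrightarrow> c \<in> charts_at A p \<Longrightarrow> covector_of c p (covector_coords A c p \<xi>) = \<xi>"
  by (auto simp: fun_eq_iff covector_of_def covector_eq) (simp add: dual_space_def)

abbreviation "TT p \<equiv> T p \<times> T' p"
abbreviation "G c p \<equiv> gvector_coords A c p"

definition gvector_of :: "('a, 'n) chart \<Rightarrow> 'a \<Rightarrow> (real ^ 'n) \<times> (real ^ 'n) \<Rightarrow> ('a, 'n) gvector" where
  "gvector_of c p g = (tvector_of A c p (fst g), covector_of c p (snd g))"

lemma gvector_of_in: "c \<in> charts_at A p \<Longrightarrow> gvector_of c p g \<in> TT p"
  by (simp add: gvector_of_def tvector_of_in covector_of_in)

lemma coords_gvector_of: "c \<in> charts_at A p \<Longrightarrow> G c p (gvector_of c p g) = g"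
  by (simp add: gvector_of_def gvector_coords_def tvector_of_same covector_coords_of)

lemma gvector_of_coords: "a \<in> TT p \<Longrightarrow> c \<in> charts_at A p \<Longrightarrow> gvector_of c p (G c p a) = a"
  by (auto simp: gvector_of_def gvector_coords_def tvector_of_eqI covector_of_coords)

lemma linear_gvector_coords: "linear (G c p)"
  by (rule linearI) (auto simp: gvector_coords_def covector_coords_def vec_eq_iff)

lemma inj_on_gvector_coords: "c \<in> charts_at A p \<Longrightarrow> inj_on (G c p) (TT p)"
  by (rule inj_onI) (metis gvector_of_coords)

lemma subspace_TT: "c \<in> charts_at A p \<Longrightarrow> subspace (TT p)"
  by (intro subspace_Times subspace_tangent_space subspace_dual_space)

text \<open>
  Twice the pairing, in coordinates.
\<close>
definition ip :: "(real ^ 'n) \<times> (real ^ 'n) \<Rightarrow> (real ^ 'n) \<times> (real ^ 'n) \<Rightarrow> real" where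
  "ip a b = snd a \<bullet> fst b + snd b \<bullet> fst a"

lemma pairing_coords:
  assumes "a \<in> TT p" "b \<in> TT p" "c \<in> charts_at A p"
  shows "pairing a b = (1/2) * ip (G c p a) (G c p b)"
  using assms by (auto simp: pairing_def ip_def gvector_coords_def covector_eq[OF _ assms(3)])

definition LagR :: "((real ^ 'n) \<times> (real ^ 'n)) set \<Rightarrow> bool" where
  "LagR W \<longleftrightarrow> subspace W \<and> dim W = CARD('n) \<and> (\<forall>a\<in>W. \<forall>b\<in>W. ip a b = 0)"

lemma subspace_coords_iff:
  assumes "L \<subseteq> TT p" "c \<in> charts_at A p"
  shows "subspace (G c p ` L) \<longleftrightarrow> subspace L"
proof
  assume "subspace (G c p ` L)"
  then have "subspace (TT p \<inter> (G c p) -` (G c p ` L))"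
    by (intro subspace_inter subspace_TT[OF assms(2)] linear_subspace_vimage linear_gvector_coords)
  moreover have "TT p \<inter> (G c p) -` (G c p ` L) = L"
    using inj_on_image_mem_iff[OF inj_on_gvector_coords[OF assms(2)] _ assms(1)] assms(1) by blast
  ultimately show "subspace L" by simp
qed (rule linear_subspace_image[OF linear_gvector_coords])

lemma dim_coords:
  assumes "L \<subseteq> TT p" "subspace L" "c \<in> charts_at A p"
  shows "dim (G c p ` L) = dim L"
proof (rule dim_linear_image_eq[OF linear_gvector_coords])
  have "span L = L" using assms(2) span_eq_iff by blast
  then show "inj_on (G c p) (span L)"
    using inj_on_subset[OF inj_on_gvector_coords[OF assms(3)] assms(1)] by (simp only:)
qed

lemma Lag_coords_iff:
  assumes "L \<subseteq> TT p" "c \<in> charts_at A p"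
  shows "L \<in> Lag (T p) \<longleftrightarrow> LagR (G c p ` L)"
proof -
  have "(\<forall>a\<in>L. \<forall>b\<in>L. pairing a b = 0) \<longleftrightarrow> (\<forall>a\<in>G c p ` L. \<forall>b\<in>G c p ` L. ip a b = 0)"
  proof -
    have "pairing a b = 0 \<longleftrightarrow> ip (G c p a) (G c p b) = 0" if "a \<in> L" "b \<in> L" for a b
    proof -
      have ab: "a \<in> TT p" "b \<in> TT p" using that assms(1) by blast+
      show ?thesis using pairing_coords[OF ab assms(2)] by linarith
    qed
    then show ?thesis by (simp cong: ball_cong)
  qed
  then show ?thesis
    using assms subspace_coords_iff[OF assms] dim_coords[OF assms(1) _ assms(2)] dim_tangent_space[OF assms(2)]
    by (auto simp: Lag_def LagR_def)
qed

lemma Lag_subset: "L \<in> Lag (T p) \<Longrightarrow> L \<subseteq> TT p"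
  by (simp add: Lag_def)

text \<open>
  The orthogonal complement of an isotropic subspace for \<^const>\<open>ip\<close> is the Euclidean complement of its
  image under the swap of the two factors; for a Lagrangian it has the same dimension as the subspace.
\<close>
lemma LagR_maximal:
  assumes "LagR W" "\<And>a. a \<in> W \<Longrightarrow> ip a b = 0"
  shows "b \<in> W"
proof -
  define J where "J = (\<lambda>a :: (real ^ 'n) \<times> (real ^ 'n). (snd a, fst a))"
  have J: "linear J" by (rule linearI) (auto simp: J_def)
  have "inj J" by (rule injI) (auto simp: J_def prod_eq_iff)
  have ip: "ip a b = J a \<bullet> b" for a b by (simp add: ip_def J_def inner_prod_def inner_commute)
  let ?W' = "{b \<in> UNIV. \<forall>x\<in>J ` W. orthogonal x b}"
  have W: "subspace W" "dim W = CARD('n)" "\<And>a b. a \<in> W \<Longrightarrow> b \<in> W \<Longrightarrow> ip a b = 0"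
    using assms(1) by (auto simp: LagR_def)
  have "dim (J ` W) = dim W"
    by (rule dim_linear_image_eq[OF J]) (use \<open>inj J\<close> inj_on_subset in auto)
  moreover have "dim ?W' + dim (J ` W) = dim (UNIV :: ((real ^ 'n) \<times> (real ^ 'n)) set)"
    by (rule dim_subspace_orthogonal_to_vectors[OF linear_subspace_image[OF J W(1)] subspace_UNIV]) simp
  ultimately have "dim ?W' = dim W" using W(2) by simp
  moreover have "W \<subseteq> ?W'" using W(3) by (auto simp: ip orthogonal_def)
  moreover have "subspace ?W'" by (auto simp: subspace_def orthogonal_def inner_add_right)
  ultimately have "W = ?W'" using W(1) by (metis (no_types, lifting) order_refl subspace_dim_equal)
  moreover have "b \<in> ?W'" using assms(2) by (auto simp: ip orthogonal_def)
  ultimately show ?thesis by simp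
qed

text \<open>
  The covector part is expressed by the derivative of the reverse transition map, so no matrix needs to be
  inverted.
\<close>
lemma gvector_coords_change:
  assumes "a \<in> TT p" "c \<in> charts_at A p" "d \<in> charts_at A p"
  shows "G d p a = (trD c d p (fst (G c p a)), \<chi> i. snd (G c p a) \<bullet> trD d c p (axis i 1))"
proof -
  have "covector_coords A d p (snd a) = (\<chi> i. covector_coords A c p (snd a) \<bullet> trD d c p (axis i 1))"
    using assms(1) covector_eq[of "snd a" p c] assms tvector_of_in[OF assms(3)]
    by (auto simp: covector_coords_def[of A d] tvector_of_apply)
  moreover have "fst a d = trD c d p (fst a c)"
    by (rule tangent_space_trD[OF _ assms(2,3)]) (use assms(1) in auto)
  ultimately show ?thesis by (simp add: gvector_coords_def)
qed

text \<open>
  The local representative of a section; \<open>vloc\<close>, \<open>floc\<close> and \<open>Eloc\<close> below are those of its two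
  components and of a subbundle.
\<close>
abbreviation gloc :: "('a, 'n) chart \<Rightarrow> ('a \<Rightarrow> ('a, 'n) gvector) \<Rightarrow> real ^ 'n \<Rightarrow> (real ^ 'n) \<times> (real ^ 'n)" where
  "gloc c a \<equiv> (\<lambda>x. G c (chart_inv c x) (a (chart_inv c x)))"

lemma smooth_gsection_on_subset:
  "smooth_gsection_on A U a \<Longrightarrow> U' \<subseteq> U \<Longrightarrow> smooth_gsection_on A U' a"
  unfolding smooth_gsection_on_def by (blast intro: smooth_on_subset)

lemma smooth_gsection_on_local:
  assumes "\<And>p. p \<in> U \<Longrightarrow> \<exists>U'. openin M U' \<and> p \<in> U' \<and> smooth_gsection_on A U' a"
  shows "smooth_gsection_on A U a"
  unfolding smooth_gsection_on_def
proof (intro ballI smooth_on_local)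
  fix c x assume c: "c \<in> A" and "x \<in> snd c ` (fst c \<inter> U)"
  then obtain p where p: "p \<in> fst c" "p \<in> U" "x = snd c p" by auto
  obtain U' where U': "openin M U'" "p \<in> U'" "smooth_gsection_on A U' a" using assms[OF p(2)] by auto
  then show "\<exists>V. open V \<and> x \<in> V \<and> smooth_on V (gloc c a)"
    using c p by (intro exI[of _ "snd c ` (fst c \<inter> U')"]) (auto simp: open_chart_image_Int smooth_gsection_on_def)
qed

text \<open>
  One chart suffices, because components in another chart depend on those in the first through derivatives
  of the smooth transition maps.
\<close>
lemma smooth_gsection_onI:
  assumes c: "c \<in> A" and U: "openin M U" "U \<subseteq> fst c" and a: "\<And>q. q \<in> U \<Longrightarrow> a q \<in> TT q"
    and sm: "smooth_on (snd c ` U) (gloc c a)"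
  shows "smooth_gsection_on A U a"
  unfolding smooth_gsection_on_def
proof (intro ballI)
  fix d assume d: "d \<in> A"
  let ?S = "snd d ` (fst d \<inter> U)" and ?S' = "snd c ` (fst d \<inter> U)"
  have S: "open ?S" by (rule open_chart_image_Int[OF d U(1)])
  have S': "open ?S'" by (rule open_chart_image_subset[OF c]) (use U openin_Int[OF openin_chart[OF d] U(1)] in auto)
  let ?\<tau> = "transition d c"
  have \<tau>: "smooth_on ?S ?\<tau>" by (rule smooth_on_subset[OF transition_smooth[OF d c]]) (use U in auto)
  have \<tau>S: "?\<tau> y \<in> ?S'" if "y \<in> ?S" for y using that d by (auto simp: transition_apply)
  have sm': "smooth_on ?S' (gloc c a)" by (rule smooth_on_subset[OF sm]) auto
  have 1: "smooth_on ?S (\<lambda>y. gloc c a (?\<tau> y))"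
    by (rule smooth_on_compose[OF S S' \<tau>S \<tau> sm'])
  have "smooth_on ?S' (\<lambda>x. jac (transition c d) x (fst (gloc c a x)))"
    by (intro smooth_on_frechet_derivative_apply S' smooth_on_fst sm' smooth_on_subset[OF transition_smooth[OF c d]])
       (use U in auto)
  from smooth_on_compose[OF S S' \<tau>S \<tau> this]
  have 2: "smooth_on ?S (\<lambda>y. jac (transition c d) (?\<tau> y) (fst (gloc c a (?\<tau> y))))" .
  have 3: "smooth_on ?S (\<lambda>y. \<chi> i. snd (gloc c a (?\<tau> y)) \<bullet> jac ?\<tau> y (axis i 1))"
    by (rule smooth_on_vec[OF S])
       (simp, intro smooth_on_inner S smooth_on_snd 1 smooth_on_frechet_derivative \<tau>)
  show "smooth_on ?S (gloc d a)"
  proof (rule smooth_on_cong[OF S _ smooth_on_Pair[OF S 2 3]])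
    fix y assume "y \<in> ?S"
    then obtain p where p: "p \<in> fst d" "p \<in> U" "y = snd d p" by auto
    have ch: "c \<in> charts_at A p" "d \<in> charts_at A p" using p U c d by (auto simp: charts_at_def)
    have t: "?\<tau> y = snd c p" using p d by (simp add: transition_apply)
    show "(jac (transition c d) (?\<tau> y) (fst (gloc c a (?\<tau> y))),
        \<chi> i. snd (gloc c a (?\<tau> y)) \<bullet> jac ?\<tau> y (axis i 1)) = gloc d a y"
      using gvector_coords_change[OF a[OF p(2)] ch] ch unfolding t
      by (simp add: p chart_inv_left charts_at_def)
  qed
qed

lemma charts_at_nonempty: "p \<in> topspace M \<Longrightarrow> \<exists>c. c \<in> charts_at A p"
proof -
  assume "p \<in> topspace M"
  moreover have "(\<Union>c\<in>A. fst c) = topspace M" using smooth_manifold unfolding smooth_manifold_def by blast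
  ultimately show ?thesis unfolding charts_at_def by blast
qed

lemma chart_at_in: "p \<in> topspace M \<Longrightarrow> chart_at A p \<in> charts_at A p"
  unfolding chart_at_def using charts_at_nonempty by (metis someI_ex)

end

section \<open>The Courant bracket in a chart\<close>

definition lie_local :: "(real ^ 'n \<Rightarrow> real ^ 'n) \<Rightarrow> (real ^ 'n \<Rightarrow> real ^ 'n) \<Rightarrow> real ^ 'n \<Rightarrow> real ^ 'n" where
  "lie_local X Y x = jac Y x (X x) - jac X x (Y x)"

definition lie_deriv_local ::
    "(real ^ 'n \<Rightarrow> real ^ 'n) \<Rightarrow> (real ^ 'n \<Rightarrow> real ^ 'n) \<Rightarrow> real ^ 'n \<Rightarrow> real ^ 'n \<Rightarrow> real" where
  "lie_deriv_local X \<eta> x v = jac \<eta> x (X x) \<bullet> v + \<eta> x \<bullet> jac X x v"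

definition courant_form_local ::
    "(real ^ 'n \<Rightarrow> real ^ 'n) \<Rightarrow> (real ^ 'n \<Rightarrow> real ^ 'n) \<Rightarrow> (real ^ 'n \<Rightarrow> real ^ 'n) \<Rightarrow> (real ^ 'n \<Rightarrow> real ^ 'n)
      \<Rightarrow> real ^ 'n \<Rightarrow> real ^ 'n \<Rightarrow> real" where
  "courant_form_local X \<xi> Y \<eta> x v = lie_deriv_local X \<eta> x v - lie_deriv_local Y \<xi> x v
     - (1/2) * jac (\<lambda>y. \<eta> y \<bullet> X y - \<xi> y \<bullet> Y y) x v"

lemma has_derivative_frechet_derivative_apply:
  fixes \<tau> :: "'a::euclidean_space \<Rightarrow> 'b::real_normed_vector"
  assumes S: "open S" "x \<in> S" "smooth_on S \<tau>" and X: "smooth_on S X"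
  shows "((\<lambda>y. jac \<tau> y (X y)) has_derivative
     (\<lambda>w. jac (\<lambda>y. jac \<tau> y (X x)) x w +
          jac \<tau> x (jac X x w))) (at x)"
proof -
  let ?D2 = "\<lambda>u. jac (\<lambda>y. jac \<tau> y u) x"
  have d\<tau>: "((\<lambda>y. jac \<tau> y u) has_derivative ?D2 u) (at x)" for u
    by (rule smooth_on_has_derivative[OF smooth_on_frechet_derivative[OF S(3)] S(2)])
  have dX: "(X has_derivative jac X x) (at x)"
    by (rule smooth_on_has_derivative[OF X S(2)])
  have expand: "jac \<tau> y u = (\<Sum>b\<in>Basis. (u \<bullet> b) *\<^sub>R jac \<tau> y b)"
    if "y \<in> S" for y u
    by (rule frechet_derivative_basis_expansion[OF smooth_on_differentiable[OF S(3) that]])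
  have D2: "?D2 u w = (\<Sum>b\<in>Basis. (u \<bullet> b) *\<^sub>R ?D2 b w)" for u w
  proof -
    have "((\<lambda>y. \<Sum>b\<in>Basis. (u \<bullet> b) *\<^sub>R jac \<tau> y b) has_derivative (\<lambda>w. \<Sum>b\<in>Basis. (u \<bullet> b) *\<^sub>R ?D2 b w)) (at x)"
      by (intro has_derivative_sum bounded_linear.has_derivative[OF bounded_linear_scaleR_right] d\<tau>)
    then have "((\<lambda>y. jac \<tau> y u) has_derivative (\<lambda>w. \<Sum>b\<in>Basis. (u \<bullet> b) *\<^sub>R ?D2 b w)) (at x)"
      by (rule has_derivative_transform_within_open[OF _ S(1,2)]) (simp add: expand[symmetric])
    from fun_cong[OF has_derivative_unique[OF d\<tau> this]] show ?thesis .
  qed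
  have "((\<lambda>y. \<Sum>b\<in>Basis. (X y \<bullet> b) *\<^sub>R jac \<tau> y b) has_derivative
      (\<lambda>w. \<Sum>b\<in>Basis. (X x \<bullet> b) *\<^sub>R ?D2 b w + (jac X x w \<bullet> b) *\<^sub>R jac \<tau> x b)) (at x)"
    by (intro has_derivative_sum has_derivative_scaleR d\<tau> bounded_linear.has_derivative[OF bounded_linear_inner_left] dX)
  then have "((\<lambda>y. jac \<tau> y (X y)) has_derivative
      (\<lambda>w. \<Sum>b\<in>Basis. (X x \<bullet> b) *\<^sub>R ?D2 b w + (jac X x w \<bullet> b) *\<^sub>R jac \<tau> x b)) (at x)"
    by (rule has_derivative_transform_within_open[OF _ S(1,2)]) (simp add: expand[symmetric])
  moreover have "(\<lambda>w. \<Sum>b\<in>Basis. (X x \<bullet> b) *\<^sub>R ?D2 b w + (jac X x w \<bullet> b) *\<^sub>R jac \<tau> x b)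
    = (\<lambda>w. ?D2 (X x) w + jac \<tau> x (jac X x w))"
    by (simp add: sum.distrib D2[of "X x"] expand[OF S(2), of "jac X x _"] fun_eq_iff)
  ultimately show ?thesis by (simp only:)
qed

text \<open>
  Differentiating the transformation law of a vector field produces one second derivative of \<open>\<tau>\<close>.  In the
  Lie bracket, the Lie derivative and hence the Courant bracket these terms cancel by symmetry.
\<close>
lemma frechet_derivative_related:
  fixes \<tau> X X' :: "real ^ 'n \<Rightarrow> real ^ 'n"
  assumes S: "open S" "x \<in> S" "smooth_on S \<tau>" "smooth_on S X" and X': "X' differentiable (at (\<tau> x))"
    and rel: "\<And>y. y \<in> S \<Longrightarrow> X' (\<tau> y) = jac \<tau> y (X y)"
  shows "jac X' (\<tau> x) (jac \<tau> x w) =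
    jac (\<lambda>y. jac \<tau> y (X x)) x w +
    jac \<tau> x (jac X x w)"
proof -
  have "((\<lambda>y. X' (\<tau> y)) has_derivative (\<lambda>w. jac X' (\<tau> x) (jac \<tau> x w))) (at x)"
    by (rule has_derivative_compose[OF smooth_on_has_derivative[OF S(3,2)]])
       (use X' in \<open>simp add: frechet_derivative_works\<close>)
  moreover have "((\<lambda>y. X' (\<tau> y)) has_derivative (\<lambda>w. jac (\<lambda>y. jac \<tau> y (X x)) x w +
    jac \<tau> x (jac X x w))) (at x)"
    by (rule has_derivative_transform_within_open[OF has_derivative_frechet_derivative_apply[OF S] S(1,2)]) (simp add: rel)
  ultimately show ?thesis using fun_cong[OF has_derivative_unique] by blast
qed

lemma lie_local_natural:
  fixes \<tau> X X' Y Y' :: "real ^ 'n \<Rightarrow> real ^ 'n"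
  assumes S: "open S" "x \<in> S" "smooth_on S \<tau>"
    and X: "smooth_on S X" "X' differentiable (at (\<tau> x))" "\<And>y. y \<in> S \<Longrightarrow> X' (\<tau> y) = jac \<tau> y (X y)"
    and Y: "smooth_on S Y" "Y' differentiable (at (\<tau> x))" "\<And>y. y \<in> S \<Longrightarrow> Y' (\<tau> y) = jac \<tau> y (Y y)"
  shows "lie_local X' Y' (\<tau> x) = jac \<tau> x (lie_local X Y x)"
proof -
  have l: "linear (jac \<tau> x)"
    using smooth_on_has_derivative[OF S(3,2)] has_derivative_linear by blast
  have DX: "jac X' (\<tau> x) (Y' (\<tau> x)) =
      jac (\<lambda>y. jac \<tau> y (X x)) x (Y x) +
      jac \<tau> x (jac X x (Y x))"
    unfolding Y(3)[OF S(2)] by (rule frechet_derivative_related) (fact S X)+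
  have DY: "jac Y' (\<tau> x) (X' (\<tau> x)) =
      jac (\<lambda>y. jac \<tau> y (Y x)) x (X x) +
      jac \<tau> x (jac Y x (X x))"
    unfolding X(3)[OF S(2)] by (rule frechet_derivative_related) (fact S Y)+
  have "jac (\<lambda>y. jac \<tau> y (X x)) x (Y x)
      = jac (\<lambda>y. jac \<tau> y (Y x)) x (X x)"
    by (rule second_derivative_symmetric[OF S])
  then show ?thesis
    unfolding lie_local_def DX DY linear_diff[OF l] by simp
qed

lemma lie_deriv_local_natural:
  fixes \<tau> X X' \<eta> \<eta>' :: "real ^ 'n \<Rightarrow> real ^ 'n"
  assumes S: "open S" "x \<in> S" "smooth_on S \<tau>"
    and X: "smooth_on S X" "X' differentiable (at (\<tau> x))" "\<And>y. y \<in> S \<Longrightarrow> X' (\<tau> y) = jac \<tau> y (X y)"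
    and \<eta>: "smooth_on S \<eta>" "\<eta>' differentiable (at (\<tau> x))"
      "\<And>y v. y \<in> S \<Longrightarrow> \<eta> y \<bullet> v = \<eta>' (\<tau> y) \<bullet> jac \<tau> y v"
  shows "lie_deriv_local X' \<eta>' (\<tau> x) (jac \<tau> x v) = lie_deriv_local X \<eta> x v"
proof -
  have d: "(\<eta>' has_derivative jac \<eta>' (\<tau> x)) (at (\<tau> x))"
    using \<eta>(2) by (simp add: frechet_derivative_works)
  have "((\<lambda>y. \<eta>' (\<tau> y) \<bullet> jac \<tau> y v) has_derivative
     (\<lambda>w. \<eta>' (\<tau> x) \<bullet> jac (\<lambda>y. jac \<tau> y v) x w +
       jac \<eta>' (\<tau> x) (jac \<tau> x w) \<bullet> jac \<tau> x v)) (at x)"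
    by (intro has_derivative_inner has_derivative_compose[OF smooth_on_has_derivative[OF S(3,2)] d]
       smooth_on_has_derivative[OF smooth_on_frechet_derivative[OF S(3)] S(2)])
  then have "((\<lambda>y. \<eta> y \<bullet> v) has_derivative
     (\<lambda>w. \<eta>' (\<tau> x) \<bullet> jac (\<lambda>y. jac \<tau> y v) x w +
       jac \<eta>' (\<tau> x) (jac \<tau> x w) \<bullet> jac \<tau> x v)) (at x)"
    by (rule has_derivative_transform_within_open[OF _ S(1,2)]) (simp add: \<eta>(3))
  moreover have "((\<lambda>y. \<eta> y \<bullet> v) has_derivative (\<lambda>w. jac \<eta> x w \<bullet> v)) (at x)"
    by (rule bounded_linear.has_derivative[OF bounded_linear_inner_left smooth_on_has_derivative[OF \<eta>(1) S(2)]])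
  ultimately have "jac \<eta> x w \<bullet> v = \<eta>' (\<tau> x) \<bullet> jac (\<lambda>y. jac \<tau> y v) x w +
       jac \<eta>' (\<tau> x) (jac \<tau> x w) \<bullet> jac \<tau> x v" for w
    using fun_cong[OF has_derivative_unique] by blast
  from this[of "X x"]
  have D\<eta>: "jac \<eta> x (X x) \<bullet> v =
      \<eta>' (\<tau> x) \<bullet> jac (\<lambda>y. jac \<tau> y v) x (X x) +
      jac \<eta>' (\<tau> x) (X' (\<tau> x)) \<bullet> jac \<tau> x v"
    by (simp only: X(3)[OF S(2)])
  have DX: "jac X' (\<tau> x) (jac \<tau> x v) =
      jac (\<lambda>y. jac \<tau> y (X x)) x v +
      jac \<tau> x (jac X x v)"
    by (rule frechet_derivative_related) (fact S X)+
  have sym: "jac (\<lambda>y. jac \<tau> y (X x)) x v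
      = jac (\<lambda>y. jac \<tau> y v) x (X x)"
    by (rule second_derivative_symmetric[OF S])
  show ?thesis
    unfolding lie_deriv_local_def D\<eta> DX sym \<eta>(3)[OF S(2), of "jac X x v"] inner_add_right
    by simp
qed

text \<open>
  The last term of the form is the differential of a function and transforms by the chain rule.
\<close>
lemma courant_form_local_natural:
  fixes \<tau> X X' Y Y' \<xi> \<xi>' \<eta> \<eta>' :: "real ^ 'n \<Rightarrow> real ^ 'n"
  assumes S: "open S" "x \<in> S" "smooth_on S \<tau>"
    and X: "smooth_on S X" "X' differentiable (at (\<tau> x))" "\<And>y. y \<in> S \<Longrightarrow> X' (\<tau> y) = jac \<tau> y (X y)"
    and \<xi>: "smooth_on S \<xi>" "\<xi>' differentiable (at (\<tau> x))"
      "\<And>y v. y \<in> S \<Longrightarrow> \<xi> y \<bullet> v = \<xi>' (\<tau> y) \<bullet> jac \<tau> y v"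
    and Y: "smooth_on S Y" "Y' differentiable (at (\<tau> x))" "\<And>y. y \<in> S \<Longrightarrow> Y' (\<tau> y) = jac \<tau> y (Y y)"
    and \<eta>: "smooth_on S \<eta>" "\<eta>' differentiable (at (\<tau> x))"
      "\<And>y v. y \<in> S \<Longrightarrow> \<eta> y \<bullet> v = \<eta>' (\<tau> y) \<bullet> jac \<tau> y v"
  shows "courant_form_local X' \<xi>' Y' \<eta>' (\<tau> x) (jac \<tau> x v) = courant_form_local X \<xi> Y \<eta> x v"
proof -
  let ?f' = "\<lambda>z. \<eta>' z \<bullet> X' z - \<xi>' z \<bullet> Y' z"
  have "?f' differentiable (at (\<tau> x))"
    using X(2) \<xi>(2) Y(2) \<eta>(2) by (intro differentiable_diff differentiable_inner)
  then have "((\<lambda>y. ?f' (\<tau> y)) has_derivative (\<lambda>v. jac ?f' (\<tau> x) (jac \<tau> x v))) (at x)"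
    by (intro has_derivative_compose[OF smooth_on_has_derivative[OF S(3,2)]]) (simp add: frechet_derivative_works)
  then have "((\<lambda>y. \<eta> y \<bullet> X y - \<xi> y \<bullet> Y y) has_derivative (\<lambda>v. jac ?f' (\<tau> x) (jac \<tau> x v))) (at x)"
    by (rule has_derivative_transform_within_open[OF _ S(1,2)]) (simp add: X(3) Y(3) \<xi>(3) \<eta>(3))
  from fun_cong[OF frechet_derivative_at[OF this], of v]
  show ?thesis unfolding courant_form_local_def
    using lie_deriv_local_natural[OF S X \<eta>] lie_deriv_local_natural[OF S Y \<xi>] by simp
qed

lemma linear_lie_deriv_local:
  assumes "X differentiable (at x)" shows "linear (lie_deriv_local X \<eta> x)"
  using linear_frechet_derivative[OF assms]
  by (intro linearI) (auto simp: lie_deriv_local_def linear_add linear_scale inner_add_right algebra_simps)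

lemma linear_courant_form_local:
  assumes "X differentiable (at x)" "Y differentiable (at x)" "\<xi> differentiable (at x)" "\<eta> differentiable (at x)"
  shows "linear (courant_form_local X \<xi> Y \<eta> x)"
proof -
  have "linear (jac (\<lambda>y. \<eta> y \<bullet> X y - \<xi> y \<bullet> Y y) x)"
    by (intro linear_frechet_derivative differentiable_diff differentiable_inner assms)
  moreover note linear_lie_deriv_local[OF assms(1), of \<eta>] linear_lie_deriv_local[OF assms(2), of \<xi>]
  ultimately show ?thesis
    by (intro linearI) (auto simp: courant_form_local_def linear_add linear_scale algebra_simps)
qed

context smooth_mfd begin

abbreviation "vloc c a \<equiv> vf_local c (fst \<circ> a)"
abbreviation "floc c a \<equiv> form_local A c (snd \<circ> a)"

lemma gloc_eq: "gloc c a x = (vloc c a x, floc c a x)"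
  by (simp add: gvector_coords_def vf_local_def form_local_def)

lemma smooth_on_loc:
  assumes "smooth_gsection_on A U a" "openin M U" "c \<in> A"
  shows "smooth_on (snd c ` (fst c \<inter> U)) (vloc c a)" "smooth_on (snd c ` (fst c \<inter> U)) (floc c a)"
proof -
  have o: "open (snd c ` (fst c \<inter> U))" by (rule open_chart_image_Int[OF assms(3,2)])
  have s: "smooth_on (snd c ` (fst c \<inter> U)) (gloc c a)" using assms(1,3) unfolding smooth_gsection_on_def by blast
  show "smooth_on (snd c ` (fst c \<inter> U)) (vloc c a)" "smooth_on (snd c ` (fst c \<inter> U)) (floc c a)"
    using smooth_on_fst[OF o s] smooth_on_snd[OF o s] by (simp_all add: gloc_eq)
qed

lemma dual_space_covector_of_linear:
  assumes "c \<in> charts_at A p" "linear f"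
  shows "(\<lambda>v. if v \<in> T p then f (v c) else 0) \<in> T' p"
  using subspace_tangent_space[OF assms(1)] linear_add[OF assms(2)] linear_scale[OF assms(2)]
  by (auto simp: dual_space_def subspace_add subspace_scale)

lemma courant_bracket_defining_chart:
  assumes U: "openin M U" "p \<in> U" and a: "\<And>q. q \<in> U \<Longrightarrow> a q \<in> TT q" "smooth_gsection_on A U a"
    and b: "\<And>q. q \<in> U \<Longrightarrow> b q \<in> TT q" "smooth_gsection_on A U b"
  defines "c \<equiv> chart_at A p"
  shows "courant_bracket A a b p \<in> TT p"
    and "G c p (courant_bracket A a b p) = (lie_local (vloc c a) (vloc c b) (snd c p),
      \<chi> i. courant_form_local (vloc c a) (floc c a) (vloc c b) (floc c b) (snd c p) (axis i 1))"
proof -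
  have "p \<in> topspace M" using U openin_subset by blast
  then have ch: "c \<in> charts_at A p" unfolding c_def by (rule chart_at_in)
  then have c: "c \<in> A" "p \<in> fst c" by (auto simp: charts_at_def)
  let ?S = "snd c ` (fst c \<inter> U)" and ?x = "snd c p"
  have S: "open ?S" by (rule open_chart_image_Int[OF c(1) U(1)])
  have x: "?x \<in> ?S" using c U by auto
  note sm = smooth_on_loc[OF a(2) U(1) c(1)] smooth_on_loc[OF b(2) U(1) c(1)]
  note diff = sm[THEN smooth_on_differentiable, OF x]
  let ?X = "vloc c a" and ?\<xi> = "floc c a" and ?Y = "vloc c b" and ?\<eta> = "floc c b"
  let ?f = "\<lambda>q. contraction (fst \<circ> a) (snd \<circ> b) q - contraction (fst \<circ> b) (snd \<circ> a) q"
  have contr: "fun_local c ?f y = ?\<eta> y \<bullet> ?X y - ?\<xi> y \<bullet> ?Y y" if y: "y \<in> ?S" for y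
  proof -
    obtain q where q: "q \<in> fst c" "q \<in> U" "y = snd c q" using y by auto
    then have "c \<in> charts_at A q" using c by (simp add: charts_at_def)
    then show ?thesis
      using a(1)[OF q(2)] b(1)[OF q(2)] c q
      by (simp add: fun_local_def contraction_def form_local_def vf_local_def chart_inv_left covector_eq[of _ q c] mem_Times_iff)
  qed
  have fd: "jac (fun_local c ?f) ?x = jac (\<lambda>y. ?\<eta> y \<bullet> ?X y - ?\<xi> y \<bullet> ?Y y) ?x"
    by (rule frechet_derivative_cong_open[OF S x contr])
  have snd_eq: "snd (courant_bracket A a b p) = (\<lambda>v. if v \<in> T p then courant_form_local ?X ?\<xi> ?Y ?\<eta> ?x (v c) else 0)"
    unfolding courant_bracket_def Let_def lie_derivative_def differential_def c_def[symmetric] fd courant_form_local_def lie_deriv_local_def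
    by (auto simp: fun_eq_iff)
  have fst_eq: "fst (courant_bracket A a b p) = tvector_of A c p (lie_local ?X ?Y ?x)"
    unfolding courant_bracket_def Let_def lie_bracket_def c_def[symmetric] lie_local_def by simp
  have "snd (courant_bracket A a b p) \<in> T' p"
    unfolding snd_eq by (intro dual_space_covector_of_linear[OF ch] linear_courant_form_local diff)
  then show "courant_bracket A a b p \<in> TT p"
    using fst_eq tvector_of_in[OF ch] by (simp add: mem_Times_iff)
  show "G c p (courant_bracket A a b p) = (lie_local ?X ?Y ?x, \<chi> i. courant_form_local ?X ?\<xi> ?Y ?\<eta> ?x (axis i 1))"
    by (simp add: gvector_coords_def fst_eq snd_eq covector_coords_def tvector_of_same[OF ch] tvector_of_in[OF ch])
qed

text \<open>
  The bracket at \<open>p\<close> is defined in the chart \<open>chart_at A p\<close>, which depends arbitrarily on \<open>p\<close>.  By naturality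
  the same expression holds in every chart around \<open>p\<close>, which makes smoothness of the bracket visible.
\<close>
lemma courant_bracket_coords:
  assumes U: "openin M U" "p \<in> U" and a: "\<And>q. q \<in> U \<Longrightarrow> a q \<in> TT q" "smooth_gsection_on A U a"
    and b: "\<And>q. q \<in> U \<Longrightarrow> b q \<in> TT q" "smooth_gsection_on A U b" and ch': "d \<in> charts_at A p"
  shows "G d p (courant_bracket A a b p) = (lie_local (vloc d a) (vloc d b) (snd d p),
      \<chi> i. courant_form_local (vloc d a) (floc d a) (vloc d b) (floc d b) (snd d p) (axis i 1))"
proof -
  define c where "c = chart_at A p"
  have "p \<in> topspace M" using U openin_subset by blast
  then have ch: "c \<in> charts_at A p" unfolding c_def by (rule chart_at_in)
  then have c: "c \<in> A" "p \<in> fst c" by (auto simp: charts_at_def)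
  have d: "d \<in> A" "p \<in> fst d" using ch' by (auto simp: charts_at_def)
  let ?S = "snd c ` (fst c \<inter> (fst d \<inter> U))" and ?x = "snd c p" and ?\<tau> = "transition c d"
  have S: "open ?S" by (intro open_chart_image_Int c openin_Int openin_chart d U)
  have x: "?x \<in> ?S" using c d U by auto
  have \<tau>: "smooth_on ?S ?\<tau>" by (rule smooth_on_subset[OF transition_smooth[OF c(1) d(1)]]) auto
  have \<tau>x: "?\<tau> ?x = snd d p" using transition_apply c by simp
  have sm: "smooth_on ?S (vloc c a)" "smooth_on ?S (floc c a)" if "smooth_gsection_on A U a" for a
    using smooth_on_loc[OF that U(1) c(1)] by (auto elim!: smooth_on_subset)
  have diff: "vloc d a differentiable (at (?\<tau> ?x))" "floc d a differentiable (at (?\<tau> ?x))" if "smooth_gsection_on A U a" for a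
    unfolding \<tau>x using smooth_on_loc[OF that U(1) d(1), THEN smooth_on_differentiable] d U by auto
  have rel: "vloc d a (?\<tau> y) = jac ?\<tau> y (vloc c a y)" 
     "floc c a y \<bullet> v = floc d a (?\<tau> y) \<bullet> jac ?\<tau> y v"
    if a: "\<And>q. q \<in> U \<Longrightarrow> a q \<in> TT q" and y: "y \<in> ?S" for a y v
  proof -
    obtain q where q: "q \<in> fst c" "q \<in> fst d" "q \<in> U" "y = snd c q" using y by auto
    have cd: "c \<in> charts_at A q" "d \<in> charts_at A q" using q c d by (auto simp: charts_at_def)
    have aq: "fst (a q) \<in> T q" "snd (a q) \<in> T' q" using a[OF q(3)] by (auto simp: mem_Times_iff)
    show "vloc d a (?\<tau> y) = jac ?\<tau> y (vloc c a y)"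
      using tangent_space_trD[OF aq(1) cd] q c d by (simp add: vf_local_def transition_apply chart_inv_left)
    have "snd (a q) (tvector_of A c q v) = floc c a y \<bullet> v"
      using covector_eq[OF aq(2) cd(1) tvector_of_in[OF cd(1), of v]] q c
      by (simp add: form_local_def chart_inv_left tvector_of_same[OF cd(1)])
    moreover have "snd (a q) (tvector_of A c q v) = floc d a (?\<tau> y) \<bullet> jac ?\<tau> y v"
      using covector_eq[OF aq(2) cd(2) tvector_of_in[OF cd(1), of v]] q c d
      by (simp add: form_local_def transition_apply chart_inv_left tvector_of_apply[OF cd(2)])
    ultimately show "floc c a y \<bullet> v = floc d a (?\<tau> y) \<bullet> jac ?\<tau> y v" by simp
  qed
  note br = courant_bracket_defining_chart[OF U a b, folded c_def]
  let ?F = "courant_form_local (vloc c a) (floc c a) (vloc c b) (floc c b) ?x"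
  have linF: "linear ?F"
    by (intro linear_courant_form_local sm[THEN smooth_on_differentiable, OF _ x] a b)
  have "lie_local (vloc d a) (vloc d b) (snd d p) = trD c d p (lie_local (vloc c a) (vloc c b) ?x)"
    unfolding \<tau>x[symmetric]
    by (rule lie_local_natural[OF S x \<tau> sm(1)[OF a(2)] diff(1)[OF a(2)] rel(1)[OF a(1)] sm(1)[OF b(2)] diff(1)[OF b(2)] rel(1)[OF b(1)]])
  moreover have "courant_form_local (vloc d a) (floc d a) (vloc d b) (floc d b) (snd d p) (axis i 1)
     = (\<chi> i. ?F (axis i 1)) \<bullet> trD d c p (axis i 1)" for i
  proof -
    have "courant_form_local (vloc d a) (floc d a) (vloc d b) (floc d b) (snd d p) (trD c d p (trD d c p (axis i 1)))
       = ?F (trD d c p (axis i 1))"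
      unfolding \<tau>x[symmetric]
      by (rule courant_form_local_natural[OF S x \<tau> sm(1)[OF a(2)] diff(1)[OF a(2)] rel(1)[OF a(1)] sm(2)[OF a(2)] diff(2)[OF a(2)] rel(2)[OF a(1)]
         sm(1)[OF b(2)] diff(1)[OF b(2)] rel(1)[OF b(1)] sm(2)[OF b(2)] diff(2)[OF b(2)] rel(2)[OF b(1)]])
    also have "trD c d p (trD d c p (axis i 1)) = axis i 1"
      by (simp add: trD_trD[OF ch' ch ch'] trD_self[OF ch'])
    also have "?F (trD d c p (axis i 1)) = (\<chi> i. ?F (axis i 1)) \<bullet> trD d c p (axis i 1)"
      using linear_vec_expansion[OF linF, of "trD d c p (axis i 1)"] by (simp add: inner_vec_def mult.commute)
    finally show ?thesis .
  qed
  ultimately show ?thesis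
    using gvector_coords_change[OF br(1) ch ch'] by (simp add: br(2))
qed

end

section \<open>Involutivity in rank two\<close>

lemma three_vectors_dependent:
  fixes a b c :: "'b::euclidean_space"
  assumes "dim W = 2" "a \<in> W" "b \<in> W" "c \<in> W"
  obtains r s t :: real where "r \<noteq> 0 \<or> s \<noteq> 0 \<or> t \<noteq> 0" "r *\<^sub>R a + s *\<^sub>R b + t *\<^sub>R c = 0"
proof (cases "b = 0 \<or> a \<in> span {b} \<or> c \<in> span {a, b}")
  case True
  then consider "b = 0" | k where "a = k *\<^sub>R b" | k l where "c - k *\<^sub>R a = l *\<^sub>R b"
    by (auto simp: span_singleton span_insert)
  then show thesis
  proof cases
    case 1
    then show thesis using that[of 0 1 0] by simp
  next
    case 2
    then show thesis using that[of 1 "-k" 0] by simp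
  next
    case 3
    then show thesis using that[of k l "-1"] by (simp add: algebra_simps)
  qed
next
  case False
  then have "independent {c, a, b}" "card {c, a, b} = 3"
    by (auto simp: independent_insert span_base card_insert_if)
  then show thesis using independent_card_le_dim[of "{c, a, b}" W] assms by simp
qed

lemma lie_local_alt: "lie_local X Y = (\<lambda>x. jac Y x (X x) - jac X x (Y x))"
  by (simp add: lie_local_def fun_eq_iff)

lemma smooth_on_lie_local:
  assumes "open S" "smooth_on S X" "smooth_on S Y"
  shows "smooth_on S (lie_local X Y)"
  unfolding lie_local_alt by (intro smooth_on_diff smooth_on_frechet_derivative_apply assms)

lemma smooth_on_courant_form_local:
  assumes "open S" "smooth_on S X" "smooth_on S \<xi>" "smooth_on S Y" "smooth_on S \<eta>"
  shows "smooth_on S (\<lambda>x. courant_form_local X \<xi> Y \<eta> x v)"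
  unfolding courant_form_local_def lie_deriv_local_def
  by (intro smooth_on_diff smooth_on_add smooth_on_mult smooth_on_inner smooth_on_const smooth_on_frechet_derivative
      smooth_on_frechet_derivative_apply assms)

text \<open>
  With \<open>P\<close>, \<open>Q\<close>, \<open>W\<close> for \<open>\<langle>D\<^sub>u a, b\<rangle>\<close>, \<open>\<langle>D\<^sub>u b, c\<rangle>\<close>, \<open>\<langle>D\<^sub>u c, a\<rangle>\<close> as functions of \<open>u\<close>, the pairing
  \<open>\<langle>[a, b], c\<rangle>\<close> is \<open>Q X + W Y + P Z\<close>.  A relation \<open>r a + s b + t c = 0\<close> at the point makes \<open>(P, Q, W)\<close>
  proportional to \<open>(t, r, s)\<close>, so that \<open>t\<close>, \<open>r\<close> and \<open>s\<close> times this sum are \<open>P\<close>, \<open>Q\<close> and \<open>W\<close> applied to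
  \<open>r X + s Y + t Z = 0\<close>.
\<close>
lemma courant_bracket_pairing_zero:
  fixes X \<xi> Y \<eta> Z \<zeta> :: "real ^ 'n \<Rightarrow> real ^ 'n"
  assumes S: "open S" "x \<in> S"
    and sm: "smooth_on S X" "smooth_on S \<xi>" "smooth_on S Y" "smooth_on S \<eta>" "smooth_on S Z" "smooth_on S \<zeta>"
    and iso: "\<And>y. y \<in> S \<Longrightarrow> \<xi> y \<bullet> X y = 0" "\<And>y. y \<in> S \<Longrightarrow> \<eta> y \<bullet> Y y = 0" "\<And>y. y \<in> S \<Longrightarrow> \<zeta> y \<bullet> Z y = 0"
      "\<And>y. y \<in> S \<Longrightarrow> \<xi> y \<bullet> Y y + \<eta> y \<bullet> X y = 0" "\<And>y. y \<in> S \<Longrightarrow> \<eta> y \<bullet> Z y + \<zeta> y \<bullet> Y y = 0"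
      "\<And>y. y \<in> S \<Longrightarrow> \<zeta> y \<bullet> X y + \<xi> y \<bullet> Z y = 0"
    and dep: "r \<noteq> 0 \<or> s \<noteq> 0 \<or> t \<noteq> 0" "r *\<^sub>R X x + s *\<^sub>R Y x + t *\<^sub>R Z x = 0" "r *\<^sub>R \<xi> x + s *\<^sub>R \<eta> x + t *\<^sub>R \<zeta> x = 0"
  shows "\<zeta> x \<bullet> lie_local X Y x + courant_form_local X \<xi> Y \<eta> x (Z x) = 0"
proof -
  let ?D = "\<lambda>f. jac f x"
  have d: "(f has_derivative ?D f) (at x)" if "smooth_on S f" for f :: "real ^ 'n \<Rightarrow> real ^ 'n"
    by (rule smooth_on_has_derivative[OF that S(2)])
  have d_in: "((\<lambda>y. f y \<bullet> g y) has_derivative (\<lambda>u. f x \<bullet> ?D g u + ?D f u \<bullet> g x)) (at x)"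
    if "smooth_on S f" "smooth_on S g" for f g :: "real ^ 'n \<Rightarrow> real ^ 'n"
    by (intro has_derivative_inner d that)
  have zero: "h u = 0" if "(f has_derivative h) (at x)" "\<And>y. y \<in> S \<Longrightarrow> f y = 0" for f :: "real ^ 'n \<Rightarrow> real" and h u
  proof -
    have "(f has_derivative (\<lambda>_. 0)) (at x)"
      by (rule has_derivative_transform_within_open[OF has_derivative_const S]) (simp add: that(2))
    from fun_cong[OF has_derivative_unique[OF that(1) this]] show ?thesis .
  qed
  have lin: "linear (?D f)" if "smooth_on S f" for f :: "real ^ 'n \<Rightarrow> real ^ 'n"
    using d[OF that] has_derivative_linear by blast
  define P where "P = (\<lambda>u. \<eta> x \<bullet> ?D X u + ?D \<xi> u \<bullet> Y x)"
  define Q where "Q = (\<lambda>u. \<zeta> x \<bullet> ?D Y u + ?D \<eta> u \<bullet> Z x)"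
  define W where "W = (\<lambda>u. \<xi> x \<bullet> ?D Z u + ?D \<zeta> u \<bullet> X x)"
  have aa: "\<xi> x \<bullet> ?D X u + ?D \<xi> u \<bullet> X x = 0" for u using zero[OF d_in[OF sm(2,1)] iso(1)] .
  have bb: "\<eta> x \<bullet> ?D Y u + ?D \<eta> u \<bullet> Y x = 0" for u using zero[OF d_in[OF sm(4,3)] iso(2)] .
  have cc: "\<zeta> x \<bullet> ?D Z u + ?D \<zeta> u \<bullet> Z x = 0" for u using zero[OF d_in[OF sm(6,5)] iso(3)] .
  have ba: "\<xi> x \<bullet> ?D Y u + ?D \<eta> u \<bullet> X x = - P u" for u
    using zero[OF has_derivative_add[OF d_in[OF sm(2,3)] d_in[OF sm(4,1)]] iso(4), of u] by (simp add: P_def)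
  have cb: "\<eta> x \<bullet> ?D Z u + ?D \<zeta> u \<bullet> Y x = - Q u" for u
    using zero[OF has_derivative_add[OF d_in[OF sm(4,5)] d_in[OF sm(6,3)]] iso(5), of u] by (simp add: Q_def)
  have ac: "\<zeta> x \<bullet> ?D X u + ?D \<xi> u \<bullet> Z x = - W u" for u
    using zero[OF has_derivative_add[OF d_in[OF sm(6,1)] d_in[OF sm(2,5)]] iso(6), of u] by (simp add: W_def)
  have contr: "?D (\<lambda>y. \<eta> y \<bullet> X y - \<xi> y \<bullet> Y y) v = (\<eta> x \<bullet> ?D X v + ?D \<eta> v \<bullet> X x) - (\<xi> x \<bullet> ?D Y v + ?D \<xi> v \<bullet> Y x)" for v
    using fun_cong[OF frechet_derivative_at[OF has_derivative_diff[OF d_in[OF sm(4,1)] d_in[OF sm(2,3)]]], of v] by simp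
  have "\<zeta> x \<bullet> lie_local X Y x + courant_form_local X \<xi> Y \<eta> x (Z x) = Q (X x) + W (Y x) + P (Z x)"
    using ba[of "Z x"] ac[of "Y x"]
    unfolding lie_local_def courant_form_local_def lie_deriv_local_def contr P_def Q_def
    by (simp add: inner_diff_right algebra_simps) 
  moreover
  have lP: "linear P" and lQ: "linear Q" and lW: "linear W"
    using lin[OF sm(1)] lin[OF sm(2)] lin[OF sm(3)] lin[OF sm(4)] lin[OF sm(5)] lin[OF sm(6)]
    by (auto intro!: linearI simp: P_def Q_def W_def linear_add linear_scale inner_add_left inner_add_right algebra_simps)
  have dep0: "f (r *\<^sub>R X x + s *\<^sub>R Y x + t *\<^sub>R Z x) = r * f (X x) + s * f (Y x) + t * f (Z x)"
    if "linear f" for f :: "real ^ 'n \<Rightarrow> real"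
    by (simp add: linear_add[OF that] linear_scale[OF that])
  have zP: "r * P (X x) + s * P (Y x) + t * P (Z x) = 0" and zQ: "r * Q (X x) + s * Q (Y x) + t * Q (Z x) = 0"
    and zW: "r * W (X x) + s * W (Y x) + t * W (Z x) = 0"
    using dep0[OF lP] dep0[OF lQ] dep0[OF lW] dep(2) linear_0[OF lP] linear_0[OF lQ] linear_0[OF lW] by simp_all
  \<comment> \<open>The vanishing combination pairs to zero with \<open>D\<^sub>u a\<close>, \<open>D\<^sub>u b\<close> and \<open>D\<^sub>u c\<close>.\<close>
  have comb: "r * (\<xi> x \<bullet> v + w \<bullet> X x) + s * (\<eta> x \<bullet> v + w \<bullet> Y x) + t * (\<zeta> x \<bullet> v + w \<bullet> Z x) = 0" for v w
  proof -
    have "(r *\<^sub>R \<xi> x + s *\<^sub>R \<eta> x + t *\<^sub>R \<zeta> x) \<bullet> v + w \<bullet> (r *\<^sub>R X x + s *\<^sub>R Y x + t *\<^sub>R Z x) = 0"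
      unfolding dep(2,3) by simp
    then show ?thesis by (simp add: inner_add_left inner_add_right algebra_simps)
  qed
  have k1: "s * P u = t * W u" for u
    using comb[of "?D X u" "?D \<xi> u"] aa[of u] ac[of u] by (simp add: P_def)
  have k2: "r * P u = t * Q u" for u
    using comb[of "?D Y u" "?D \<eta> u"] bb[of u] ba[of u] by (simp add: Q_def)
  have k3: "r * W u = s * Q u" for u
    using comb[of "?D Z u" "?D \<zeta> u"] cc[of u] cb[of u] by (simp add: W_def)
  have "t * (Q (X x) + W (Y x) + P (Z x)) = 0" using zP k1[of "Y x"] k2[of "X x"] by (simp add: algebra_simps)
  moreover have "r * (Q (X x) + W (Y x) + P (Z x)) = 0" using zQ k3[of "Y x"] k2[of "Z x"] by (simp add: algebra_simps)
  moreover have "s * (Q (X x) + W (Y x) + P (Z x)) = 0" using zW k3[of "X x"] k1[of "Z x"] by (simp add: algebra_simps)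
  ultimately show ?thesis using dep(1) by auto
qed

context smooth_mfd begin

lemma charts_at_mem: "c \<in> A \<Longrightarrow> q \<in> fst c \<Longrightarrow> c \<in> charts_at A q"
  by (simp add: charts_at_def)

lemma courant_bracket_pairing_local_sections:
  assumes n: "CARD('n) = 2" and U: "openin M U" "p \<in> U"
    and E: "\<And>q. q \<in> U \<Longrightarrow> E q \<in> Lag (T q)"
    and a: "\<And>q. q \<in> U \<Longrightarrow> a q \<in> E q" "smooth_gsection_on A U a"
    and b: "\<And>q. q \<in> U \<Longrightarrow> b q \<in> E q" "smooth_gsection_on A U b"
    and e: "\<And>q. q \<in> U \<Longrightarrow> e q \<in> E q" "smooth_gsection_on A U e"
    and d: "d \<in> charts_at A p"
  shows "ip (G d p (e p)) (G d p (courant_bracket A a b p)) = 0"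
proof -
  let ?S = "snd d ` (fst d \<inter> U)" and ?x = "snd d p"
  have dA: "d \<in> A" "p \<in> fst d" using d by (auto simp: charts_at_def)
  have S: "open ?S" by (rule open_chart_image_Int[OF dA(1) U(1)])
  have x: "?x \<in> ?S" using dA U by auto
  have TT: "f q \<in> TT q" if "\<And>q. q \<in> U \<Longrightarrow> f q \<in> E q" "q \<in> U" for f q
    using Lag_subset[OF E] that by blast
  note sm = smooth_on_loc[OF a(2) U(1) dA(1)] smooth_on_loc[OF b(2) U(1) dA(1)] smooth_on_loc[OF e(2) U(1) dA(1)]
  have iso: "floc d f y \<bullet> vloc d g y + floc d g y \<bullet> vloc d f y = 0"
    if "\<And>q. q \<in> U \<Longrightarrow> f q \<in> E q" "\<And>q. q \<in> U \<Longrightarrow> g q \<in> E q" and y: "y \<in> ?S" for f g y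
  proof -
    obtain q where q: "q \<in> fst d" "q \<in> U" "y = snd d q" using y by auto
    have dq: "d \<in> charts_at A q" using q dA by (simp add: charts_at_mem)
    have "LagR (G d q ` E q)" using Lag_coords_iff[OF Lag_subset[OF E[OF q(2)]] dq] E[OF q(2)] by simp
    then have "ip (G d q (f q)) (G d q (g q)) = 0" using that q by (simp add: LagR_def)
    then have "ip (gloc d f y) (gloc d g y) = 0" using q dA by (simp add: chart_inv_left)
    then show ?thesis unfolding gloc_eq ip_def by (simp add: add.commute)
  qed
  have iso1: "floc d f y \<bullet> vloc d f y = 0" if "\<And>q. q \<in> U \<Longrightarrow> f q \<in> E q" "y \<in> ?S" for f y
    using iso[OF that(1) that(1) that(2)] by simp
  let ?W = "G d p ` E p"
  have "LagR ?W" using Lag_coords_iff[OF Lag_subset[OF E[OF U(2)]] d] E[OF U(2)] by simp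
  then have "dim ?W = 2" using n by (simp add: LagR_def)
  then obtain r s t :: real where rst: "r \<noteq> 0 \<or> s \<noteq> 0 \<or> t \<noteq> 0"
      "r *\<^sub>R G d p (a p) + s *\<^sub>R G d p (b p) + t *\<^sub>R G d p (e p) = 0"
    by (rule three_vectors_dependent[of ?W "G d p (a p)" "G d p (b p)" "G d p (e p)"])
       (use a(1)[OF U(2)] b(1)[OF U(2)] e(1)[OF U(2)] in auto)
  have g: "G d p (f p) = (vloc d f ?x, floc d f ?x)" for f
    using gloc_eq[of d ?x f] dA by (simp add: chart_inv_left)
  have dep: "r *\<^sub>R vloc d a ?x + s *\<^sub>R vloc d b ?x + t *\<^sub>R vloc d e ?x = 0"
    "r *\<^sub>R floc d a ?x + s *\<^sub>R floc d b ?x + t *\<^sub>R floc d e ?x = 0"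
    using rst(2) unfolding g by (simp_all add: zero_prod_def)
  have "floc d e ?x \<bullet> lie_local (vloc d a) (vloc d b) ?x +
     courant_form_local (vloc d a) (floc d a) (vloc d b) (floc d b) ?x (vloc d e ?x) = 0"
    by (rule courant_bracket_pairing_zero[OF S x sm iso1[OF a(1)] iso1[OF b(1)] iso1[OF e(1)]
          iso[OF a(1) b(1)] iso[OF b(1) e(1)] iso[OF e(1) a(1)] rst(1) dep])
  moreover have "courant_form_local (vloc d a) (floc d a) (vloc d b) (floc d b) ?x (vloc d e ?x) =
     (\<chi> i. courant_form_local (vloc d a) (floc d a) (vloc d b) (floc d b) ?x (axis i 1)) \<bullet> vloc d e ?x"
    using linear_vec_expansion[OF linear_courant_form_local[OF sm(1)[THEN smooth_on_differentiable, OF x]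
        sm(3)[THEN smooth_on_differentiable, OF x] sm(2)[THEN smooth_on_differentiable, OF x] sm(4)[THEN smooth_on_differentiable, OF x]],
       of "vloc d e ?x"]
    by (simp add: inner_vec_def mult.commute)
  moreover have "G d p (courant_bracket A a b p) = (lie_local (vloc d a) (vloc d b) ?x,
      \<chi> i. courant_form_local (vloc d a) (floc d a) (vloc d b) (floc d b) ?x (axis i 1))"
    by (rule courant_bracket_coords[OF U TT[OF a(1)] a(2) TT[OF b(1)] b(2) d])
  ultimately show ?thesis by (simp add: g[of e] ip_def)
qed

lemma almost_diracD:
  assumes "almost_dirac M A E"
  shows "p \<in> topspace M \<Longrightarrow> E p \<in> Lag (T p)"
    and "p \<in> topspace M \<Longrightarrow> \<exists>U s. openin M U \<and> p \<in> U \<and> (\<forall>i::'n. smooth_gsection_on A U (s i)) \<and>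
        (\<forall>q\<in>U. E q = span (range (\<lambda>i. s i q)))"
    and "p \<notin> topspace M \<Longrightarrow> E p = undefined"
  using assms by (auto simp: almost_dirac_def PiE_def extensional_def)

lemma smooth_courant_bracket:
  assumes a: "\<And>q. q \<in> topspace M \<Longrightarrow> a q \<in> TT q" "smooth_gsection_on A (topspace M) a"
    and b: "\<And>q. q \<in> topspace M \<Longrightarrow> b q \<in> TT q" "smooth_gsection_on A (topspace M) b"
  shows "smooth_gsection_on A (topspace M) (courant_bracket A a b)"
proof (rule smooth_gsection_on_local)
  fix p assume p: "p \<in> topspace M"
  obtain c where "c \<in> charts_at A p" using charts_at_nonempty[OF p] by blast
  then have c: "c \<in> A" "p \<in> fst c" using charts_atD by blast+
  let ?S = "snd c ` fst c"
  have S: "open ?S" by (rule open_chart_image[OF c(1)])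
  have eq: "fst c \<inter> topspace M = fst c" using chart_subset[OF c(1)] by blast
  note sm = smooth_on_loc[OF a(2) openin_topspace c(1), unfolded eq] smooth_on_loc[OF b(2) openin_topspace c(1), unfolded eq]
  have "smooth_on ?S (\<lambda>x. (lie_local (vloc c a) (vloc c b) x,
      \<chi> i. courant_form_local (vloc c a) (floc c a) (vloc c b) (floc c b) x (axis i 1)))"
    by (intro smooth_on_Pair S smooth_on_lie_local sm smooth_on_vec[OF S]) 
       (simp, intro smooth_on_courant_form_local S sm)
  then have "smooth_on ?S (gloc c (courant_bracket A a b))"
  proof (rule smooth_on_cong[OF S, rotated])
    fix x assume "x \<in> ?S"
    then obtain q where q: "q \<in> fst c" "x = snd c q" by auto
    have qM: "q \<in> topspace M" using q chart_subset[OF c(1)] by blast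
    show "(lie_local (vloc c a) (vloc c b) x, \<chi> i. courant_form_local (vloc c a) (floc c a) (vloc c b) (floc c b) x (axis i 1))
       = gloc c (courant_bracket A a b) x"
      using courant_bracket_coords[OF openin_topspace qM a b charts_at_mem[OF c(1) q(1)]] q c
      by (simp add: chart_inv_left)
  qed
  then have "smooth_gsection_on A (fst c) (courant_bracket A a b)"
    by (rule smooth_gsection_onI[OF c(1) openin_chart[OF c(1)] order_refl, rotated])
       (use courant_bracket_defining_chart(1)[OF openin_topspace _ a b] chart_subset[OF c(1)] in blast)
  then show "\<exists>U'. openin M U' \<and> p \<in> U' \<and> smooth_gsection_on A U' (courant_bracket A a b)"
    using c openin_chart by blast
qed

text \<open>
  Since \<open>E p\<close> is maximally isotropic, it is enough to pair the bracket with the members of a local frame.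
\<close>
theorem almost_dirac_involutive:
  assumes n: "CARD('n) = 2" and E: "almost_dirac M A E"
  shows "involutive M A E"
  unfolding involutive_def
proof (intro ballI)
  fix a b assume a: "a \<in> sections M A E" and b: "b \<in> sections M A E"
  have aE: "\<And>q. q \<in> topspace M \<Longrightarrow> a q \<in> E q" "smooth_gsection_on A (topspace M) a"
    and bE: "\<And>q. q \<in> topspace M \<Longrightarrow> b q \<in> E q" "smooth_gsection_on A (topspace M) b"
    using a b by (auto simp: sections_def)
  note Lag = almost_diracD(1)[OF E]
  have TT: "f q \<in> TT q" if "\<And>q. q \<in> topspace M \<Longrightarrow> f q \<in> E q" "q \<in> topspace M" for f q
    using Lag_subset[OF Lag] that by blast
  have "courant_bracket A a b p \<in> E p" if p: "p \<in> topspace M" for p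
  proof -
    obtain d where d: "d \<in> charts_at A p" using charts_at_nonempty[OF p] by blast
    obtain U s where U: "openin M U" "p \<in> U" and s: "\<And>i::'n. smooth_gsection_on A U (s i)"
        "\<And>q. q \<in> U \<Longrightarrow> E q = span (range (\<lambda>i. s i q))"
      using almost_diracD(2)[OF E p] by blast
    have UM: "U \<subseteq> topspace M" using U openin_subset by blast
    let ?C = "courant_bracket A a b p"
    have "ip (G d p (s i p)) (G d p ?C) = 0" for i
    proof (rule courant_bracket_pairing_local_sections[OF n U _ _ _ _ _ _ s(1) d])
      show "q \<in> U \<Longrightarrow> E q \<in> Lag (T q)" "q \<in> U \<Longrightarrow> a q \<in> E q" "q \<in> U \<Longrightarrow> b q \<in> E q" for q
        using UM Lag aE bE by blast+
      show "smooth_gsection_on A U a" "smooth_gsection_on A U b"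
        using aE(2) bE(2) UM smooth_gsection_on_subset by blast+
      show "q \<in> U \<Longrightarrow> s i q \<in> E q" for q using s(2) by (simp add: span_base)
    qed
    moreover have "subspace {e. ip (G d p e) (G d p ?C) = 0}"
    proof -
      have "linear (\<lambda>e. ip (G d p e) (G d p ?C))"
        by (intro linearI) (simp_all add: ip_def linear_add[OF linear_gvector_coords] linear_scale[OF linear_gvector_coords]
            inner_add_left inner_add_right algebra_simps)
      from linear_subspace_kernel[OF this] show ?thesis .
    qed
    ultimately have "span (range (\<lambda>i. s i p)) \<subseteq> {e. ip (G d p e) (G d p ?C) = 0}"
      by (intro span_minimal) auto
    then have z: "ip (G d p e) (G d p ?C) = 0" if "e \<in> E p" for e using that s(2)[OF U(2)] by blast
    have Ep: "E p \<subseteq> TT p" "LagR (G d p ` E p)"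
      using Lag_subset[OF Lag[OF p]] Lag_coords_iff[OF _ d] Lag[OF p] by auto
    have CW: "G d p ?C \<in> G d p ` E p" by (rule LagR_maximal[OF Ep(2)]) (use z in auto)
    have CT: "?C \<in> TT p"
      by (rule courant_bracket_defining_chart(1)[OF openin_topspace p]) (use TT[OF aE(1)] TT[OF bE(1)] aE(2) bE(2) in auto)
    show ?thesis
      using CW by (simp only: inj_on_image_mem_iff[OF inj_on_gvector_coords[OF d] CT Ep(1)])
  qed
  moreover have "smooth_gsection_on A (topspace M) (courant_bracket A a b)"
    by (rule smooth_courant_bracket) (use TT[OF aE(1)] TT[OF bE(1)] aE(2) bE(2) in auto)
  ultimately show "courant_bracket A a b \<in> sections M A E" by (simp add: sections_def)
qed

end

section \<open>Smooth plane fields and projectors\<close>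

text \<open>
  The Gram--Schmidt step without division, so that it is polynomial in \<open>a\<close> and \<open>b\<close>, and nonzero exactly
  when \<open>a\<close> and \<open>b\<close> are independent.
\<close>
definition orth_part :: "'b::real_inner \<Rightarrow> 'b \<Rightarrow> 'b" where
  "orth_part a b = (a \<bullet> a) *\<^sub>R b - (b \<bullet> a) *\<^sub>R a"

lemma closest_point_subspace:
  fixes W :: "'b::euclidean_space set"
  assumes "subspace W" "z \<in> W" "\<And>y. y \<in> W \<Longrightarrow> (w - z) \<bullet> y = 0"
  shows "closest_point W w = z"
proof (rule closest_point_unique[symmetric])
  show "\<forall>y\<in>W. dist w z \<le> dist w y"
  proof
    fix y assume "y \<in> W"
    then have "orthogonal (w - z) (z - y)"
      using assms by (simp add: orthogonal_def subspace_diff)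
    then have "(norm ((w - z) + (z - y)))\<^sup>2 = (norm (w - z))\<^sup>2 + (norm (z - y))\<^sup>2" by (rule norm_add_Pythagorean)
    then have "(norm (w - z))\<^sup>2 \<le> (norm (w - y))\<^sup>2" by simp
    then show "dist w z \<le> dist w y" by (simp add: dist_norm)
  qed
qed (use assms in \<open>auto simp: subspace_imp_convex closed_subspace\<close>)

lemma orth_part_nonzero_iff:
  fixes a b :: "'b::euclidean_space"
  shows "orth_part a b \<noteq> 0 \<longleftrightarrow> a \<noteq> 0 \<and> b \<notin> span {a}"
proof
  assume o: "orth_part a b \<noteq> 0"
  then have "a \<noteq> 0" by (auto simp: orth_part_def)
  moreover have "b \<notin> span {a}" using o by (auto simp: span_singleton orth_part_def)
  ultimately show "a \<noteq> 0 \<and> b \<notin> span {a}" by blast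
next
  assume a: "a \<noteq> 0 \<and> b \<notin> span {a}"
  show "orth_part a b \<noteq> 0"
  proof
    assume "orth_part a b = 0"
    then have "(1 / (a \<bullet> a)) *\<^sub>R (a \<bullet> a) *\<^sub>R b = (1 / (a \<bullet> a)) *\<^sub>R (b \<bullet> a) *\<^sub>R a" by (simp add: orth_part_def)
    then have "b = ((b \<bullet> a) / (a \<bullet> a)) *\<^sub>R a" using a by simp
    then show False using a by (metis span_base span_scale singletonI)
  qed
qed

lemma plane_eq_span:
  fixes W :: "'b::euclidean_space set"
  assumes "subspace W" "dim W = 2" "a \<in> W" "b \<in> W" "orth_part a b \<noteq> 0"
  shows "W = span {a, b}"
proof -
  have ab: "a \<noteq> 0" "b \<notin> span {a}" using assms(5) by (auto simp: orth_part_nonzero_iff)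
  then have "independent {b, a}" by (simp add: independent_insert)
  moreover have "a \<noteq> b" using ab by (auto simp: span_base)
  ultimately have "dim {a, b} = 2" by (simp add: dim_eq_card_independent insert_commute)
  have "span {a, b} = W"
  proof (rule subspace_dim_equal[OF subspace_span assms(1)])
    show "span {a, b} \<subseteq> W" using assms by (intro span_minimal) auto
    show "dim W \<le> dim (span {a, b})" using \<open>dim {a, b} = 2\<close> assms(2) by simp
  qed
  then show ?thesis by simp
qed

lemma closest_point_plane:
  fixes W :: "'b::euclidean_space set"
  assumes W: "subspace W" "dim W = 2" "a \<in> W" "b \<in> W" "orth_part a b \<noteq> 0"
  shows "closest_point W w = ((w \<bullet> a) / (a \<bullet> a)) *\<^sub>R a
    + ((w \<bullet> orth_part a b) / (orth_part a b \<bullet> orth_part a b)) *\<^sub>R orth_part a b" (is "_ = ?z")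
proof (rule closest_point_subspace[OF W(1)])
  let ?g = "orth_part a b"
  have a: "a \<noteq> 0" using W(5) by (auto simp: orth_part_def)
  have g: "?g \<in> W" unfolding orth_part_def by (intro subspace_diff subspace_scale W)
  have ag: "a \<bullet> ?g = 0" by (simp add: orth_part_def inner_diff_right inner_commute)
  show "?z \<in> W" by (intro subspace_add subspace_scale W g)
  have ga: "?g \<bullet> a = 0" using ag by (simp add: inner_commute)
  have za: "(w - ?z) \<bullet> a = 0" using a ga by (simp add: inner_diff_left inner_add_left)
  have zg: "(w - ?z) \<bullet> ?g = 0" using W(5) ag by (simp add: inner_diff_left inner_add_left)
  have zb: "(w - ?z) \<bullet> b = 0"
  proof -
    have "(a \<bullet> a) * ((w - ?z) \<bullet> b) = (w - ?z) \<bullet> (?g + (b \<bullet> a) *\<^sub>R a)" by (simp add: orth_part_def)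
    also have "\<dots> = 0" using za zg by (simp add: inner_add_right)
    finally show ?thesis using a by simp
  qed
  fix y assume "y \<in> W"
  then have "y \<in> span {a, b}" using plane_eq_span[OF W] by simp
  moreover have "subspace {y. (w - ?z) \<bullet> y = 0}" by (auto simp: subspace_def inner_add_right)
  ultimately show "(w - ?z) \<bullet> y = 0"
    using span_minimal[of "{a, b}" "{y. (w - ?z) \<bullet> y = 0}"] za zb by blast
qed

lemma plane_basis:
  fixes W :: "'b::euclidean_space set"
  assumes "dim W = 2"
  obtains a b where "a \<in> W" "b \<in> W" "orth_part a b \<noteq> 0"
proof -
  obtain B where B: "B \<subseteq> W" "independent B" "card B = 2" using basis_exists[of W] assms by metis
  then obtain a b where ab: "B = {a, b}" "a \<noteq> b" by (auto simp: card_2_iff)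
  then have "a \<noteq> 0" "b \<notin> span {a}"
    using B(2) by (auto simp: independent_insert insert_commute[of a b] split: if_splits dest: dependent_zero)
  then show thesis using that[of a b] B ab by (simp add: orth_part_nonzero_iff)
qed

lemma smooth_on_orth_part:
  fixes f :: "'a::euclidean_space \<Rightarrow> 'b::euclidean_space"
  assumes "open S" "smooth_on S f" "smooth_on S g"
  shows "smooth_on S (\<lambda>x. orth_part (f x) (g x))"
  unfolding orth_part_def by (intro smooth_on_diff smooth_on_scaleR smooth_on_inner assms)

lemma smooth_subspace_map_on_span:
  fixes f g :: "'a::euclidean_space \<Rightarrow> 'b::euclidean_space"
  assumes S: "open S" "smooth_on S f" "smooth_on S g"
    and W: "\<And>x. x \<in> S \<Longrightarrow> subspace (W x)" "\<And>x. x \<in> S \<Longrightarrow> dim (W x) = 2"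
      "\<And>x. x \<in> S \<Longrightarrow> f x \<in> W x" "\<And>x. x \<in> S \<Longrightarrow> g x \<in> W x" "\<And>x. x \<in> S \<Longrightarrow> orth_part (f x) (g x) \<noteq> 0"
  shows "smooth_subspace_map_on S W"
  unfolding smooth_subspace_map_on_def
proof
  fix w
  let ?o = "\<lambda>x. orth_part (f x) (g x)"
  have nz: "f x \<noteq> 0" if "x \<in> S" for x using W(5)[OF that] by (auto simp: orth_part_def)
  have "smooth_on S (\<lambda>x. ((w \<bullet> f x) / (f x \<bullet> f x)) *\<^sub>R f x + ((w \<bullet> ?o x) / (?o x \<bullet> ?o x)) *\<^sub>R ?o x)"
    by (intro smooth_on_add smooth_on_scaleR smooth_on_divide smooth_on_inner smooth_on_const smooth_on_orth_part S)
       (use nz W(5) in auto)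
  then show "smooth_on S (\<lambda>x. closest_point (W x) w)"
    by (rule smooth_on_cong[OF S(1), rotated]) (simp add: closest_point_plane[OF W])
qed

lemma smooth_subspace_map_on_local:
  assumes "\<And>x. x \<in> S \<Longrightarrow> \<exists>U. open U \<and> x \<in> U \<and> smooth_subspace_map_on U W"
  shows "smooth_subspace_map_on S W"
  unfolding smooth_subspace_map_on_def
proof (intro allI smooth_on_local)
  fix w x assume "x \<in> S"
  then show "\<exists>U. open U \<and> x \<in> U \<and> smooth_on U (\<lambda>x. closest_point (W x) w)"
    using assms unfolding smooth_subspace_map_on_def by meson
qed

lemma card_2_UNIV:
  assumes "CARD('n) = 2"
  obtains i j :: "'n::finite" where "i \<noteq> j" "UNIV = {i, j}"
  using assms by (auto simp: card_2_iff)

context smooth_mfd begin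

abbreviation "Eloc c E \<equiv> (\<lambda>x. G c (chart_inv c x) ` E (chart_inv c x))"

lemma gcoords_span: "G c q ` span B = span (G c q ` B)"
  by (rule linear_span_image[OF linear_gvector_coords, symmetric])

lemma almost_dirac_imp_smooth_subspace_map:
  assumes n: "CARD('n) = 2" and E: "almost_dirac M A E" and c: "c \<in> A"
  shows "smooth_subspace_map_on (snd c ` fst c) (Eloc c E)"
proof (rule smooth_subspace_map_on_local)
  fix x assume "x \<in> snd c ` fst c"
  then obtain p where p: "p \<in> fst c" "x = snd c p" by auto
  have pM: "p \<in> topspace M" using p chart_subset[OF c] by blast
  obtain i j :: 'n where ij: "i \<noteq> j" "UNIV = {i, j}" by (rule card_2_UNIV[OF n])
  obtain U s where U: "openin M U" "p \<in> U" and s: "\<And>i::'n. smooth_gsection_on A U (s i)"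
      "\<And>q. q \<in> U \<Longrightarrow> E q = span (range (\<lambda>i. s i q))"
    using almost_diracD(2)[OF E pM] by blast
  have UM: "U \<subseteq> topspace M" using U openin_subset by blast
  let ?S = "snd c ` (fst c \<inter> U)"
  have S: "open ?S" by (rule open_chart_image_Int[OF c U(1)])
  have sm: "smooth_on ?S (gloc c (s k))" for k using s(1)[of k] c unfolding smooth_gsection_on_def by blast
  have props: "subspace (Eloc c E y) \<and> dim (Eloc c E y) = 2 \<and> gloc c (s i) y \<in> Eloc c E y \<and> gloc c (s j) y \<in> Eloc c E y
      \<and> orth_part (gloc c (s i) y) (gloc c (s j) y) \<noteq> 0" if y: "y \<in> ?S" for y
  proof -
    obtain q where q: "q \<in> fst c" "q \<in> U" "y = snd c q" using y by auto
    have ci: "chart_inv c y = q" using q c chart_inv_left by simp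
    have cq: "c \<in> charts_at A q" using c q by (simp add: charts_at_mem)
    have EL: "E q \<in> Lag (T q)" using almost_diracD(1)[OF E] q UM by blast
    then have L: "LagR (G c q ` E q)" using Lag_coords_iff[OF Lag_subset[OF EL] cq] by simp
    have sp: "G c q ` E q = span {G c q (s i q), G c q (s j q)}"
      unfolding s(2)[OF q(2)] gcoords_span ij(2) by simp
    have d2: "dim {G c q (s i q), G c q (s j q)} = 2" using L n sp by (simp add: LagR_def)
    have "orth_part (G c q (s i q)) (G c q (s j q)) \<noteq> 0"
      unfolding orth_part_nonzero_iff
    proof
      show "G c q (s i q) \<noteq> 0" using d2 by (auto simp: dim_insert span_zero split: if_splits)
      show "G c q (s j q) \<notin> span {G c q (s i q)}"
      proof
        assume "G c q (s j q) \<in> span {G c q (s i q)}"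
        then have "dim (insert (G c q (s j q)) {G c q (s i q)}) = dim {G c q (s i q)}" by (simp only: dim_insert if_True)
        then show False using d2 by (simp add: insert_commute split: if_splits)
      qed
    qed
    then show ?thesis using L n sp unfolding ci by (auto simp: LagR_def span_base)
  qed
  have "smooth_subspace_map_on ?S (Eloc c E)"
    by (rule smooth_subspace_map_on_span[OF S sm[of i] sm[of j]]) (use props in auto)
  then show "\<exists>U. open U \<and> x \<in> U \<and> smooth_subspace_map_on U (Eloc c E)"
    using S p U by (intro exI[of _ ?S]) auto
qed

text \<open>
  Frames may be given by their components in one chart around each point.
\<close>
lemma almost_diracI_chart:
  assumes E: "E \<in> (\<Pi>\<^sub>E p\<in>topspace M. Lag (T p))"
    and frames: "\<And>p. p \<in> topspace M \<Longrightarrow> \<exists>c U (f :: 'n \<Rightarrow> real ^ 'n \<Rightarrow> (real ^ 'n) \<times> (real ^ 'n)).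
      c \<in> A \<and> openin M U \<and> p \<in> U \<and> U \<subseteq> fst c \<and> (\<forall>i. smooth_on (snd c ` U) (f i)) \<and>
      (\<forall>q\<in>U. G c q ` E q = span (range (\<lambda>i. f i (snd c q))))"
  shows "almost_dirac M A E"
  unfolding almost_dirac_def
proof (intro conjI ballI E)
  fix p assume "p \<in> topspace M"
  from frames[OF this] obtain c U and f :: "'n \<Rightarrow> real ^ 'n \<Rightarrow> (real ^ 'n) \<times> (real ^ 'n)" where
    c: "c \<in> A" and U: "openin M U" "p \<in> U" "U \<subseteq> fst c" and fall: "\<forall>i. smooth_on (snd c ` U) (f i)"
      "\<forall>q\<in>U. G c q ` E q = span (range (\<lambda>i. f i (snd c q)))"
    by (elim exE conjE) (rule that)
  have f: "smooth_on (snd c ` U) (f i)" "q \<in> U \<Longrightarrow> G c q ` E q = span (range (\<lambda>i. f i (snd c q)))" for i q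
    using fall by auto
  define s where "s = (\<lambda>i q. gvector_of c q (f i (snd c q)))"
  have cq: "c \<in> charts_at A q" if "q \<in> U" for q using that U(3) c by (auto intro: charts_at_mem)
  have sm: "smooth_gsection_on A U (s i)" for i
  proof (rule smooth_gsection_onI[OF c U(1,3)])
    show "s i q \<in> TT q" if "q \<in> U" for q unfolding s_def by (rule gvector_of_in[OF cq[OF that]])
    show "smooth_on (snd c ` U) (gloc c (s i))"
    proof (rule smooth_on_cong[OF open_chart_image_subset[OF c U(1,3)] _ f(1)])
      fix x assume "x \<in> snd c ` U"
      then obtain q where q: "q \<in> U" "x = snd c q" by auto
      then have "chart_inv c x = q" using chart_inv_left[OF c] U(3) by auto
      then show "f i x = gloc c (s i) x" using coords_gvector_of[OF cq[OF q(1)]] q by (simp add: s_def)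
    qed
  qed
  have "E q = span (range (\<lambda>i. s i q))" if q: "q \<in> U" for q
  proof -
    have qM: "q \<in> topspace M" using q U(1) openin_subset by blast
    have ET: "E q \<subseteq> TT q" using E qM by (intro Lag_subset) (simp add: PiE_def Pi_def)
    have "s i q \<in> TT q" for i unfolding s_def by (rule gvector_of_in[OF cq[OF q]])
    then have sT: "span (range (\<lambda>i. s i q)) \<subseteq> TT q"
      by (intro span_minimal[OF _ subspace_TT[OF cq[OF q]]]) blast
    have "G c q ` span (range (\<lambda>i. s i q)) = G c q ` E q"
      unfolding gcoords_span f(2)[OF q] by (simp add: image_image s_def coords_gvector_of[OF cq[OF q]])
    then show ?thesis using inj_on_image_eq_iff[OF inj_on_gvector_coords[OF cq[OF q]] ET sT] by simp
  qed
  then show "\<exists>U s. openin M U \<and> p \<in> U \<and> (\<forall>i::'n. smooth_gsection_on A U (s i)) \<and>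
        (\<forall>q\<in>U. E q = span (range (\<lambda>i. s i q)))"
    using U sm by blast
qed

text \<open>
  The projections to nearby fibres of a basis of the fibre at \<open>p\<close> stay independent near \<open>p\<close>, since
  \<^const>\<open>orth_part\<close> is continuous.
\<close>
lemma smooth_subspace_map_imp_almost_dirac:
  assumes n: "CARD('n) = 2" and E: "E \<in> (\<Pi>\<^sub>E p\<in>topspace M. Lag (T p))"
    and sm: "\<And>c. c \<in> A \<Longrightarrow> smooth_subspace_map_on (snd c ` fst c) (Eloc c E)"
  shows "almost_dirac M A E"
proof (rule almost_diracI_chart[OF E])
  fix p assume p: "p \<in> topspace M"
  obtain c where cp: "c \<in> charts_at A p" using charts_at_nonempty[OF p] by blast
  then have c: "c \<in> A" "p \<in> fst c" using charts_atD by blast+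
  obtain i j :: 'n where ij: "i \<noteq> j" "UNIV = {i, j}" by (rule card_2_UNIV[OF n])
  let ?S = "snd c ` fst c"
  have S: "open ?S" by (rule open_chart_image[OF c(1)])
  have W: "subspace (G c q ` E q)" "dim (G c q ` E q) = 2" if q: "q \<in> fst c" for q
  proof -
    have EL: "E q \<in> Lag (T q)" using E q chart_subset[OF c(1)] by (auto simp: PiE_def Pi_def)
    then have "LagR (G c q ` E q)" using Lag_coords_iff[OF Lag_subset[OF EL] charts_at_mem[OF c(1) q]] by simp
    then show "subspace (G c q ` E q)" "dim (G c q ` E q) = 2" using n by (auto simp: LagR_def)
  qed
  obtain a b where ab: "a \<in> G c p ` E p" "b \<in> G c p ` E p" "orth_part a b \<noteq> 0" by (rule plane_basis[OF W(2)[OF c(2)]])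
  define f where "f = (\<lambda>k x. closest_point (Eloc c E x) (if k = i then a else b))"
  have fsm: "smooth_on ?S (f k)" for k using sm[OF c(1)] unfolding smooth_subspace_map_on_def f_def by blast
  define h where "h = (\<lambda>x. orth_part (f i x) (f j x))"
  have osm: "smooth_on ?S h" unfolding h_def by (rule smooth_on_orth_part[OF S fsm fsm])
  define V where "V = ?S \<inter> h -` (- {0})"
  have V: "open V" unfolding V_def by (rule continuous_open_preimage[OF smooth_on_continuous[OF osm] S]) auto
  let ?U = "{q \<in> fst c. snd c q \<in> V}"
  have "closest_point (G c p ` E p) a = a" by (rule closest_point_self[OF ab(1)])
  moreover have "closest_point (G c p ` E p) b = b" by (rule closest_point_self[OF ab(2)])
  ultimately have "h (snd c p) = orth_part a b" using ij(1) by (simp add: h_def f_def chart_inv_left[OF c])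
  then have pU: "p \<in> ?U" using c ab(3) by (simp add: V_def)
  have span: "G c q ` E q = span (range (\<lambda>k. f k (snd c q)))" if q: "q \<in> ?U" for q
  proof -
    have qc: "q \<in> fst c" using q by simp
    have "f k (snd c q) \<in> G c q ` E q" for k
    proof -
      have "G c q ` E q \<noteq> {}" using subspace_0[OF W(1)[OF qc]] by blast
      from closest_point_in_set[OF closed_subspace[OF W(1)[OF qc]] this] show ?thesis
        by (simp only: f_def chart_inv_left[OF c(1) qc])
    qed
    moreover have "orth_part (f i (snd c q)) (f j (snd c q)) \<noteq> 0" using q by (simp add: V_def h_def)
    ultimately have "G c q ` E q = span {f i (snd c q), f j (snd c q)}"
      by (intro plane_eq_span W qc)
    then show ?thesis by (simp add: ij(2))
  qed
  show "\<exists>c U (f :: 'n \<Rightarrow> real ^ 'n \<Rightarrow> (real ^ 'n) \<times> (real ^ 'n)). c \<in> A \<and> openin M U \<and> p \<in> U \<and> U \<subseteq> fst c \<and>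
      (\<forall>i. smooth_on (snd c ` U) (f i)) \<and> (\<forall>q\<in>U. G c q ` E q = span (range (\<lambda>i. f i (snd c q))))"
    by (intro exI[of _ c] exI[of _ ?U] exI[of _ f] conjI ballI allI c(1) openin_chart_preimage[OF c(1) V] pU span
        smooth_on_subset[OF fsm]) auto
qed

theorem even_almost_dirac_iff:
  assumes "CARD('n) = 2"
  shows "almost_dirac M A E \<and> even_structure M A E \<longleftrightarrow> E \<in> smooth_Lag_even_sections M A"
proof
  assume a: "almost_dirac M A E \<and> even_structure M A E"
  then have "E \<in> (\<Pi>\<^sub>E p\<in>topspace M. Lag_even (T p))"
    by (auto simp: almost_dirac_def even_structure_def PiE_def)
  then show "E \<in> smooth_Lag_even_sections M A"
    unfolding smooth_Lag_even_sections_def using almost_dirac_imp_smooth_subspace_map[OF assms] a by blast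
next
  assume e: "E \<in> smooth_Lag_even_sections M A"
  then have E: "E \<in> (\<Pi>\<^sub>E p\<in>topspace M. Lag_even (T p))"
    and sm: "\<And>c. c \<in> A \<Longrightarrow> smooth_subspace_map_on (snd c ` fst c) (Eloc c E)"
    by (auto simp: smooth_Lag_even_sections_def)
  have "E \<in> (\<Pi>\<^sub>E p\<in>topspace M. Lag (T p))" using E by (auto simp: PiE_def Pi_def Lag_even_def)
  from smooth_subspace_map_imp_almost_dirac[OF assms this sm] E
  show "almost_dirac M A E \<and> even_structure M A E" by (auto simp: even_structure_def PiE_def Pi_def)
qed

end

section \<open>Foliations of surfaces as line fields\<close>

lemma inner_2: "u \<bullet> v = u $ 1 * v $ 1 + u $ 2 * v $ 2" for u v :: "real ^ 2"
  by (simp add: inner_vec_def sum_2)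

lemma vec2_eqI: "u $ 1 = v $ 1 \<Longrightarrow> u $ 2 = v $ 2 \<Longrightarrow> u = v" for u v :: "real ^ 2"
  by (simp add: vec_eq_iff forall_2)

lemma perp_unique_2:
  fixes u w w' :: "real ^ 2"
  assumes "u \<noteq> 0" "w \<noteq> 0" "w \<bullet> u = 0" "w' \<bullet> u = 0"
  obtains k where "w' = k *\<^sub>R w"
proof -
  define J :: "real ^ 2" where "J = vector [- (u $ 2), u $ 1]"
  have uu: "u \<bullet> u \<noteq> 0" using assms(1) by simp
  have J: "z = ((z \<bullet> J) / (u \<bullet> u)) *\<^sub>R J" if "z \<bullet> u = 0" for z
  proof -
    have e: "z $ 1 * u $ 1 = - (z $ 2 * u $ 2)" using that by (simp add: inner_2)
    have "(u \<bullet> u) *\<^sub>R z = (z \<bullet> J) *\<^sub>R J"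
    proof (rule vec2_eqI)
      have "(z \<bullet> J) * - (u $ 2) = z $ 1 * (u $ 2 * u $ 2) - (z $ 2 * u $ 2) * u $ 1"
        by (simp add: inner_2 J_def algebra_simps)
      also have "\<dots> = (u \<bullet> u) * z $ 1" unfolding minus_mult_minus using e by (simp add: inner_2 algebra_simps)
      finally show "((u \<bullet> u) *\<^sub>R z) $ 1 = ((z \<bullet> J) *\<^sub>R J) $ 1" by (simp add: J_def)
      have "(z \<bullet> J) * u $ 1 = - ((z $ 1 * u $ 1) * u $ 2) + z $ 2 * (u $ 1 * u $ 1)"
        by (simp add: inner_2 J_def algebra_simps)
      also have "\<dots> = (u \<bullet> u) * z $ 2" unfolding e by (simp add: inner_2 algebra_simps)
      finally show "((u \<bullet> u) *\<^sub>R z) $ 2 = ((z \<bullet> J) *\<^sub>R J) $ 2" by (simp add: J_def)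
    qed
    then have "(1 / (u \<bullet> u)) *\<^sub>R (u \<bullet> u) *\<^sub>R z = (1 / (u \<bullet> u)) *\<^sub>R (z \<bullet> J) *\<^sub>R J" by simp
    then show ?thesis using uu by simp
  qed
  have "w \<bullet> J \<noteq> 0" using J[OF assms(3)] assms(2) by auto
  then have "J = ((u \<bullet> u) / (w \<bullet> J)) *\<^sub>R w"
    using arg_cong[OF J[OF assms(3)], of "\<lambda>z. ((u \<bullet> u) / (w \<bullet> J)) *\<^sub>R z"] uu by simp
  then have "w' = (((w' \<bullet> J) / (u \<bullet> u)) * ((u \<bullet> u) / (w \<bullet> J))) *\<^sub>R w"
    using J[OF assms(4)] by (metis scaleR_scaleR)
  then show thesis by (rule that)
qed

text \<open>
  A transition map sends plaques to plaques locally if and only if its derivative preserves the horizontal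
  direction.  This lemma and the next are the two implications; in the next one the second component
  is constant along horizontal segments, which stay in the ball.
\<close>
lemma horizontal_derivative_if_foliated:
  fixes \<tau> :: "real ^ 2 \<Rightarrow> real ^ 2"
  assumes N: "open N" "z \<in> N" "\<And>x. x \<in> N \<Longrightarrow> \<tau> x $ 2 = g (x $ 2)"
    and d: "(\<tau> has_derivative \<tau>') (at z)" and u: "u $ 2 = 0"
  shows "\<tau>' u $ 2 = 0"
proof -
  have line: "((\<lambda>t. z + t *\<^sub>R u) has_derivative (\<lambda>t. t *\<^sub>R u)) (at 0)"
    by (auto intro!: derivative_eq_intros)
  have "((\<lambda>t. \<tau> (z + t *\<^sub>R u) $ 2) has_derivative (\<lambda>t. \<tau>' (t *\<^sub>R u) $ 2)) (at 0)"
    by (rule bounded_linear.has_derivative[OF bounded_linear_vec_nth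
        has_derivative_compose[where f = "\<lambda>t. z + t *\<^sub>R u" and g = \<tau>, OF line]]) (use d in simp)
  moreover have "((\<lambda>t. \<tau> (z + t *\<^sub>R u) $ 2) has_derivative (\<lambda>t. 0)) (at 0)"
  proof (rule has_derivative_transform_within_open[OF has_derivative_const])
    show "open ((\<lambda>t. z + t *\<^sub>R u) -` N)" by (intro open_vimage N continuous_intros)
    show "0 \<in> (\<lambda>t. z + t *\<^sub>R u) -` N" using N by simp
    show "g (z $ 2) = \<tau> (z + t *\<^sub>R u) $ 2" if "t \<in> (\<lambda>t. z + t *\<^sub>R u) -` N" for t
      using N(3)[of "z + t *\<^sub>R u"] that u by simp
  qed
  ultimately have "(\<lambda>t. \<tau>' (t *\<^sub>R u) $ 2) = (\<lambda>t. 0)" by (rule has_derivative_unique)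
  from fun_cong[OF this, of 1] show ?thesis by simp
qed

lemma foliated_if_horizontal_derivative:
  fixes \<tau> :: "real ^ 2 \<Rightarrow> real ^ 2"
  assumes d: "\<And>x. x \<in> ball z e \<Longrightarrow> (\<tau> has_derivative \<tau>' x) (at x)"
    and h: "\<And>x u. x \<in> ball z e \<Longrightarrow> u $ 2 = 0 \<Longrightarrow> \<tau>' x u $ 2 = 0"
    and x: "x \<in> ball z e"
  shows "\<tau> x $ 2 = \<tau> (vector [z $ 1, x $ 2]) $ 2"
proof -
  define x' :: "real ^ 2" where "x' = vector [z $ 1, x $ 2]"
  have "norm (z - x') = \<bar>z $ 2 - x $ 2\<bar>"
    by (simp add: x'_def norm_eq_sqrt_inner inner_2 power2_eq_square[symmetric])
  also have "\<dots> \<le> norm (z - x)" using component_le_norm_cart[of "z - x" 2] by simp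
  finally have x': "x' \<in> ball z e" using x by (simp add: dist_norm)
  have seg: "x + t *\<^sub>R (x' - x) \<in> ball z e" if "t \<in> {0..1}" for t
    using convexD_alt[OF convex_ball x x', of t] that by (simp add: algebra_simps)
  have u: "(x' - x) $ 2 = 0" by (simp add: x'_def)
  have "((\<lambda>t. \<tau> (x + t *\<^sub>R (x' - x)) $ 2) has_real_derivative 0) (at t within {0..1})" if t: "t \<in> {0..1}" for t
  proof -
    have line: "((\<lambda>t. x + t *\<^sub>R (x' - x)) has_derivative (\<lambda>t. t *\<^sub>R (x' - x))) (at t within {0..1})"
      by (auto intro!: derivative_eq_intros)
    have "((\<lambda>t. \<tau> (x + t *\<^sub>R (x' - x)) $ 2) has_derivative (\<lambda>s. \<tau>' (x + t *\<^sub>R (x' - x)) (s *\<^sub>R (x' - x)) $ 2)) (at t within {0..1})"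
      by (rule bounded_linear.has_derivative[OF bounded_linear_vec_nth
          has_derivative_compose[where f = "\<lambda>t. x + t *\<^sub>R (x' - x)" and g = \<tau>, OF line d[OF seg[OF t]]]])
    moreover have "\<tau>' (x + t *\<^sub>R (x' - x)) (s *\<^sub>R (x' - x)) $ 2 = 0" for s
      by (rule h[OF seg[OF t]]) (use u in simp)
    moreover have "(*) (0 :: real) = (\<lambda>_. 0)" by auto
    ultimately show ?thesis by (simp add: has_field_derivative_def)
  qed
  then obtain k where "\<forall>t\<in>{0..1}. \<tau> (x + t *\<^sub>R (x' - x)) $ 2 = k"
    using has_field_derivative_zero_constant[of "{0..1 :: real}" "\<lambda>t. \<tau> (x + t *\<^sub>R (x' - x)) $ 2"] by auto
  from this[THEN bspec, of 0] this[THEN bspec, of 1] show ?thesis by (simp add: x'_def)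
qed

locale smooth_surface = smooth_mfd M A for M :: "'a topology" and A :: "('a, 2) chart set"
begin

text \<open>
  The charts in which \<open>D\<close> is horizontal, that is, in which its integral curves are the plaques.
\<close>
definition adapted :: "('a \<Rightarrow> ('a, 2) tvector set) \<Rightarrow> ('a, 2) chart \<Rightarrow> bool" where
  "adapted D c \<longleftrightarrow> (\<forall>q\<in>fst c. \<forall>v\<in>D q. v c $ 2 = 0)"

text \<open>
  The fibres are nonzero subspaces; that they are lines follows where an adapted chart exists.
\<close>
definition line_field :: "('a \<Rightarrow> ('a, 2) tvector set) \<Rightarrow> bool" where
  "line_field D \<longleftrightarrow> (\<forall>p\<in>topspace M. subspace (D p) \<and> D p \<subseteq> T p \<and> (\<exists>v\<in>D p. v \<noteq> 0))"

lemma tvector_zero_iff: "v \<in> T p \<Longrightarrow> c \<in> charts_at A p \<Longrightarrow> v c = 0 \<longleftrightarrow> v = 0"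
  using tangent_eqI[of v p 0 c] subspace_0[OF subspace_tangent_space, of c p] by auto

lemma foliated_compatible_horizontal:
  assumes "foliated_compatible c d" "c \<in> charts_at A p" "d \<in> charts_at A p" "u $ 2 = 0"
  shows "trD c d p u $ 2 = 0"
proof -
  have "p \<in> fst c \<inter> fst d" using assms(2,3) by (auto simp: charts_at_def)
  from assms(1)[unfolded foliated_compatible_def, rule_format, OF this]
  obtain N and f :: "real \<Rightarrow> real \<Rightarrow> real" and g where
    N: "open N" "snd c p \<in> N" "N \<subseteq> snd c ` (fst c \<inter> fst d)"
      "\<forall>z\<in>N. transition c d z = vector [f (z $ 1) (z $ 2), g (z $ 2)]"
    by (elim exE conjE) (rule that)
  show ?thesis
    by (rule horizontal_derivative_if_foliated[OF N(1,2) _ transition_has_derivative[OF assms(2,3)] assms(4), of g])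
       (simp add: N(4))
qed

lemma foliated_compatibleI:
  assumes "c \<in> A" "d \<in> A" "\<And>p u. p \<in> fst c \<inter> fst d \<Longrightarrow> u $ 2 = 0 \<Longrightarrow> trD c d p u $ 2 = 0"
  shows "foliated_compatible c d"
  unfolding foliated_compatible_def
proof
  fix p assume p: "p \<in> fst c \<inter> fst d"
  let ?S = "snd c ` (fst c \<inter> fst d)" and ?z = "snd c p" and ?\<tau> = "transition c d"
  obtain e where e: "e > 0" "ball ?z e \<subseteq> ?S" using open_overlap[OF assms(1,2)] p by (meson imageI openE)
  have d: "(?\<tau> has_derivative jac ?\<tau> x) (at x)" if "x \<in> ball ?z e" for x
    by (rule smooth_on_has_derivative[OF transition_smooth[OF assms(1,2)]]) (use that e in blast)
  have h: "jac ?\<tau> x u $ 2 = 0" if x: "x \<in> ball ?z e" and u: "u $ 2 = 0" for x u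
  proof -
    obtain q where "q \<in> fst c \<inter> fst d" "x = snd c q" using x e by blast
    then show ?thesis using assms(3) u by simp
  qed
  have "?\<tau> x = (vector [?\<tau> (vector [x $ 1, x $ 2]) $ 1, ?\<tau> (vector [?z $ 1, x $ 2]) $ 2] :: real ^ 2)"
    if "x \<in> ball ?z e" for x
  proof (rule vec2_eqI)
    have "vector [x $ 1, x $ 2] = x" by (rule vec2_eqI) simp_all
    then show "?\<tau> x $ 1 = (vector [?\<tau> (vector [x $ 1, x $ 2]) $ 1, ?\<tau> (vector [?z $ 1, x $ 2]) $ 2] :: real ^ 2) $ 1" by simp
    show "?\<tau> x $ 2 = (vector [?\<tau> (vector [x $ 1, x $ 2]) $ 1, ?\<tau> (vector [?z $ 1, x $ 2]) $ 2] :: real ^ 2) $ 2"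
      using foliated_if_horizontal_derivative[OF d h that] by simp
  qed
  then show "\<exists>N (f :: real \<Rightarrow> real \<Rightarrow> real) (g :: real \<Rightarrow> real). open N \<and> ?z \<in> N \<and> N \<subseteq> ?S \<and>
      (\<forall>z\<in>N. ?\<tau> z = vector [f (z $ 1) (z $ 2), g (z $ 2)])"
    using e by (intro exI[of _ "ball ?z e"] exI[of _ "\<lambda>x y. ?\<tau> (vector [x, y]) $ 1"]
        exI[of _ "\<lambda>y. ?\<tau> (vector [?z $ 1, y]) $ 2"]) auto
qed

lemma adapted_line_eq:
  assumes D: "line_field D" "p \<in> topspace M" and c: "c \<in> charts_at A p" "adapted D c"
  shows "D p = {v \<in> T p. v c $ 2 = 0}"
proof
  have DT: "D p \<subseteq> T p" and sub: "subspace (D p)" using D by (auto simp: line_field_def)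
  show "D p \<subseteq> {v \<in> T p. v c $ 2 = 0}" using DT c by (auto simp: adapted_def charts_at_def)
  obtain v where v: "v \<in> D p" "v \<noteq> 0" using D by (auto simp: line_field_def)
  have vT: "v \<in> T p" using v DT by blast
  have v2: "v c $ 2 = 0" using v c by (auto simp: adapted_def charts_at_def)
  have "v c \<noteq> 0" using tvector_zero_iff[OF vT c(1)] v by simp
  then have v1: "v c $ 1 \<noteq> 0" using v2 vec2_eqI[of "v c" 0] by auto
  show "{v \<in> T p. v c $ 2 = 0} \<subseteq> D p"
  proof
    fix w assume w: "w \<in> {v \<in> T p. v c $ 2 = 0}"
    have "w = (w c $ 1 / v c $ 1) *\<^sub>R v"
    proof (rule tangent_eqI[OF _ _ c(1)])
      show "w \<in> T p" using w by simp
      show "(w c $ 1 / v c $ 1) *\<^sub>R v \<in> T p" by (rule subspace_scale[OF subspace_tangent_space[OF c(1)] vT])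
      show "w c = ((w c $ 1 / v c $ 1) *\<^sub>R v) c" using v1 v2 w by (intro vec2_eqI) auto
    qed
    then show "w \<in> D p" using subspace_scale[OF sub v(1)] by metis
  qed
qed

lemma adapted_foliated_compatible:
  assumes D: "line_field D" and c: "c \<in> A" "adapted D c" and d: "d \<in> A" "adapted D d"
  shows "foliated_compatible c d"
proof (rule foliated_compatibleI[OF c(1) d(1)])
  fix p and u :: "real ^ 2" assume p: "p \<in> fst c \<inter> fst d" and u: "u $ 2 = 0"
  have ch: "c \<in> charts_at A p" "d \<in> charts_at A p" using p c d by (auto simp: charts_at_def)
  have pM: "p \<in> topspace M" using p chart_subset[OF c(1)] by blast
  have "tvector_of A c p u \<in> D p"
    unfolding adapted_line_eq[OF D pM ch(1) c(2)] using u by (simp add: tvector_of_in[OF ch(1)] tvector_of_same[OF ch(1)])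
  then have "tvector_of A c p u d $ 2 = 0" using d(2) p by (auto simp: adapted_def)
  then show "trD c d p u $ 2 = 0" by (simp add: tvector_of_apply[OF ch(2)])
qed

lemma foliation_tangent_eq:
  assumes F: "foliation M A F" and c: "c \<in> charts_at F p"
  shows "foliation_tangent M A F p = {v \<in> T p. v c $ 2 = 0}"
proof -
  have FA: "F \<subseteq> A" and comp: "\<And>c d. c \<in> F \<Longrightarrow> d \<in> F \<Longrightarrow> foliated_compatible c d" using F by (auto simp: foliation_def)
  have cA: "c \<in> charts_at A p" and cF: "c \<in> F" using c FA by (auto simp: charts_at_def)
  have pM: "p \<in> topspace M" using chart_subset[of c] cA by (auto simp: charts_at_def)
  have "v c $ 2 = 0" if "v \<in> T p" "c' \<in> charts_at F p" "v c' $ 2 = 0" for v c'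
  proof -
    have c': "c' \<in> charts_at A p" "c' \<in> F" using that FA by (auto simp: charts_at_def)
    have "trD c' c p (v c') $ 2 = 0"
      by (rule foliated_compatible_horizontal[OF comp[OF c'(2) cF] c'(1) cA that(3)])
    then show ?thesis using tangent_space_trD[OF that(1) c'(1) cA] by simp
  qed
  then show ?thesis using c pM by (auto simp: foliation_tangent_def)
qed

lemma foliation_chart_ex:
  assumes "foliation M A F" "p \<in> topspace M"
  obtains c where "c \<in> charts_at F p" "c \<in> charts_at A p"
proof -
  have "(\<Union>c\<in>F. fst c) = topspace M" "F \<subseteq> A" using assms(1) by (auto simp: foliation_def)
  then obtain c where "c \<in> F" "c \<in> A" "p \<in> fst c" using assms(2) by blast
  then show thesis using that[of c] by (simp add: charts_at_def)
qed

lemma line_field_foliation_tangent: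
  assumes F: "foliation M A F"
  shows "line_field (foliation_tangent M A F)"
  unfolding line_field_def
proof (intro ballI conjI)
  fix p assume p: "p \<in> topspace M"
  obtain c where c: "c \<in> charts_at F p" "c \<in> charts_at A p" by (rule foliation_chart_ex[OF F p])
  note eq = foliation_tangent_eq[OF F c(1)]
  show "foliation_tangent M A F p \<subseteq> T p" unfolding eq by blast
  show "subspace (foliation_tangent M A F p)"
    using subspace_tangent_space[OF c(2)] unfolding eq by (auto simp: subspace_def)
  have "tvector_of A c p (axis 1 1) \<noteq> 0"
    using tvector_of_same[OF c(2), of "axis 1 1"] by (metis axis_eq_0_iff one_neq_zero zero_fun_apply)
  then show "\<exists>v\<in>foliation_tangent M A F p. v \<noteq> 0"
    unfolding eq using tvector_of_in[OF c(2)] tvector_of_same[OF c(2)]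
    by (intro bexI[of _ "tvector_of A c p (axis 1 1)"]) (auto simp: axis_def)
qed

text \<open>
  Adapted charts are foliated compatible with each other, so maximality puts all of them into \<open>F\<close>.
  Hence \<open>F\<close> is determined by its tangent line field.
\<close>
lemma foliation_eq_adapted:
  assumes F: "foliation M A F"
  shows "F = {c \<in> A. adapted (foliation_tangent M A F) c}"
proof
  let ?D = "foliation_tangent M A F"
  have FA: "F \<subseteq> A" using F by (auto simp: foliation_def)
  show sub: "F \<subseteq> {c \<in> A. adapted ?D c}"
  proof
    fix c assume c: "c \<in> F"
    have "v c $ 2 = 0" if q: "q \<in> fst c" and v: "v \<in> ?D q" for q v
    proof -
      have "c \<in> charts_at F q" using c q by (simp add: charts_at_def)
      then show ?thesis using foliation_tangent_eq[OF F] v by blast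
    qed
    then show "c \<in> {c \<in> A. adapted ?D c}" using c FA by (auto simp: adapted_def)
  qed
  show "{c \<in> A. adapted ?D c} \<subseteq> F"
  proof
    fix c assume c: "c \<in> {c \<in> A. adapted ?D c}"
    have "foliated_compatible c d \<and> foliated_compatible d c" if "d \<in> F" for d
      using adapted_foliated_compatible[OF line_field_foliation_tangent[OF F]] c sub that by blast
    moreover have "\<forall>c\<in>A. (\<forall>d\<in>F. foliated_compatible c d \<and> foliated_compatible d c) \<longrightarrow> c \<in> F"
      using F by (auto simp: foliation_def)
    ultimately show "c \<in> F" using c by blast
  qed
qed

lemma foliation_adapted:
  assumes D: "line_field D" and cov: "\<And>p. p \<in> topspace M \<Longrightarrow> \<exists>c\<in>A. p \<in> fst c \<and> adapted D c"
  shows "foliation M A {c \<in> A. adapted D c}"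
    and "p \<in> topspace M \<Longrightarrow> foliation_tangent M A {c \<in> A. adapted D c} p = D p"
proof -
  let ?F = "{c \<in> A. adapted D c}"
  show F: "foliation M A ?F"
    unfolding foliation_def
  proof (intro conjI ballI impI)
    show "(\<Union>c\<in>?F. fst c) = topspace M" using cov chart_subset by blast
    show "foliated_compatible c d" if "c \<in> ?F" "d \<in> ?F" for c d
      using adapted_foliated_compatible[OF D] that by blast
    fix c assume c: "c \<in> A" and comp: "\<forall>d\<in>?F. foliated_compatible c d \<and> foliated_compatible d c"
    have "v c $ 2 = 0" if q: "q \<in> fst c" and v: "v \<in> D q" for q v
    proof -
      have qM: "q \<in> topspace M" using q chart_subset[OF c] by blast
      obtain d where d: "d \<in> A" "q \<in> fst d" "adapted D d" using cov[OF qM] by blast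
      have ch: "c \<in> charts_at A q" "d \<in> charts_at A q" using c d q by (auto simp: charts_at_def)
      have "v \<in> T q" using D qM v by (auto simp: line_field_def)
      moreover have "trD d c q (v d) $ 2 = 0"
      proof (rule foliated_compatible_horizontal[OF _ ch(2,1)])
        show "foliated_compatible d c" using comp d by blast
        show "v d $ 2 = 0" using d v by (auto simp: adapted_def)
      qed
      ultimately show ?thesis using tangent_space_trD[OF _ ch(2,1)] by simp
    qed
    then show "c \<in> ?F" using c by (auto simp: adapted_def)
  qed blast
  assume p: "p \<in> topspace M"
  obtain c where c: "c \<in> charts_at ?F p" "c \<in> charts_at A p" by (rule foliation_chart_ex[OF F p])
  have "adapted D c" using c(1) by (simp add: charts_at_def)
  then show "foliation_tangent M A ?F p = D p"
    using foliation_tangent_eq[OF F c(1)] adapted_line_eq[OF D p c(2)] by simp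
qed

end

section \<open>Odd Lagrangians as line fields\<close>

abbreviation hor :: "(real ^ 2) \<times> (real ^ 2)" where "hor \<equiv> (axis 1 1, 0)"
abbreviation ver :: "(real ^ 2) \<times> (real ^ 2)" where "ver \<equiv> (0, axis 2 1)"

lemma orth_part_split:
  fixes u w :: "real ^ 2"
  assumes "u \<noteq> 0" "w \<noteq> 0"
  shows "orth_part (u, 0 :: real ^ 2) (0, w) \<noteq> 0"
  using assms by (simp add: orth_part_def zero_prod_def)

lemma span_split: "span {(u :: real ^ 2, 0), (0, w :: real ^ 2)} = {(r *\<^sub>R u, s *\<^sub>R w) | r s. True}"
proof -
  have "span {(u, 0), (0, w)} = {x. \<exists>r s. x = r *\<^sub>R (u, 0) + s *\<^sub>R (0, w)}"
    by (auto simp: span_insert span_singleton algebra_simps)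
  then show ?thesis by auto
qed

lemma dim_split:
  fixes u w :: "real ^ 2"
  assumes "u \<noteq> 0" "w \<noteq> 0"
  shows "dim {(u, 0 :: real ^ 2), (0, w)} = 2"
proof -
  have "(0, w) \<notin> span {(u, 0 :: real ^ 2)}" "(u, 0 :: real ^ 2) \<noteq> 0"
    using orth_part_split[OF assms] unfolding orth_part_nonzero_iff by auto
  then have "dim (insert (0, w) {(u, 0 :: real ^ 2)}) = 2" by (simp add: dim_insert)
  then show ?thesis by (simp add: insert_commute)
qed

context smooth_surface begin

text \<open>
  The intersection of \<open>W\<close> with the vertical plane has odd dimension, so it is neither zero nor all of
  \<open>W\<close>.  Take \<open>(0, w)\<close> in the intersection and \<open>(u, w')\<close> in \<open>W\<close> with \<open>u \<noteq> 0\<close>.  Isotropy makes both \<open>w\<close>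
  and \<open>w'\<close> orthogonal to \<open>u\<close>, hence parallel in the plane, and \<open>(u, 0)\<close> lies in \<open>W\<close> as well.
\<close>
lemma odd_Lagrangian_split:
  assumes W: "LagR W" and odd: "odd (dim (W \<inter> ({0} \<times> UNIV)))"
  obtains u w :: "real ^ 2" where "u \<noteq> 0" "w \<noteq> 0" "w \<bullet> u = 0" "W = span {(u, 0), (0, w)}"
proof -
  have sub: "subspace W" and d2: "dim W = 2" and iso: "\<And>a b. a \<in> W \<Longrightarrow> b \<in> W \<Longrightarrow> ip a b = 0"
    using W by (auto simp: LagR_def)
  let ?V = "W \<inter> ({0} \<times> UNIV)"
  have "\<not> ?V \<subseteq> {0}"
  proof
    assume "?V \<subseteq> {0}"
    then have d0: "dim ?V = 0" by (simp only: dim_eq_0)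
    from odd[unfolded d0] show False by simp
  qed
  then obtain w where w: "(0, w) \<in> W" "w \<noteq> 0" by (auto simp: zero_prod_def)
  have "\<not> W \<subseteq> {0} \<times> UNIV"
  proof
    assume "W \<subseteq> {0} \<times> UNIV"
    then have "?V = W" by blast
    then show False using odd d2 by simp
  qed
  then obtain u w' where u: "(u, w') \<in> W" "u \<noteq> 0" by auto
  have wu: "w \<bullet> u = 0" using iso[OF w(1) u(1)] by (simp add: ip_def)
  have w'u: "w' \<bullet> u = 0" using iso[OF u(1) u(1)] by (simp add: ip_def)
  obtain k where k: "w' = k *\<^sub>R w" by (rule perp_unique_2[OF u(2) w(2) wu w'u])
  have "(u, w') - k *\<^sub>R (0, w) \<in> W" by (intro subspace_diff subspace_scale sub u w)
  then have "(u, 0) \<in> W" using k by simp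
  then have "W = span {(u, 0), (0, w)}" by (intro plane_eq_span sub d2 w(1) orth_part_split[OF u(2) w(2)])
  then show thesis using that u w wu by blast
qed

lemma Lag_odd_iff_coords:
  assumes L: "L \<in> Lag (T p)" and c: "c \<in> charts_at A p"
  shows "L \<in> Lag_odd (T p) \<longleftrightarrow> odd (dim (G c p ` L \<inter> ({0} \<times> UNIV)))"
proof -
  have LT: "L \<subseteq> TT p" using L by (rule Lag_subset)
  have "G c p ` (L \<inter> ({0} \<times> T' p)) = G c p ` L \<inter> ({0} \<times> UNIV)"
  proof
    show "G c p ` (L \<inter> ({0} \<times> T' p)) \<subseteq> G c p ` L \<inter> ({0} \<times> UNIV)" by (auto simp: gvector_coords_def)
    show "G c p ` L \<inter> ({0} \<times> UNIV) \<subseteq> G c p ` (L \<inter> ({0} \<times> T' p))"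
    proof
      fix g assume "g \<in> G c p ` L \<inter> ({0} \<times> UNIV)"
      then obtain a where a: "a \<in> L" "g = G c p a" "fst a c = 0" by (auto simp: gvector_coords_def)
      have "fst a \<in> T p" "snd a \<in> T' p" using a LT by auto
      then have "a \<in> {0} \<times> T' p" using tvector_zero_iff[OF _ c] a(3) by (simp add: mem_Times_iff)
      then show "g \<in> G c p ` (L \<inter> ({0} \<times> T' p))" using a by blast
    qed
  qed
  moreover have "dim (G c p ` (L \<inter> ({0} \<times> T' p))) = dim (L \<inter> ({0} \<times> T' p))"
  proof (rule dim_coords[OF _ _ c])
    show "L \<inter> ({0} \<times> T' p) \<subseteq> TT p" using LT by blast
    show "subspace (L \<inter> ({0} \<times> T' p))"
      using L by (intro subspace_inter subspace_Times subspace_dual_space subspace_single_0) (simp add: Lag_def)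
  qed
  ultimately show ?thesis using L by (simp add: Lag_odd_def Lag_type_def)
qed

text \<open>
  In adapted charts \<open>D \<oplus> Ann D\<close> is the constant plane spanned by \<open>\<partial>\<^sub>1\<close> and \<open>dx\<^sup>2\<close>, which gives its
  smooth frames.
\<close>
lemma coords_plus_annihilator:
  assumes D: "line_field D" "p \<in> topspace M" and c: "c \<in> charts_at A p" "adapted D c"
  shows "plus_annihilator M A D p \<subseteq> TT p" "G c p ` plus_annihilator M A D p = span {hor, ver}"
proof -
  note Deq = adapted_line_eq[OF D c]
  have E: "plus_annihilator M A D p = D p \<times> annihilator (T p) (D p)" using D(2) by (simp add: plus_annihilator_def)
  show sub: "plus_annihilator M A D p \<subseteq> TT p" unfolding E Deq annihilator_def by blast
  have hv: "span {hor, ver} = {(u, w). u $ 2 = 0 \<and> w $ 1 = 0}"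
  proof -
    have "(u, w) \<in> {(r *\<^sub>R axis 1 1, s *\<^sub>R axis 2 1) | r s. True} \<longleftrightarrow> u $ 2 = 0 \<and> w $ 1 = 0" for u w :: "real ^ 2"
    proof
      assume "u $ 2 = 0 \<and> w $ 1 = 0"
      then have "u = (u $ 1) *\<^sub>R axis 1 1" "w = (w $ 2) *\<^sub>R axis 2 1" by (auto intro!: vec2_eqI simp: axis_def)
      then show "(u, w) \<in> {(r *\<^sub>R axis 1 1, s *\<^sub>R axis 2 1) | r s. True}" by blast
    qed (auto simp: axis_def)
    then show ?thesis unfolding span_split by auto
  qed
  show "G c p ` plus_annihilator M A D p = span {hor, ver}"
  proof
    show "G c p ` plus_annihilator M A D p \<subseteq> span {hor, ver}"
    proof
      fix g assume "g \<in> G c p ` plus_annihilator M A D p"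
      then obtain v \<xi> where a: "v \<in> D p" "\<xi> \<in> annihilator (T p) (D p)" "g = (v c, covector_coords A c p \<xi>)"
        unfolding E by (auto simp: gvector_coords_def)
      have "tvector_of A c p (axis 1 1) \<in> D p"
        unfolding Deq by (simp add: tvector_of_in[OF c(1)] tvector_of_same[OF c(1)] axis_def)
      then have "covector_coords A c p \<xi> $ 1 = 0" using a(2) by (simp add: covector_coords_def annihilator_def)
      moreover have "v c $ 2 = 0" using a(1) Deq by simp
      ultimately show "g \<in> span {hor, ver}" unfolding hv a(3) by simp
    qed
    show "span {hor, ver} \<subseteq> G c p ` plus_annihilator M A D p"
    proof
      fix g assume g: "g \<in> span {hor, ver}"
      then have g2: "fst g $ 2 = 0" "snd g $ 1 = 0" unfolding hv by auto
      have "tvector_of A c p (fst g) \<in> D p"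
        unfolding Deq using g2 by (simp add: tvector_of_in[OF c(1)] tvector_of_same[OF c(1)])
      moreover have "covector_of c p (snd g) \<in> annihilator (T p) (D p)"
        unfolding annihilator_def Deq using covector_of_in[OF c(1)] g2 by (simp add: covector_of_def inner_2)
      ultimately have "gvector_of c p g \<in> plus_annihilator M A D p" unfolding E by (simp add: gvector_of_def)
      then show "g \<in> G c p ` plus_annihilator M A D p" using coords_gvector_of[OF c(1), of g] by (metis imageI)
    qed
  qed
qed

lemma LagR_hor_ver: "LagR (span {hor, ver})" "dim (span {hor, ver} \<inter> ({0} \<times> UNIV)) = 1"
proof -
  have ax: "(axis k 1 :: real ^ 2) \<noteq> 0" for k by (simp add: axis_eq_0_iff)
  have "ip a b = 0" if "a \<in> span {hor, ver}" "b \<in> span {hor, ver}" for a b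
    using that unfolding span_split by (auto simp: ip_def inner_2 axis_def)
  then show "LagR (span {hor, ver})" using dim_split[OF ax ax] by (simp add: LagR_def)
  have "span {hor, ver} \<inter> ({0} \<times> UNIV) = span {ver}"
    unfolding span_split span_singleton using ax[of 1] by auto
  then show "dim (span {hor, ver} \<inter> ({0} \<times> UNIV)) = 1" using ax[of 2] by (simp add: zero_prod_def)
qed

lemma plus_annihilator_odd_dirac:
  assumes D: "line_field D" and cov: "\<And>p. p \<in> topspace M \<Longrightarrow> \<exists>c\<in>A. p \<in> fst c \<and> adapted D c"
  shows "dirac M A (plus_annihilator M A D)" "odd_structure M A (plus_annihilator M A D)"
proof -
  let ?E = "plus_annihilator M A D"
  have EL: "?E p \<in> Lag (T p)" "?E p \<in> Lag_odd (T p)" if p: "p \<in> topspace M" for p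
  proof -
    obtain c where c: "c \<in> A" "p \<in> fst c" "adapted D c" using cov[OF p] by blast
    have cp: "c \<in> charts_at A p" using c by (simp add: charts_at_mem)
    note co = coords_plus_annihilator[OF D p cp c(3)]
    show L: "?E p \<in> Lag (T p)" unfolding Lag_coords_iff[OF co(1) cp] co(2) by (rule LagR_hor_ver)
    show "?E p \<in> Lag_odd (T p)" unfolding Lag_odd_iff_coords[OF L cp] co(2) LagR_hor_ver by simp
  qed
  then show "odd_structure M A ?E" by (simp add: odd_structure_def)
  have "almost_dirac M A ?E"
  proof (rule almost_diracI_chart)
    show "?E \<in> (\<Pi>\<^sub>E p\<in>topspace M. Lag (T p))" using EL(1) by (auto simp: plus_annihilator_def)
    fix p assume p: "p \<in> topspace M"
    obtain c where c: "c \<in> A" "p \<in> fst c" "adapted D c" using cov[OF p] by blast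
    define f where "f = (\<lambda>(i :: 2) (x :: real ^ 2). if i = 1 then hor else ver)"
    have "G c q ` ?E q = span (range (\<lambda>i. f i (snd c q)))" if q: "q \<in> fst c" for q
    proof -
      have "range (\<lambda>i. f i (snd c q)) = {hor, ver}" unfolding UNIV_2 by (auto simp: f_def)
      then show ?thesis
        using coords_plus_annihilator(2)[OF D _ charts_at_mem[OF c(1) q] c(3)] q chart_subset[OF c(1)] by auto
    qed
    moreover have "smooth_on (snd c ` fst c) (f i)" for i
      unfolding f_def by (intro smooth_on_const open_chart_image c)
    ultimately show "\<exists>c U (f :: 2 \<Rightarrow> real ^ 2 \<Rightarrow> (real ^ 2) \<times> (real ^ 2)). c \<in> A \<and> openin M U \<and> p \<in> U \<and> U \<subseteq> fst c \<and>
      (\<forall>i. smooth_on (snd c ` U) (f i)) \<and> (\<forall>q\<in>U. G c q ` ?E q = span (range (\<lambda>i. f i (snd c q))))"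
      using c openin_chart[OF c(1)] by (intro exI[of _ c] exI[of _ "fst c"] exI[of _ f]) blast
  qed
  then show "dirac M A ?E" using almost_dirac_involutive by (simp add: dirac_def)
qed

text \<open>
  The atlas is maximal, so it contains the composition of a chart with any diffeomorphism between open sets.
\<close>
lemma compose_chart:
  assumes c: "c \<in> A" and V: "open V" "V \<subseteq> snd c ` fst c" and W: "open W"
    and \<phi>: "smooth_on V \<phi>" "\<And>z. z \<in> V \<Longrightarrow> \<phi> z \<in> W \<and> \<psi> (\<phi> z) = z"
    and \<psi>: "smooth_on W \<psi>" "\<And>w. w \<in> W \<Longrightarrow> \<psi> w \<in> V \<and> \<phi> (\<psi> w) = w"
  defines "U \<equiv> {q \<in> fst c. snd c q \<in> V}"
  shows "(U, restrict (\<phi> \<circ> snd c) U) \<in> A"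
proof -
  define d where "d = (U, restrict (\<phi> \<circ> snd c) U)"
  have Uo: "openin M U" unfolding U_def by (rule openin_chart_preimage[OF c V(1)])
  have Uc: "U \<subseteq> fst c" by (auto simp: U_def)
  have UM: "U \<subseteq> topspace M" using Uo openin_subset by blast
  have img: "snd c ` U = V" using V(2) by (auto simp: U_def)
  have dq: "snd d q = \<phi> (snd c q)" if "q \<in> U" for q using that by (simp add: d_def)
  have fd: "fst d = U" by (simp add: d_def)
  have imgd: "snd d ` Q = \<phi> ` (snd c ` Q)" if "Q \<subseteq> U" for Q
    unfolding image_image by (rule image_cong) (use dq that in auto)
  have \<phi>V: "\<phi> ` V = W" using \<phi>(2) \<psi>(2) by force
  have imgW: "snd d ` U = W" using imgd[OF order_refl] img \<phi>V by simp
  have op: "open (\<phi> ` Q)" if "open Q" "Q \<subseteq> V" for Q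
  proof -
    have "\<phi> ` Q = W \<inter> \<psi> -` Q" using \<phi>(2) \<psi>(2) that(2) by force
    then show ?thesis using continuous_open_preimage[OF smooth_on_continuous[OF \<psi>(1)] W that(1)] by simp
  qed
  have inj: "inj_on (snd d) U"
  proof (rule inj_onI)
    fix q r assume qr: "q \<in> U" "r \<in> U" "snd d q = snd d r"
    then have "snd c q = snd c r" using \<phi>(2) img dq by (metis imageI)
    then show "q = r" using qr Uc chart_inj[OF c] by (auto dest: inj_onD)
  qed
  have tU: "topspace (subtopology M U) = U" using UM by auto
  have hm: "homeomorphic_map (subtopology M U) (top_of_set W) (snd d)"
  proof (rule bijective_open_imp_homeomorphic_map)
    have "continuous_map (subtopology M U) (top_of_set (snd c ` fst c)) (snd c)"
      using continuous_map_from_subtopology_mono[OF homeomorphic_imp_continuous_map[OF chart_homeo[OF c]] Uc] .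
    then have "continuous_map (subtopology M U) euclidean (snd c)"
      using continuous_map_into_fulltopology by blast
    then have "continuous_map (subtopology M U) (top_of_set V) (snd c)"
      using img UM by (auto simp: continuous_map_in_subtopology)
    moreover have "continuous_map (top_of_set V) (top_of_set W) \<phi>"
      using smooth_on_continuous[OF \<phi>(1)] \<phi>V by (auto simp: continuous_map_in_subtopology)
    ultimately have "continuous_map (subtopology M U) (top_of_set W) (\<phi> \<circ> snd c)"
      by (rule continuous_map_compose)
    then show "continuous_map (subtopology M U) (top_of_set W) (snd d)"
      by (rule continuous_map_eq) (use dq UM in auto)
    show "open_map (subtopology M U) (top_of_set W) (snd d)"
      unfolding open_map_def
    proof (intro allI impI)
      fix Q assume "openin (subtopology M U) Q"
      then have Q: "openin M Q" "Q \<subseteq> U" using openin_open_subtopology[OF Uo] by auto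
      have "open (snd c ` Q)" by (rule open_chart_image_subset[OF c Q(1)]) (use Q(2) Uc in blast)
      then have "open (snd d ` Q)" unfolding imgd[OF Q(2)] using Q(2) img by (intro op) blast+
      moreover have "snd d ` Q \<subseteq> W" using Q(2) imgW by blast
      ultimately show "openin (top_of_set W) (snd d ` Q)" using openin_open_eq[OF W] by blast
    qed
    show "snd d ` topspace (subtopology M U) = topspace (top_of_set W)" using imgW tU by simp
    show "inj_on (snd d) (topspace (subtopology M U))" using inj tU by simp
  qed
  have ch: "chart_on M d"
    unfolding chart_on_def fd imgW using Uo W hm by (simp add: d_def)
  have dinv: "chart_inv d (snd d q) = q" if "q \<in> U" for q using inj that fd by simp
  have "smoothly_compatible d e" if e: "e \<in> A" for e
    unfolding smoothly_compatible_def fd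
  proof
    have Ue: "openin M (U \<inter> fst e)" using Uo openin_chart[OF e] by blast
    have So: "open (snd c ` (U \<inter> fst e))" by (rule open_chart_image_subset[OF c Ue]) (use Uc in blast)
    have Sd: "open (snd d ` (U \<inter> fst e))" unfolding imgd[OF Int_lower1] by (rule op[OF So]) (use img in blast)
    have Se: "open (snd e ` (U \<inter> fst e))" by (rule open_chart_image_subset[OF e Ue]) blast
    have "smooth_on (snd d ` (U \<inter> fst e)) (\<lambda>w. transition c e (\<psi> w))"
    proof (rule smooth_on_compose[OF Sd So, where f = \<psi> and g = "transition c e"])
      show "smooth_on (snd d ` (U \<inter> fst e)) \<psi>" by (rule smooth_on_subset[OF \<psi>(1)]) (use imgW in blast)
      show "smooth_on (snd c ` (U \<inter> fst e)) (transition c e)"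
        by (rule smooth_on_subset[OF transition_smooth[OF c e]]) (use Uc in blast)
      show "\<psi> w \<in> snd c ` (U \<inter> fst e)" if "w \<in> snd d ` (U \<inter> fst e)" for w
        using that dq \<phi>(2) img by auto
    qed
    then show "smooth_on (snd d ` (U \<inter> fst e)) (transition d e)"
    proof (rule smooth_on_cong[OF Sd, rotated])
      fix w assume "w \<in> snd d ` (U \<inter> fst e)"
      then obtain q where q: "q \<in> U" "w = snd d q" by blast
      have "\<psi> w = snd c q" using q dq \<phi>(2) img by auto
      then show "transition c e (\<psi> w) = transition d e w"
        using q dinv transition_apply[OF c] Uc by (auto simp: transition_def)
    qed
    have "smooth_on (snd e ` (U \<inter> fst e)) (\<lambda>y. \<phi> (transition e c y))"
    proof (rule smooth_on_compose[OF Se V(1) _ _ \<phi>(1)])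
      show "smooth_on (snd e ` (U \<inter> fst e)) (transition e c)"
        by (rule smooth_on_subset[OF transition_smooth[OF e c]]) (use Uc in blast)
      show "transition e c y \<in> V" if y: "y \<in> snd e ` (U \<inter> fst e)" for y
      proof -
        obtain q where q: "q \<in> U" "q \<in> fst e" "y = snd e q" using y by blast
        then have "transition e c y = snd c q" using transition_apply[OF e q(2)] by simp
        then show ?thesis using q(1) img by blast
      qed
    qed
    then show "smooth_on (snd e ` (U \<inter> fst e)) (transition e d)"
    proof (rule smooth_on_cong[OF Se, rotated])
      fix y assume "y \<in> snd e ` (U \<inter> fst e)"
      then obtain q where q: "q \<in> U" "q \<in> fst e" "y = snd e q" by blast
      then show "\<phi> (transition e c y) = transition e d y"
        using transition_apply[OF e] dq by simp
    qed
  qed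
  then show ?thesis using ch smooth_manifold unfolding smooth_manifold_def d_def by blast
qed

text \<open>
  A flow box for a local vector field that spans \<open>D\<close> is composed with a chart.
\<close>
lemma adapted_chart_exists:
  assumes D: "line_field D" and one: "\<And>q v w. q \<in> topspace M \<Longrightarrow> v \<in> D q \<Longrightarrow> v \<noteq> 0 \<Longrightarrow> w \<in> D q \<Longrightarrow> \<exists>k. w = k *\<^sub>R v"
    and U: "openin M U" "p \<in> U" and c: "c \<in> A" "p \<in> fst c"
    and X: "\<And>q. q \<in> U \<Longrightarrow> X q \<in> D q" "X p \<noteq> 0" "smooth_on (snd c ` (fst c \<inter> U)) (vf_local c X)"
  shows "\<exists>d\<in>A. p \<in> fst d \<and> adapted D d"
proof -
  let ?S = "snd c ` (fst c \<inter> U)"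
  have UM: "U \<subseteq> topspace M" using U openin_subset by blast
  have S: "open ?S" by (rule open_chart_image_Int[OF c(1) U(1)])
  have XT: "X q \<in> T q" if "q \<in> U" for q using D X(1)[OF that] UM that by (auto simp: line_field_def)
  have Xl: "vf_local c X (snd c q) = X q c" if "q \<in> fst c" for q using that c by (simp add: vf_local_def chart_inv_left)
  define S0 where "S0 = ?S \<inter> vf_local c X -` (- {0})"
  have S0: "open S0" unfolding S0_def by (rule continuous_open_preimage[OF smooth_on_continuous[OF X(3)] S]) auto
  have pc: "X p c \<noteq> 0" using tvector_zero_iff[OF XT[OF U(2)] charts_at_mem[OF c]] X(2) by simp
  have pS: "snd c p \<in> S0" using c U pc Xl[OF c(2)] by (auto simp: S0_def)
  have sm: "smooth_on S0 (vf_local c X)" by (rule smooth_on_subset[OF X(3)]) (auto simp: S0_def)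
  have nz: "vf_local c X (snd c p) \<noteq> 0" using pc Xl[OF c(2)] by simp
  obtain V W and \<phi> \<psi> :: "real ^ 2 \<Rightarrow> real ^ 2" where F: "open V" "open W" "snd c p \<in> V" "V \<subseteq> S0"
    "smooth_on V \<phi>" "smooth_on W \<psi>"
    "\<And>z. z \<in> V \<Longrightarrow> \<phi> z \<in> W \<and> \<psi> (\<phi> z) = z" "\<And>w. w \<in> W \<Longrightarrow> \<psi> w \<in> V \<and> \<phi> (\<psi> w) = w"
    "\<And>z. z \<in> V \<Longrightarrow> jac \<phi> z (vf_local c X z) $ 2 = 0"
    by (rule flow_box[OF S0 pS sm nz]) (assumption | blast)+
  let ?U = "{q \<in> fst c. snd c q \<in> V}"
  define d where "d = (?U, restrict (\<phi> \<circ> snd c) ?U)"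
  have dA: "d \<in> A" unfolding d_def
    by (rule compose_chart[OF c(1) F(1) _ F(2,5,7,6,8)]) (use F(4) in \<open>auto simp: S0_def\<close>)
  have pd: "p \<in> fst d" using c F(3) by (simp add: d_def)
  have "v d $ 2 = 0" if q: "q \<in> fst d" and v: "v \<in> D q" for q v
  proof -
    have qc: "q \<in> fst c" and qV: "snd c q \<in> V" using q by (auto simp: d_def)
    have qS: "snd c q \<in> S0" using qV F(4) by blast
    then obtain r where r: "r \<in> fst c" "r \<in> U" "snd c q = snd c r" by (auto simp: S0_def)
    then have qU: "q \<in> U" using chart_inj[OF c(1)] qc by (metis inj_onD)
    have cq: "c \<in> charts_at A q" and dq: "d \<in> charts_at A q" using c dA q qc by (auto simp: charts_at_mem)
    have qM: "q \<in> topspace M" using qU UM by blast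
    have "X q c \<noteq> 0" using qS Xl[OF qc] by (auto simp: S0_def)
    then have "X q \<noteq> 0" by auto
    from one[OF qM X(1)[OF qU] this v] obtain k where k: "v = k *\<^sub>R X q" by blast
    have tr: "trD c d q = jac \<phi> (snd c q)"
    proof (rule frechet_derivative_cong_open[OF F(1) qV])
      fix z assume z: "z \<in> V"
      then obtain r where "r \<in> fst c" "z = snd c r" using F(4) by (auto simp: S0_def)
      then show "transition c d z = \<phi> z" using z transition_apply[OF c(1), of r d] by (simp add: d_def)
    qed
    have "X q d = trD c d q (X q c)" by (rule tangent_space_trD[OF XT[OF qU] cq dq])
    then have "X q d $ 2 = 0" using F(9)[OF qV] Xl[OF qc] tr by simp
    then show ?thesis using k by simp
  qed
  then have "adapted D d" by (simp add: adapted_def)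
  then show ?thesis using dA pd by blast
qed

text \<open>
  The line field is the projection of \<open>E\<close> to the tangent bundle; the tangent part of a member of a local frame
  that is nonzero at \<open>p\<close> spans it near \<open>p\<close>.
\<close>
lemma odd_dirac_from_foliation:
  assumes E: "almost_dirac M A E" "odd_structure M A E"
  obtains F where "foliation M A F" "plus_annihilator M A (foliation_tangent M A F) = E"
proof -
  define D where "D = (\<lambda>p. fst ` E p)"
  have EL: "E p \<in> Lag (T p)" if "p \<in> topspace M" for p by (rule almost_diracD(1)[OF E(1) that])
  have split: "\<exists>u w. u \<noteq> 0 \<and> w \<noteq> 0 \<and> w \<bullet> u = 0 \<and> G c p ` E p = span {(u, 0), (0, w)}"
    if p: "p \<in> topspace M" and c: "c \<in> charts_at A p" for p c
  proof -
    have L: "LagR (G c p ` E p)" using Lag_coords_iff[OF Lag_subset[OF EL[OF p]] c] EL[OF p] by simp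
    have "odd (dim (G c p ` E p \<inter> ({0} \<times> UNIV)))"
      using Lag_odd_iff_coords[OF EL[OF p] c] E(2) p by (simp add: odd_structure_def)
    from odd_Lagrangian_split[OF L this] show ?thesis by metis
  qed
  have memE: "a \<in> E p \<longleftrightarrow> (\<exists>r s. G c p a = (r *\<^sub>R u, s *\<^sub>R w))"
    if p: "p \<in> topspace M" and c: "c \<in> charts_at A p" and uw: "G c p ` E p = span {(u, 0), (0, w)}" and a: "a \<in> TT p"
    for p c u w a
  proof -
    have "a \<in> E p \<longleftrightarrow> G c p a \<in> G c p ` E p"
      using inj_on_image_mem_iff[OF inj_on_gvector_coords[OF c] a Lag_subset[OF EL[OF p]]] by simp
    then show ?thesis unfolding uw span_split by blast
  qed
  have memD: "v \<in> D p \<longleftrightarrow> (\<exists>r. v c = r *\<^sub>R u)"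
    if p: "p \<in> topspace M" and c: "c \<in> charts_at A p" and uw: "G c p ` E p = span {(u, 0), (0, w)}" and v: "v \<in> T p"
    for p c u w v
  proof
    assume "v \<in> D p"
    then obtain \<xi> where x: "(v, \<xi>) \<in> E p" by (auto simp: D_def)
    then have "(v, \<xi>) \<in> TT p" using Lag_subset[OF EL[OF p]] by blast
    from memE[OF p c uw this] x show "\<exists>r. v c = r *\<^sub>R u" by (auto simp: gvector_coords_def)
  next
    assume "\<exists>r. v c = r *\<^sub>R u"
    then obtain r where r: "v c = r *\<^sub>R u" by blast
    have "(v, covector_of c p 0) \<in> TT p" using v covector_of_in[OF c] by simp
    moreover have "G c p (v, covector_of c p 0) = (r *\<^sub>R u, 0 *\<^sub>R w)"
      using r by (simp add: gvector_coords_def covector_coords_of[OF c])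
    ultimately have "(v, covector_of c p 0) \<in> E p" using memE[OF p c uw] by blast
    then show "v \<in> D p" unfolding D_def by force
  qed
  have DT: "D p \<subseteq> T p" if "p \<in> topspace M" for p using Lag_subset[OF EL[OF that]] by (auto simp: D_def)
  have D: "line_field D"
    unfolding line_field_def
  proof (intro ballI conjI)
    fix p assume p: "p \<in> topspace M"
    obtain c where c: "c \<in> charts_at A p" using charts_at_nonempty[OF p] by blast
    obtain u w where uw: "u \<noteq> 0" "G c p ` E p = span {(u, 0), (0, w)}" using split[OF p c] by blast
    have "subspace (E p)" using EL[OF p] by (simp add: Lag_def)
    then show "subspace (D p)" unfolding D_def by (rule linear_subspace_image[OF linear_fst])
    show "D p \<subseteq> T p" by (rule DT[OF p])
    have "tvector_of A c p u \<in> D p"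
      unfolding memD[OF p c uw(2) tvector_of_in[OF c]] tvector_of_same[OF c] by (rule exI[of _ 1]) simp
    moreover have "tvector_of A c p u \<noteq> 0" using tvector_of_same[OF c, of u] uw(1) by auto
    ultimately show "\<exists>v\<in>D p. v \<noteq> 0" by blast
  qed
  have one: "\<exists>k. w = k *\<^sub>R v" if q: "q \<in> topspace M" and vw: "v \<in> D q" "v \<noteq> 0" "w \<in> D q" for q v w
  proof -
    obtain c where c: "c \<in> charts_at A q" using charts_at_nonempty[OF q] by blast
    obtain x y where xy: "x \<noteq> 0" "G c q ` E q = span {(x, 0), (0, y)}" using split[OF q c] by blast
    have vT: "v \<in> T q" "w \<in> T q" using vw DT[OF q] by auto
    obtain r s where rs: "v c = r *\<^sub>R x" "w c = s *\<^sub>R x" using memD[OF q c xy(2)] vT vw by blast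
    have "r \<noteq> 0" using tvector_zero_iff[OF vT(1) c] vw(2) rs by auto
    have "w = (s / r) *\<^sub>R v"
      by (rule tangent_eqI[OF vT(2) subspace_scale[OF subspace_tangent_space[OF c] vT(1)] c])
         (use rs \<open>r \<noteq> 0\<close> in simp)
    then show ?thesis by blast
  qed
  have cov: "\<exists>d\<in>A. p \<in> fst d \<and> adapted D d" if p: "p \<in> topspace M" for p
  proof -
    obtain c where "c \<in> charts_at A p" using charts_at_nonempty[OF p] by blast
    then have c: "c \<in> A" "p \<in> fst c" using charts_atD by blast+
    obtain U s where U: "openin M U" "p \<in> U" and s: "\<And>i::2. smooth_gsection_on A U (s i)"
        "\<And>q. q \<in> U \<Longrightarrow> E q = span (range (\<lambda>i. s i q))"
      using almost_diracD(2)[OF E(1) p] by blast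
    have "\<exists>i. fst (s i p) \<noteq> 0"
    proof (rule ccontr)
      assume "\<not> ?thesis"
      then have "s i p \<in> {0} \<times> UNIV" for i by (simp add: mem_Times_iff)
      then have "E p \<subseteq> {0} \<times> UNIV"
        unfolding s(2)[OF U(2)]
        by (intro span_minimal subspace_Times subspace_single_0 subspace_UNIV) blast
      then have "D p \<subseteq> {0}" by (auto simp: D_def)
      then show False using D p by (auto simp: line_field_def)
    qed
    then obtain i where i: "fst (s i p) \<noteq> 0" by blast
    show ?thesis
    proof (rule adapted_chart_exists[OF D one U c, where X = "fst \<circ> s i"])
      show "(fst \<circ> s i) q \<in> D q" if "q \<in> U" for q using s(2)[OF that] by (auto simp: D_def span_base)
      show "(fst \<circ> s i) p \<noteq> 0" using i by simp
      show "smooth_on (snd c ` (fst c \<inter> U)) (vloc c (s i))" by (rule smooth_on_loc(1)[OF s(1) U(1) c(1)])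
    qed
  qed
  let ?F = "{c \<in> A. adapted D c}"
  have fol: "foliation M A ?F" by (rule foliation_adapted(1)[OF D]) (rule cov)
  have tan: "foliation_tangent M A ?F p = D p" if "p \<in> topspace M" for p
    by (rule foliation_adapted(2)[OF D _ that]) (rule cov)
  have "plus_annihilator M A (foliation_tangent M A ?F) p = E p" for p
  proof (cases "p \<in> topspace M")
    case False
    then show ?thesis using almost_diracD(3)[OF E(1) False] by (simp add: plus_annihilator_def)
  next
    case p: True
    obtain c where c: "c \<in> charts_at A p" using charts_at_nonempty[OF p] by blast
    obtain u w where uw: "u \<noteq> 0" "w \<noteq> 0" "w \<bullet> u = 0" "G c p ` E p = span {(u, 0), (0, w)}"
      using split[OF p c] by blast
    have uD: "tvector_of A c p u \<in> D p"
      unfolding memD[OF p c uw(4) tvector_of_in[OF c]] tvector_of_same[OF c] by (rule exI[of _ 1]) simp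
    have "a \<in> D p \<times> annihilator (T p) (D p) \<longleftrightarrow> a \<in> E p" for a
    proof
      assume a: "a \<in> E p"
      have aT: "fst a \<in> T p" "snd a \<in> T' p" using a Lag_subset[OF EL[OF p]] by auto
      then obtain r s where rs: "G c p a = (r *\<^sub>R u, s *\<^sub>R w)" using memE[OF p c uw(4), of a] a by (auto simp: mem_Times_iff)
      have "snd a v = 0" if v: "v \<in> D p" for v
      proof -
        have vT: "v \<in> T p" using v DT[OF p] by blast
        obtain k where "v c = k *\<^sub>R u" using memD[OF p c uw(4) vT] v by blast
        moreover have "covector_coords A c p (snd a) = s *\<^sub>R w" using rs by (simp add: gvector_coords_def)
        ultimately show ?thesis using covector_eq[OF aT(2) c vT] uw(3) by simp
      qed
      then show "a \<in> D p \<times> annihilator (T p) (D p)"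
        using a aT by (simp add: mem_Times_iff annihilator_def D_def)
    next
      assume a: "a \<in> D p \<times> annihilator (T p) (D p)"
      have aT: "fst a \<in> T p" "snd a \<in> T' p" using a DT[OF p] by (auto simp: annihilator_def)
      obtain r where r: "fst a c = r *\<^sub>R u" using memD[OF p c uw(4) aT(1)] a by (auto simp: mem_Times_iff)
      have "snd a (tvector_of A c p u) = 0" using a uD by (auto simp: annihilator_def)
      then have "covector_coords A c p (snd a) \<bullet> u = 0"
        using covector_eq[OF aT(2) c tvector_of_in[OF c]] by (simp add: tvector_of_same[OF c])
      then obtain k where "covector_coords A c p (snd a) = k *\<^sub>R w" by (rule perp_unique_2[OF uw(1-3)])
      then have "G c p a = (r *\<^sub>R u, k *\<^sub>R w)" using r by (simp add: gvector_coords_def)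
      then show "a \<in> E p" using memE[OF p c uw(4), of a] aT by (auto simp: mem_Times_iff)
    qed
    then have "D p \<times> annihilator (T p) (D p) = E p" by blast
    moreover have "plus_annihilator M A (foliation_tangent M A ?F) p = D p \<times> annihilator (T p) (D p)"
      by (simp only: plus_annihilator_def restrict_apply p if_True tan[OF p])
    ultimately show ?thesis by (rule trans[rotated])
  qed
  then show thesis using that[OF fol] by blast
qed

lemma foliation_covered:
  assumes "foliation M A F" "p \<in> topspace M"
  shows "\<exists>c\<in>A. p \<in> fst c \<and> adapted (foliation_tangent M A F) c"
proof -
  obtain c where c: "c \<in> charts_at F p" by (rule foliation_chart_ex[OF assms])
  then have "c \<in> F" "p \<in> fst c" by (auto simp: charts_at_def)
  then show ?thesis using foliation_eq_adapted[OF assms(1)] by blast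
qed

lemma plus_annihilator_foliation_inj:
  assumes F: "foliation M A F" and F': "foliation M A F'"
    and eq: "plus_annihilator M A (foliation_tangent M A F) = plus_annihilator M A (foliation_tangent M A F')"
  shows "F = F'"
proof -
  have "foliation_tangent M A F p = foliation_tangent M A F' p" for p
  proof (cases "p \<in> topspace M")
    case False
    then show ?thesis by (simp add: foliation_tangent_def)
  next
    case p: True
    have rec: "fst ` plus_annihilator M A D p = D p" for D :: "'a \<Rightarrow> ('a, 2) tvector set"
    proof -
      have "0 \<in> annihilator (T p) (D p)" using subspace_0[OF subspace_dual_space] by (simp add: annihilator_def)
      then have "annihilator (T p) (D p) \<noteq> {}" by blast
      then show ?thesis using p by (simp add: plus_annihilator_def)
    qed
    show ?thesis using rec[of "foliation_tangent M A F"] rec[of "foliation_tangent M A F'"] eq by simp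
  qed
  then have "foliation_tangent M A F = foliation_tangent M A F'" by blast
  then show ?thesis using foliation_eq_adapted[OF F] foliation_eq_adapted[OF F'] by simp
qed

end

theorem theorem3p1:
  fixes M :: "'a topology" and A :: "('a, 2) chart set"
  assumes "smooth_manifold M A"
  shows "{E. dirac M A E \<and> even_structure M A E} = smooth_Lag_even_sections M A \<and>
    (\<forall>E. almost_dirac M A E \<and> even_structure M A E \<longrightarrow> involutive M A E) \<and>
    bij_betw (\<lambda>F. plus_annihilator M A (foliation_tangent M A F))
      {F. foliation M A F} {E. dirac M A E \<and> odd_structure M A E}"
proof -
  interpret smooth_surface M A by unfold_locales (rule assms)
  have two: "CARD(2) = 2" by simp
  have inv: "involutive M A E" if "almost_dirac M A E" for E
    by (rule almost_dirac_involutive[OF two that])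
  have even: "{E. dirac M A E \<and> even_structure M A E} = smooth_Lag_even_sections M A"
    using even_almost_dirac_iff[OF two] inv unfolding dirac_def by blast
  have "bij_betw (\<lambda>F. plus_annihilator M A (foliation_tangent M A F))
      {F. foliation M A F} {E. dirac M A E \<and> odd_structure M A E}"
    unfolding bij_betw_def
  proof
    show "inj_on (\<lambda>F. plus_annihilator M A (foliation_tangent M A F)) {F. foliation M A F}"
      by (rule inj_onI) (use plus_annihilator_foliation_inj in blast)
    show "(\<lambda>F. plus_annihilator M A (foliation_tangent M A F)) ` {F. foliation M A F} = {E. dirac M A E \<and> odd_structure M A E}"
    proof
      show "(\<lambda>F. plus_annihilator M A (foliation_tangent M A F)) ` {F. foliation M A F} \<subseteq> {E. dirac M A E \<and> odd_structure M A E}"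
        using plus_annihilator_odd_dirac[OF line_field_foliation_tangent foliation_covered] by blast
      show "{E. dirac M A E \<and> odd_structure M A E} \<subseteq> (\<lambda>F. plus_annihilator M A (foliation_tangent M A F)) ` {F. foliation M A F}"
      proof
        fix E assume "E \<in> {E. dirac M A E \<and> odd_structure M A E}"
        then have E: "almost_dirac M A E" "odd_structure M A E" by (auto simp: dirac_def)
        obtain F where "foliation M A F" "plus_annihilator M A (foliation_tangent M A F) = E"
          by (rule odd_dirac_from_foliation[OF E])
        then show "E \<in> (\<lambda>F. plus_annihilator M A (foliation_tangent M A F)) ` {F. foliation M A F}" by blast
      qed
    qed
  qed
  with even inv show ?thesis by blast
qed

end
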